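(* Let $\mathcal{Q}$ be a set of prime powers with the following property: every $q\in\mathcal{Q}$ can be written as $q=r_1^{e_1}\cdots r_m^{e_m}t+1$, where $r_1,\ldots,r_m$ are distinct primes, $e_1,\ldots,e_m,t\geq 1$ are integers with $\gcd(r_1\cdots r_m,t)=1$, such that $r_1+\cdots+r_m+t=O(\mathrm{poly}(\log q))$, and such that for each $1\leq j\leq m$ a primitive $z_j$-th root of unity in $\mathbb{F}_q$ can be computed in time polynomial in $\log q$, where $z_j=4$ if $r_j=2$ and $z_j=r_j$ otherwise. Then for $q\in\mathcal{Q}$ and $r\in\{r_1,\ldots,r_m\}$ there is a deterministic polynomial-time (in $\log q$) algorithm which, given any $r$-th residue $\beta\in\mathbb{F}_q$, computes an $r$-th root of $\beta$ in $\mathbb{F}_q$. Equivalently, there is a deterministic polynomial-time algorithm constructing an $r$-th nonresidue in $\mathbb{F}_q$.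
   Context: $\mathbb{F}_q$ denotes the finite field with $q$ elements. An $r$-th residue is an element $\beta\in\mathbb{F}_q^\times$ with $\beta=\alpha^r$ for some $\alpha\in\mathbb{F}_q$; an $r$-th nonresidue is an element of $\mathbb{F}_q^\times$ that is not an $r$-th power. The set of all $q$ admitting such a representation (with $t$ arbitrary) is denoted $\overline{\mathcal{Q}}=\bigcup_{t\geq1}\mathcal{Q}_t$ in the paper. Running times are measured in bit operations. *)

theory Defs
  imports
    "HOL-Algebra.Ring"
    "HOL-Computational_Algebra.Polynomial"
    "HOL-Number_Theory.Prime_Powers"
    "HOL-Library.Log_Nat"
begin

section \<open>Explicitly presented finite fields\<close>

text \<open>
  The pair \<open>(p, f)\<close> of a prime \<open>p\<close> and a monic polynomial \<open>f\<close> that is irreducible modulo \<open>p\<close>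
  presents the field \<open>\<int>[X]/(p, f)\<close>. Its elements are the integer polynomials of degree less than
  \<open>degree f\<close> with coefficients in \<open>{0..<p}\<close>. As \<open>f\<close> is monic, \<open>pseudo_mod a f\<close> is the ordinary
  remainder of \<open>a\<close> on division by \<open>f\<close>.
\<close>

definition reduce :: "nat \<Rightarrow> int poly \<Rightarrow> int poly \<Rightarrow> int poly" where
  "reduce p f a = map_poly (\<lambda>c. c mod int p) (pseudo_mod a f)"

definition Fq :: "nat \<times> int poly \<Rightarrow> int poly ring" where
  "Fq = (\<lambda>(p, f).
     \<lparr> carrier = {a. degree a < degree f \<and> (\<forall>i. coeff a i \<in> {0..<int p})},
       monoid.mult = (\<lambda>a b. reduce p f (a * b)),
       one = 1,
       zero = 0,
       add = (\<lambda>a b. reduce p f (a + b)) \<rparr>)"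

text \<open>For prime \<open>p\<close> and monic \<open>f\<close>, being a field says exactly that \<open>f\<close> is irreducible modulo \<open>p\<close>.\<close>

definition field_presentation :: "nat \<times> int poly \<Rightarrow> bool" where
  "field_presentation = (\<lambda>(p, f).
     prime p \<and> lead_coeff f = 1 \<and> (\<forall>i. coeff f i \<in> {0..<int p}) \<and> field (Fq (p, f)))"

definition field_size :: "nat \<times> int poly \<Rightarrow> nat" where
  "field_size K = card (carrier (Fq K))"

definition primitive_root_of_unity :: "('a, 'b) ring_scheme \<Rightarrow> nat \<Rightarrow> 'a \<Rightarrow> bool" where
  "primitive_root_of_unity F z \<zeta> \<longleftrightarrow> \<zeta> \<in> carrier F \<and> z > 0 \<and> \<zeta> [^]\<^bsub>F\<^esub> z = \<one>\<^bsub>F\<^esub> \<and>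
     (\<forall>k. 0 < k \<and> k < z \<longrightarrow> \<zeta> [^]\<^bsub>F\<^esub> k \<noteq> \<one>\<^bsub>F\<^esub>)"

definition residues_of_power :: "('a, 'b) ring_scheme \<Rightarrow> nat \<Rightarrow> 'a set" where
  "residues_of_power F r =
     {\<beta> \<in> carrier F - {\<zero>\<^bsub>F\<^esub>}. \<exists>\<alpha>\<in>carrier F. \<beta> = \<alpha> [^]\<^bsub>F\<^esub> r}"

definition nonresidues_of_power :: "('a, 'b) ring_scheme \<Rightarrow> nat \<Rightarrow> 'a set" where
  "nonresidues_of_power F r =
     {\<beta> \<in> carrier F - {\<zero>\<^bsub>F\<^esub>}. \<not> (\<exists>\<alpha>\<in>carrier F. \<beta> = \<alpha> [^]\<^bsub>F\<^esub> r)}"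


section \<open>Deterministic algorithms and bit costs\<close>

text \<open>
  Algorithms are structured programs over registers that hold natural numbers, with logarithmic
  cost: every operation is charged (up to a constant factor, at least) the number of bit operations
  of its schoolbook implementation, and reading, writing or testing a number is charged its length.
  A program mentions finitely many registers, so there is no addressing cost. Up to polynomial
  factors this running time is that of a multitape Turing machine.
\<close>

datatype aexp =
    Const nat
  | Reg nat
  | Add aexp aexp
  | Sub aexp aexp
  | Mul aexp aexp
  | Div aexp aexp
  | Mod aexp aexp

datatype program =
    Skip
  | Assign nat aexp
  | Seq program program
  | Cond aexp program program
  | While aexp program

type_synonym registers = "nat \<Rightarrow> nat"

fun aval :: "aexp \<Rightarrow> registers \<Rightarrow> nat" where
  "aval (Const n) s = n"
| "aval (Reg x) s = s x"
| "aval (Add a b) s = aval a s + aval b s"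
| "aval (Sub a b) s = aval a s - aval b s"
| "aval (Mul a b) s = aval a s * aval b s"
| "aval (Div a b) s = aval a s div aval b s"
| "aval (Mod a b) s = aval a s mod aval b s"

text \<open>\<open>floorlog 2 n\<close> is the number of binary digits of \<open>n\<close>.\<close>

abbreviation bits :: "nat \<Rightarrow> nat" where
  "bits n \<equiv> floorlog 2 n"

fun acost :: "aexp \<Rightarrow> registers \<Rightarrow> nat" where
  "acost (Const n) s = 1 + bits n"
| "acost (Reg x) s = 1 + bits (s x)"
| "acost (Add a b) s = acost a s + acost b s + (1 + bits (aval a s) + bits (aval b s))"
| "acost (Sub a b) s = acost a s + acost b s + (1 + bits (aval a s) + bits (aval b s))"
| "acost (Mul a b) s = acost a s + acost b s + (1 + bits (aval a s)) * (1 + bits (aval b s))"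
| "acost (Div a b) s = acost a s + acost b s + (1 + bits (aval a s)) * (1 + bits (aval b s))"
| "acost (Mod a b) s = acost a s + acost b s + (1 + bits (aval a s)) * (1 + bits (aval b s))"

text \<open>
  \<open>exec c s n s'\<close>: started in \<open>s\<close>, the program \<open>c\<close> halts in \<open>s'\<close> after \<open>n\<close> bit operations.
  A condition holds if its value is nonzero.
\<close>

inductive exec :: "program \<Rightarrow> registers \<Rightarrow> nat \<Rightarrow> registers \<Rightarrow> bool" where
  Skip: "exec Skip s 1 s"
| Assign: "exec (Assign x a) s (1 + acost a s + bits (aval a s)) (s(x := aval a s))"
| Seq: "exec c1 s n1 s1 \<Longrightarrow> exec c2 s1 n2 s2 \<Longrightarrow> exec (Seq c1 c2) s (n1 + n2) s2"
| CondTrue: "aval b s \<noteq> 0 \<Longrightarrow> exec c1 s n s1 \<Longrightarrow> exec (Cond b c1 c2) s (1 + acost b s + n) s1"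
| CondFalse: "aval b s = 0 \<Longrightarrow> exec c2 s n s2 \<Longrightarrow> exec (Cond b c1 c2) s (1 + acost b s + n) s2"
| WhileFalse: "aval b s = 0 \<Longrightarrow> exec (While b c) s (1 + acost b s) s"
| WhileTrue: "aval b s \<noteq> 0 \<Longrightarrow> exec c s n1 s1 \<Longrightarrow> exec (While b c) s1 n2 s2 \<Longrightarrow>
    exec (While b c) s (1 + acost b s + n1 + n2) s2"

inductive_cases SkipE: "exec Skip s n s'"
  and AssignE: "exec (Assign x a) s n s'"
  and SeqE: "exec (Seq c1 c2) s n s'"
  and CondE: "exec (Cond b c1 c2) s n s'"
  and WhileE: "exec (While b c) s n s'"

lemma exec_deterministic:
  "exec c s n s' \<Longrightarrow> exec c s m u \<Longrightarrow> m = n \<and> u = s'"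
proof (induction arbitrary: m u rule: exec.induct)
  case (Seq c1 s n1 s1 c2 n2 s2)
  from Seq.prems obtain k1 t1 k2 where
    "m = k1 + k2" "exec c1 s k1 t1" "exec c2 t1 k2 u"
    by (rule SeqE) blast
  with Seq.IH show ?case by blast
next
  case (CondTrue b s c1 n s1 c2)
  from CondTrue.prems obtain k where "m = 1 + acost b s + k" "exec c1 s k u"
    by (rule CondE) (use CondTrue.hyps in auto)
  with CondTrue.IH show ?case by blast
next
  case (CondFalse b s c2 n s2 c1)
  from CondFalse.prems obtain k where "m = 1 + acost b s + k" "exec c2 s k u"
    by (rule CondE) (use CondFalse.hyps in auto)
  with CondFalse.IH show ?case by blast
next
  case (WhileFalse b s c)
  from WhileFalse.prems show ?case
    by (rule WhileE) (use WhileFalse.hyps in auto)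
next
  case (WhileTrue b s c n1 s1 n2 s2)
  from WhileTrue.prems obtain k1 t1 k2 where
    "m = 1 + acost b s + k1 + k2" "exec c s k1 t1" "exec (While b c) t1 k2 u"
    by (rule WhileE) (use WhileTrue.hyps in auto)
  with WhileTrue.IH show ?case by blast
qed (erule SkipE AssignE; simp)+

text \<open>The inputs are in the registers \<open>0, 1, \<dots>\<close>, all other registers are \<open>0\<close> initially.\<close>

definition input :: "nat list \<Rightarrow> registers" where
  "input xs = (\<lambda>i. if i < length xs then xs ! i else 0)"

text \<open>
  A search problem is a set \<open>I\<close> of instances with an encoding \<open>enc\<close>, a size \<open>sz\<close> and the set \<open>sol\<close> of
  solutions of each instance, encoded by numbers. One program has to handle all instances in \<open>I\<close>,
  leaving a solution in register \<open>0\<close>; nothing is required on other inputs.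
\<close>

definition polytime_solvable ::
  "'i set \<Rightarrow> ('i \<Rightarrow> nat list) \<Rightarrow> ('i \<Rightarrow> real) \<Rightarrow> ('i \<Rightarrow> nat set) \<Rightarrow> bool" where
  "polytime_solvable I enc sz sol \<longleftrightarrow>
     (\<exists>prog (C::real) (d::nat). \<forall>i\<in>I. \<exists>n s.
        exec prog (input (enc i)) n s \<and> real n \<le> C * sz i ^ d \<and> s 0 \<in> sol i)"


section \<open>Computational problems over finite fields\<close>

text \<open>
  The polynomial \<open>a\<close> with coefficients in \<open>{0..<p}\<close> is encoded by the number with base \<open>p\<close> digits
  \<open>coeff a i\<close>, which is the value of \<open>a\<close> at \<open>p\<close>.
\<close>

definition encode_poly :: "nat \<Rightarrow> int poly \<Rightarrow> nat" where
  "encode_poly p a = nat (poly a (int p))"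

definition encode_field :: "nat \<times> int poly \<Rightarrow> nat list" where
  "encode_field = (\<lambda>(p, f). [p, degree f, encode_poly p f])"

text \<open>
  In the following problems \<open>Ks\<close> is a set of presented fields, and the numbers \<open>r\<close> admitted for a
  field with \<open>q\<close> elements are those in \<open>R q\<close>.
\<close>

definition root_of_unity_order :: "nat \<Rightarrow> nat" where
  "root_of_unity_order r = (if r = 2 then 4 else r)"

definition roots_of_unity_polytime :: "(nat \<times> int poly) set \<Rightarrow> (nat \<Rightarrow> nat set) \<Rightarrow> bool" where
  "roots_of_unity_polytime Ks R \<longleftrightarrow> polytime_solvable
     {(K, r). K \<in> Ks \<and> r \<in> R (field_size K)}
     (\<lambda>(K, r). encode_field K @ [r])
     (\<lambda>(K, r). log 2 (real (field_size K)))
     (\<lambda>(K, r). encode_poly (fst K) `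
        {\<zeta>. primitive_root_of_unity (Fq K) (root_of_unity_order r) \<zeta>})"

definition taking_roots_polytime :: "(nat \<times> int poly) set \<Rightarrow> (nat \<Rightarrow> nat set) \<Rightarrow> bool" where
  "taking_roots_polytime Ks R \<longleftrightarrow> polytime_solvable
     {(K, r, \<beta>). K \<in> Ks \<and> r \<in> R (field_size K) \<and> \<beta> \<in> residues_of_power (Fq K) r}
     (\<lambda>(K, r, \<beta>). encode_field K @ [r, encode_poly (fst K) \<beta>])
     (\<lambda>(K, r, \<beta>). log 2 (real (field_size K)))
     (\<lambda>(K, r, \<beta>). encode_poly (fst K) ` {\<alpha> \<in> carrier (Fq K). \<alpha> [^]\<^bsub>Fq K\<^esub> r = \<beta>})"

definition nonresidues_polytime :: "(nat \<times> int poly) set \<Rightarrow> (nat \<Rightarrow> nat set) \<Rightarrow> bool" where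
  "nonresidues_polytime Ks R \<longleftrightarrow> polytime_solvable
     {(K, r). K \<in> Ks \<and> r \<in> R (field_size K)}
     (\<lambda>(K, r). encode_field K @ [r])
     (\<lambda>(K, r). log 2 (real (field_size K)))
     (\<lambda>(K, r). encode_poly (fst K) ` nonresidues_of_power (Fq K) r)"

end

theory Submission
  imports
    Defs
    "HOL-Algebra.Multiplicative_Group"
    "HOL-Number_Theory.Cong"
begin

text \<open>
  Let \<open>\<beta> = \<alpha>\<^sup>r\<close> and let \<open>\<zeta>\<close> be a primitive \<open>r\<close>-th root of unity. The algebra \<open>A = \<F>\<^sub>q[x]/(x\<^sup>r - \<beta>)\<close> is
  isomorphic to \<open>\<F>\<^sub>q\<^sup>r\<close> by evaluation at \<open>\<theta>\<^sub>j = \<zeta>\<^sup>j\<alpha>\<close>, and \<open>x \<mapsto> \<zeta>x\<close> permutes the evaluations cyclically.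
  An element \<open>h\<close> of \<open>A\<close> that vanishes at the \<open>\<theta>\<^sub>j\<close> with \<open>j\<close> in a proper nonempty set \<open>J\<close> yields a
  root: for the idempotent \<open>\<epsilon> = h\<^bsup>q-1\<^esup>\<close> the norm of \<open>x(1 - \<epsilon>) + \<epsilon>\<close> is the product of the \<open>\<theta>\<^sub>j\<close> with
  \<open>j \<in> J\<close>, which is \<open>\<zeta>\<^sup>m\<alpha>\<^sup>k\<close> with \<open>0 < k < r\<close>, and Euclid's algorithm on \<open>k\<close> and \<open>r\<close> gives a root of \<open>\<beta>\<close>.

  To find such an \<open>h\<close>, put \<open>y = (a - x)/(a - \<zeta>x)\<close> and \<open>u(x) = y(x)/y(\<zeta>x)\<close> for \<open>a \<in> \<F>\<^sub>q\<close>. As a function of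
  \<open>a\<close>, \<open>u(\<alpha>)\<close> takes each value at most twice, so \<open>u(\<alpha>)\<^sup>t \<noteq> 1\<close> for some \<open>a\<close> among any \<open>2t + 1\<close>. Then a
  prime \<open>s \<in> {r\<^sub>1, \<dots>, r\<^sub>m}\<close> divides the order of \<open>u(\<alpha>)\<close>; for the first \<open>i\<close> such that \<open>u\<^sup>N \<noteq> 1\<close> with
  \<open>N = (q - 1)/s\<^sup>i\<close>, all evaluations of \<open>u\<^sup>N\<close> are \<open>s\<close>-th roots of unity. If they differ, then \<open>h = u\<^sup>N - \<omega>\<^sup>k\<close>
  works, where \<open>\<omega>\<close> is the given \<open>z\<^sub>s\<close>-th root of unity. If they all equal \<open>c \<noteq> 1\<close>, then \<open>c\<^sup>r = 1\<close>, hence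
  \<open>s = r\<close>, and the evaluations of \<open>y\<^sup>N\<close> are distinct \<open>z\<^sub>r\<close>-th roots of unity \<open>w c\<^bsup>-j\<^esup>\<close>, so that
  \<open>h = y\<^sup>N - \<omega>\<^sup>k\<close> works; for \<open>r = 2\<close> these are fourth roots of unity.

  The algorithm tries all small \<open>a\<close>, \<open>s\<close>, \<open>i\<close>, \<open>k\<close> and tests each candidate. It does not know the set
  \<open>{r\<^sub>1, \<dots>, r\<^sub>m}\<close>, so the program for roots of unity is run with a clock for every small \<open>s\<close>.
\<close>

section \<open>Polynomial-time programs\<close>

text \<open>A computation in A acts on all evaluations at once, so nothing separates \<alpha> from
  its conjugates before an element with both zero and nonzero evaluations is found. Two successive
  quotients are taken because one does not suffice: if all evaluations of a power of y were the same
  c of order r, the next candidates would be powers of a - x, whose r-th powers are unknown field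
  elements. For powers of y these are under control: the product of the evaluations of y around the
  cycle is 1, so y_j^N = c y_(j+1)^N forces (y_0^N)^r = c^(r(r-1)/2). This is 1 for odd r, but it is
  c = -1 for r = 2, which is the origin of the fourth root of unity. The value u(\<alpha>) is at
  most two-to-one in a because it becomes a quadratic polynomial in v = 1/(a - \<theta>_1).
  Nonresidues are obtained by extracting r-th roots repeatedly, starting from \<zeta>, until the
  extraction fails.\<close>

definition poly_bounded :: "'a set \<Rightarrow> ('a \<Rightarrow> nat) \<Rightarrow> ('a \<Rightarrow> nat) \<Rightarrow> bool" where
  "poly_bounded I S g \<longleftrightarrow> (\<exists>k. \<forall>x\<in>I. g x \<le> (S x + 2) ^ k)"

lemma poly_bounded_mono:
  assumes "poly_bounded I S h" "\<And>x. x \<in> I \<Longrightarrow> g x \<le> h x"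
  shows "poly_bounded I S g"
  using assms unfolding poly_bounded_def by (meson order_trans)

text \<open>The offset 2 in the base makes constants powers of it at worst: c \<le> 2^c.\<close>

lemma poly_bounded_const [intro]: "poly_bounded I S (\<lambda>_. c)"
proof -
  have "c \<le> (S x + 2) ^ c" for x
  proof -
    have "c \<le> 2 ^ c" by (simp add: less_imp_le)
    also have "\<dots> \<le> (S x + 2) ^ c" by (rule power_mono) auto
    finally show ?thesis .
  qed
  then show ?thesis unfolding poly_bounded_def by blast
qed

lemma poly_bounded_mult [intro]:
  assumes "poly_bounded I S g" "poly_bounded I S h"
  shows "poly_bounded I S (\<lambda>x. g x * h x)"
proof -
  obtain k l where "\<forall>x\<in>I. g x \<le> (S x + 2) ^ k" "\<forall>x\<in>I. h x \<le> (S x + 2) ^ l"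
    using assms unfolding poly_bounded_def by blast
  then have "\<forall>x\<in>I. g x * h x \<le> (S x + 2) ^ (k + l)"
    by (simp add: power_add mult_mono)
  then show ?thesis unfolding poly_bounded_def by blast
qed

text \<open>A single power has to absorb a sum. This follows from g + h \<le> (g + 1)(h + 1), where
  adding 1 costs one more factor of the base, which is at least 2.\<close>

lemma poly_bounded_add [intro]:
  assumes "poly_bounded I S g" "poly_bounded I S h"
  shows "poly_bounded I S (\<lambda>x. g x + h x)"
proof -
  have *: "poly_bounded I S (\<lambda>x. g x + 1)" if g: "poly_bounded I S g" for g
  proof -
    obtain k where k: "\<forall>x\<in>I. g x \<le> (S x + 2) ^ k" using g unfolding poly_bounded_def by blast
    have "g x + 1 \<le> (S x + 2) ^ (k + 1)" if "x \<in> I" for x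
    proof -
      have "1 \<le> (S x + 2) ^ k" by simp
      moreover have "g x \<le> (S x + 2) ^ k" using k that by blast
      ultimately have "g x + 1 \<le> 2 * (S x + 2) ^ k" by linarith
      also have "\<dots> \<le> (S x + 2) ^ (k + 1)" by simp
      finally show ?thesis .
    qed
    then show ?thesis unfolding poly_bounded_def by blast
  qed
  have "poly_bounded I S (\<lambda>x. (g x + 1) * (h x + 1))"
    by (intro poly_bounded_mult * assms)
  then show ?thesis by (rule poly_bounded_mono) simp
qed

lemma poly_bounded_size [intro]: "poly_bounded I S S"
  unfolding poly_bounded_def by (rule exI[of _ 1]) simp

lemma poly_bounded_power [intro]:
  "poly_bounded I S g \<Longrightarrow> poly_bounded I S (\<lambda>x. g x ^ k)"
  by (induction k) auto

section \<open>Bit lengths of sums, products and powers\<close>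

lemma bits_le_iff: "bits x \<le> w \<longleftrightarrow> x < 2 ^ w"
  by (simp add: floorlog_le_iff)

lemma less_two_power_bits: "x < 2 ^ bits x"
  using bits_le_iff by blast

lemma bits_le_self: "bits x \<le> x"
  by (simp add: bits_le_iff)

lemma bits_mono: "x \<le> y \<Longrightarrow> bits x \<le> bits y"
  by (rule floorlog_mono)

lemma bits_add_le: "bits (x + y) \<le> bits x + bits y + 1"
proof -
  have "x + y < 2 ^ bits x + 2 ^ bits y" using less_two_power_bits add_strict_mono by blast
  also have "\<dots> \<le> 2 ^ (bits x + bits y) + 2 ^ (bits x + bits y)"
    by (intro add_mono power_increasing) auto
  finally show ?thesis by (simp add: bits_le_iff mult_2)
qed

lemma bits_mult_le: "bits (x * y) \<le> bits x + bits y"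
  unfolding bits_le_iff power_add
  by (metis less_two_power_bits mult_strict_mono' zero_le)

lemma bits_power_le: "bits (x ^ n) \<le> n * bits x + 1"
proof (induction n)
  case (Suc n)
  then show ?case using bits_mult_le[of x "x ^ n"] by simp
qed (simp add: floorlog_def)

text \<open>
  A context consists of a set of instances, a size measure and a set of registers known to hold given
  functions of the instance. Instances are lists of numbers: the body of a loop is run in a context
  where the loop counter has been pushed onto the instance.
\<close>

type_synonym ctx = "nat list set \<times> (nat list \<Rightarrow> nat) \<times> (nat \<times> (nat list \<Rightarrow> nat)) set"

definition insts :: "ctx \<Rightarrow> nat list set" where "insts C = fst C"
definition size_of :: "ctx \<Rightarrow> nat list \<Rightarrow> nat" where "size_of C = fst (snd C)"
definition stored :: "ctx \<Rightarrow> (nat \<times> (nat list \<Rightarrow> nat)) set" where "stored C = snd (snd C)"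

definition below :: "ctx \<Rightarrow> nat \<Rightarrow> bool" where
  "below C b \<longleftrightarrow> (\<forall>(j, g)\<in>stored C. j < b)"

definition matches :: "ctx \<Rightarrow> nat list \<Rightarrow> registers \<Rightarrow> bool" where
  "matches C xs s \<longleftrightarrow> (\<forall>(j, g)\<in>stored C. s j = g xs)"

abbreviation pbd :: "ctx \<Rightarrow> (nat list \<Rightarrow> nat) \<Rightarrow> bool" where
  "pbd C \<equiv> poly_bounded (insts C) (size_of C)"

text \<open>A stack discipline: registers below \<open>b\<close> survive, \<open>b\<close> receives
  the result, and everything above is scratch space whose initial content is arbitrary.\<close>

definition runs :: "ctx \<Rightarrow> nat \<Rightarrow> program \<Rightarrow> (nat list \<Rightarrow> nat) \<Rightarrow> (nat list \<Rightarrow> nat) \<Rightarrow> bool" where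
  "runs C b prog T f \<longleftrightarrow> (\<forall>xs\<in>insts C. \<forall>s. matches C xs s \<longrightarrow>
     (\<exists>n s'. exec prog s n s' \<and> (\<forall>j<b. s' j = s j) \<and> s' b = f xs \<and> n \<le> T xs))"

text \<open>The program may depend on the free register \<open>b\<close>, so two pieces are composed
  by compiling the second one at a higher register. The length of the value is bounded as well,
  since the value becomes the input of later steps.\<close>

definition polytime :: "ctx \<Rightarrow> (nat list \<Rightarrow> nat) \<Rightarrow> bool" where
  "polytime C f \<longleftrightarrow> pbd C (\<lambda>xs. bits (f xs)) \<and>
     (\<forall>b. below C b \<longrightarrow> (\<exists>prog T. pbd C T \<and> runs C b prog T f))"

text \<open>The number itself, not only its length, is polynomially bounded. Such functions may
  serve as loop bounds, exponents and digit positions.\<close>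

definition unary :: "ctx \<Rightarrow> (nat list \<Rightarrow> nat) \<Rightarrow> bool" where
  "unary C f \<longleftrightarrow> polytime C f \<and> pbd C f"

definition extends :: "ctx \<Rightarrow> (nat list \<Rightarrow> nat) \<Rightarrow> ctx \<Rightarrow> bool" where
  "extends C n C' \<longleftrightarrow>
     (\<forall>ys\<in>insts C'. tl ys \<in> insts C \<and> hd ys < n (tl ys) \<and> size_of C' ys = size_of C (tl ys)) \<and>
     (\<forall>(j, g)\<in>stored C. (j, \<lambda>ys. g (tl ys)) \<in> stored C')"

lemma unaryD: "unary C f \<Longrightarrow> polytime C f" "unary C f \<Longrightarrow> pbd C f"
  by (auto simp: unary_def)

lemma polytime_bits: "polytime C f \<Longrightarrow> pbd C (\<lambda>xs. bits (f xs))"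
  by (simp add: polytime_def)

lemma polytimeE:
  assumes "polytime C f" "below C b"
  obtains prog T where "pbd C T" "runs C b prog T f"
  using assms unfolding polytime_def by blast

lemma runsE:
  assumes "runs C b prog T f" "xs \<in> insts C" "matches C xs s"
  obtains n s' where "exec prog s n s'" "\<forall>j<b. s' j = s j" "s' b = f xs" "n \<le> T xs"
  using assms unfolding runs_def by blast

lemma polytime_cong:
  assumes "polytime C f" "\<And>xs. xs \<in> insts C \<Longrightarrow> f xs = g xs"
  shows "polytime C g"
proof -
  have "pbd C (\<lambda>xs. bits (g xs))"
    using polytime_bits[OF assms(1)] by (rule poly_bounded_mono) (simp add: assms(2))
  moreover have "runs C b prog T f \<Longrightarrow> runs C b prog T g" for b prog T
    unfolding runs_def using assms(2) by simp
  ultimately show ?thesis using assms(1) unfolding polytime_def by meson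
qed

lemma below_mono: "below C b \<Longrightarrow> b \<le> c \<Longrightarrow> below C c"
  unfolding below_def by fastforce

lemma matches_cong:
  "matches C xs s \<Longrightarrow> below C b \<Longrightarrow> (\<And>j. j < b \<Longrightarrow> s' j = s j) \<Longrightarrow> matches C xs s'"
  unfolding matches_def below_def by fastforce

lemma pbd_lift:
  assumes "extends C n C'" "pbd C g"
  shows "pbd C' (\<lambda>ys. g (tl ys))"
  using assms unfolding poly_bounded_def extends_def by auto

text \<open>A program compiled above all registers of the extended context runs unchanged, because
  everything the old context stores is still in place.\<close>

lemma polytime_lift:
  assumes ext: "extends C n C'" and f: "polytime C f"
  shows "polytime C' (\<lambda>ys. f (tl ys))"
  unfolding polytime_def
proof (intro conjI allI impI)
  show "pbd C' (\<lambda>ys. bits (f (tl ys)))"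
    using pbd_lift[OF ext polytime_bits[OF f]] .
  fix b assume "below C' b"
  then have "below C b" using ext unfolding below_def extends_def by fastforce
  with f obtain prog T where *: "pbd C T" "runs C b prog T f" by (rule polytimeE)
  have "matches C (tl ys) s" if "matches C' ys s" for ys s
    using that ext unfolding matches_def extends_def by fastforce
  then have "runs C' b prog (\<lambda>ys. T (tl ys)) (\<lambda>ys. f (tl ys))"
    using *(2) ext unfolding runs_def extends_def by simp
  then show "\<exists>prog T. pbd C' T \<and> runs C' b prog T (\<lambda>ys. f (tl ys))"
    using pbd_lift[OF ext *(1)] by blast
qed

lemma unary_lift:
  assumes ext: "extends C n C'" and f: "unary C f"
  shows "unary C' (\<lambda>ys. f (tl ys))"
  using assms polytime_lift pbd_lift unfolding unary_def by blast

lemma polytime_const: "polytime C (\<lambda>_. c)"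
  unfolding polytime_def
proof (intro conjI allI impI)
  fix b
  have "runs C b (Assign b (Const c)) (\<lambda>_. 1 + acost (Const c) (\<lambda>_. 0) + bits c) (\<lambda>_. c)"
    unfolding runs_def
  proof (intro ballI allI impI)
    fix xs and s :: registers
    show "\<exists>n s'. exec (Assign b (Const c)) s n s' \<and> (\<forall>j<b. s' j = s j) \<and> s' b = c \<and>
        n \<le> 1 + acost (Const c) (\<lambda>_. 0) + bits c"
      using exec.Assign[of b "Const c" s]
      by (intro exI[of _ "1 + acost (Const c) s + bits (aval (Const c) s)"] exI[of _ "s(b := aval (Const c) s)"])
        auto
  qed
  then show "\<exists>prog T. pbd C T \<and> runs C b prog T (\<lambda>_. c)"
    using poly_bounded_const by blast
qed auto

lemma polytime_stored:
  assumes "(j, g) \<in> stored C" "pbd C (\<lambda>xs. bits (g xs))"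
  shows "polytime C g"
  unfolding polytime_def
proof (intro conjI allI impI)
  fix b assume "below C b"
  have "runs C b (Assign b (Reg j)) (\<lambda>xs. 2 + bits (g xs) + bits (g xs)) g"
    unfolding runs_def
  proof (intro ballI allI impI)
    fix xs s assume "xs \<in> insts C" "matches C xs s"
    then have "s j = g xs" using assms(1) unfolding matches_def by auto
    then show "\<exists>n s'. exec (Assign b (Reg j)) s n s' \<and> (\<forall>j<b. s' j = s j) \<and> s' b = g xs \<and>
        n \<le> 2 + bits (g xs) + bits (g xs)"
      using exec.Assign[of b "Reg j" s]
      by (intro exI[of _ "1 + acost (Reg j) s + bits (aval (Reg j) s)"] exI[of _ "s(b := aval (Reg j) s)"])
        auto
  qed
  then show "\<exists>prog T. pbd C T \<and> runs C b prog T g"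
    using poly_bounded_add[OF poly_bounded_add[OF poly_bounded_const[of _ _ 2] assms(2)] assms(2)] by blast
qed fact

text \<open>The operands are computed into \<open>b\<close> and \<open>b + 1\<close> and combined
  into \<open>b\<close>. The quadratic cost bound is dictated by schoolbook multiplication and
  division.\<close>

lemma polytime_binop:
  assumes val: "\<And>x y s. aval (con (Reg x) (Reg y)) s = h (s x) (s y)"
    and cost: "\<And>x y s. acost (con (Reg x) (Reg y)) s \<le> (bits (s x) + bits (s y) + 3) ^ 2"
    and size: "\<And>x y. bits (h x y) \<le> bits x + bits y + 1"
    and f: "polytime C f" and g: "polytime C g"
  shows "polytime C (\<lambda>xs. h (f xs) (g xs))"
  unfolding polytime_def
proof (intro conjI allI impI)
  note bd = polytime_bits[OF f] polytime_bits[OF g]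
  have "pbd C (\<lambda>xs. bits (f xs) + bits (g xs) + 1)" by (intro poly_bounded_add poly_bounded_const bd)
  then show "pbd C (\<lambda>xs. bits (h (f xs) (g xs)))"
    by (rule poly_bounded_mono) (rule size)
  fix b assume b: "below C b"
  obtain P T where P: "pbd C T" "runs C b P T f" using f b by (rule polytimeE)
  obtain P' T' where P': "pbd C T'" "runs C (Suc b) P' T' g"
    by (rule polytimeE[OF g below_mono[OF b le_SucI[OF order_refl]]])
  define prog where "prog = Seq P (Seq P' (Assign b (con (Reg b) (Reg (Suc b)))))"
  define W where "W = (\<lambda>xs. T xs + (T' xs + (1 + (bits (f xs) + bits (g xs) + 3) ^ 2 + (bits (f xs) + bits (g xs) + 1))))"
  have "runs C b prog W (\<lambda>xs. h (f xs) (g xs))"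
    unfolding runs_def
  proof (intro ballI allI impI)
    fix xs s assume xs: "xs \<in> insts C" and s: "matches C xs s"
    obtain n1 s1 where 1: "exec P s n1 s1" "\<forall>j<b. s1 j = s j" "s1 b = f xs" "n1 \<le> T xs"
      by (rule runsE[OF P(2) xs s])
    have s1: "matches C xs s1" using matches_cong[OF s b] 1(2) by blast
    obtain n2 s2 where 2: "exec P' s1 n2 s2" "\<forall>j<Suc b. s2 j = s1 j"
      "s2 (Suc b) = g xs" "n2 \<le> T' xs"
      by (rule runsE[OF P'(2) xs s1])
    let ?e = "con (Reg b) (Reg (Suc b))"
    have s2: "s2 b = f xs" "s2 (Suc b) = g xs" using 1(3) 2(2,3) by auto
    have v: "aval ?e s2 = h (f xs) (g xs)" by (simp only: val s2)
    have c: "acost ?e s2 \<le> (bits (f xs) + bits (g xs) + 3) ^ 2"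
      using cost[of b "Suc b" s2] by (simp only: s2)
    have "exec prog s (n1 + (n2 + (1 + acost ?e s2 + bits (aval ?e s2)))) (s2(b := aval ?e s2))"
      unfolding prog_def by (rule exec.Seq[OF 1(1) exec.Seq[OF 2(1) exec.Assign]])
    moreover have "n1 + (n2 + (1 + acost ?e s2 + bits (aval ?e s2))) \<le> W xs"
      unfolding W_def v by (intro add_mono order_refl 1(4) 2(4) c size)
    moreover have "\<forall>j<b. (s2(b := aval ?e s2)) j = s j" "(s2(b := aval ?e s2)) b = h (f xs) (g xs)"
      using 1(2) 2(2) unfolding v by simp_all
    ultimately show "\<exists>n s'. exec prog s n s' \<and> (\<forall>j<b. s' j = s j) \<and> s' b = h (f xs) (g xs) \<and> n \<le> W xs"
      by blast
  qed
  moreover have "pbd C W" unfolding W_def by (intro poly_bounded_add poly_bounded_power poly_bounded_const bd P(1) P'(1))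
  ultimately show "\<exists>prog T. pbd C T \<and> runs C b prog T (\<lambda>xs. h (f xs) (g xs))" by blast
qed

lemma binop_cost_bounds:
  "(1 + x) + (1 + y) + (1 + x + y) \<le> (x + y + 3 :: nat) ^ 2"
  "(1 + x) + (1 + y) + (1 + x) * (1 + y) \<le> (x + y + 3 :: nat) ^ 2"
  by (simp_all add: power2_eq_square algebra_simps)

lemma
  assumes "polytime C f" "polytime C g"
  shows polytime_add: "polytime C (\<lambda>xs. f xs + g xs)"
    and polytime_diff: "polytime C (\<lambda>xs. f xs - g xs)"
    and polytime_mult: "polytime C (\<lambda>xs. f xs * g xs)"
    and polytime_div: "polytime C (\<lambda>xs. f xs div g xs)"
    and polytime_mod: "polytime C (\<lambda>xs. f xs mod g xs)"
proof -
  have le: "bits z \<le> bits x + bits y + 1" if "z \<le> x" for x y z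
    using bits_mono[OF that] by simp
  have "bits (x * y) \<le> bits x + bits y + 1" for x y using bits_mult_le[of x y] by simp
  then show "polytime C (\<lambda>xs. f xs * g xs)"
    by (intro polytime_binop[of Mul, OF _ _ _ assms]) (use binop_cost_bounds in simp_all)
  show "polytime C (\<lambda>xs. f xs + g xs)"
    by (intro polytime_binop[of Add, OF _ _ _ assms] bits_add_le) (use binop_cost_bounds in simp_all)
  show "polytime C (\<lambda>xs. f xs - g xs)" "polytime C (\<lambda>xs. f xs div g xs)"
    "polytime C (\<lambda>xs. f xs mod g xs)"
    by (intro polytime_binop[of Sub, OF _ _ _ assms] polytime_binop[of Div, OF _ _ _ assms]
          polytime_binop[of aexp.Mod, OF _ _ _ assms] le;
        use binop_cost_bounds in simp)+
qed

text \<open>With truncated subtraction \<open>1 - c\<close> is the truth value of c = 0, so the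
  selection is arithmetic and both branches are always evaluated. This suits the total functions
  used throughout.\<close>

lemma polytime_if_nonzero:
  assumes c: "polytime C c" and f: "polytime C f" and g: "polytime C g"
  shows "polytime C (\<lambda>xs. if c xs \<noteq> 0 then f xs else g xs)"
proof -
  have "polytime C (\<lambda>xs. (1 - (1 - c xs)) * f xs + (1 - c xs) * g xs)"
    by (intro polytime_add polytime_mult polytime_diff polytime_const assms)
  then show ?thesis by (rule polytime_cong) auto
qed

lemma polytime_if_eq:
  assumes "polytime C u" "polytime C v" "polytime C f" "polytime C g"
  shows "polytime C (\<lambda>xs. if u xs = v xs then f xs else g xs)"
proof -
  have "polytime C (\<lambda>xs. if (u xs - v xs) + (v xs - u xs) \<noteq> 0 then g xs else f xs)"
    by (intro polytime_if_nonzero polytime_add polytime_diff assms)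
  then show ?thesis by (rule polytime_cong) auto
qed

lemma polytime_min:
  assumes "polytime C f" "polytime C g"
  shows "polytime C (\<lambda>xs. min (f xs) (g xs))"
proof -
  have "polytime C (\<lambda>xs. if f xs - g xs \<noteq> 0 then g xs else f xs)"
    by (intro polytime_if_nonzero polytime_diff assms)
  then show ?thesis by (rule polytime_cong) auto
qed

section \<open>Loops with a precomputed number of rounds\<close>

fun loop :: "nat \<Rightarrow> (nat \<Rightarrow> nat \<Rightarrow> nat) \<Rightarrow> nat \<Rightarrow> nat" where
  "loop 0 f a = a"
| "loop (Suc n) f a = f n (loop n f a)"

text \<open>Register \<open>b\<close> is the accumulator, \<open>b + 1\<close> the counter,
  \<open>b + 2\<close> the number of rounds, and the body leaves its result in \<open>b + 3\<close>.
  A round costs the body, at most \<open>2 * B + 2\<close> for copying the result, and counter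
  operations estimated crudely by \<open>bits i \<le> i\<close>; the summand
  \<open>4 * n + 4\<close> pays for the final failing test.\<close>

lemma loop_program:
  fixes b :: nat and P :: program
  defines "w \<equiv> While (Sub (Reg (b + 2)) (Reg (b + 1)))
      (Seq P (Seq (Assign b (Reg (b + 3))) (Assign (b + 1) (Add (Reg (b + 1)) (Const 1)))))"
  assumes run: "\<And>i s. i < n \<Longrightarrow> (\<forall>j<b. s j = s0 j) \<Longrightarrow> s b = loop i F a \<Longrightarrow> s (b + 1) = i \<Longrightarrow>
      (\<exists>m s'. exec P s m s' \<and> (\<forall>j<b+3. s' j = s j) \<and> s' (b + 3) = loop (Suc i) F a \<and> m \<le> T)"
    and bd: "\<And>i. i \<le> n \<Longrightarrow> bits (loop i F a) \<le> B"
    and "i \<le> n" "\<forall>j<b. s j = s0 j" "s b = loop i F a" "s (b + 1) = i" "s (b + 2) = n"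
  shows "\<exists>m s'. exec w s m s' \<and> (\<forall>j<b. s' j = s0 j) \<and> s' b = loop n F a \<and>
     m \<le> (n - i) * (T + 2 * B + 10 * n + 20) + 4 * n + 4"
  using assms(4-)
proof (induction "n - i" arbitrary: i s)
  case 0
  then have "i = n" by simp
  then have v: "aval (Sub (Reg (b + 2)) (Reg (b + 1))) s = 0" using 0 by simp
  have c: "1 + acost (Sub (Reg (b + 2)) (Reg (b + 1))) s \<le> 4 * n + 4"
    using 0 \<open>i = n\<close> bits_le_self[of n] by simp
  show ?case
    by (rule exI[of _ "1 + acost (Sub (Reg (b + 2)) (Reg (b + 1))) s"], rule exI[of _ s])
      (use 0 \<open>i = n\<close> c exec.WhileFalse[OF v] in \<open>auto simp: w_def\<close>)
next
  case (Suc d)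
  let ?c = "Sub (Reg (b + 2)) (Reg (b + 1))"
  have i: "i < n" using Suc by simp
  have v: "aval ?c s \<noteq> 0" using Suc i by simp
  have "\<exists>m s'. exec P s m s' \<and> (\<forall>j<b+3. s' j = s j) \<and> s' (b + 3) = loop (Suc i) F a \<and> m \<le> T"
    using run[OF i] Suc.prems by blast
  then obtain m1 s1 where 1: "exec P s m1 s1" "\<forall>j<b+3. s1 j = s j"
      "s1 (b + 3) = loop (Suc i) F a" "m1 \<le> T"
    by blast
  define s2 where "s2 = s1(b := loop (Suc i) F a)"
  define s3 where "s3 = s2(b + 1 := Suc i)"
  let ?m2 = "1 + acost (Reg (b + 3)) s1 + bits (aval (Reg (b + 3)) s1)"
  let ?e = "Add (Reg (b + 1)) (Const 1)"
  let ?m3 = "1 + acost ?e s2 + bits (aval ?e s2)"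
  have 2: "exec (Assign b (Reg (b + 3))) s1 ?m2 s2"
    using exec.Assign[of b "Reg (b + 3)" s1] 1(3) by (simp add: s2_def)
  have e: "aval ?e s2 = Suc i" using 1 Suc.prems by (simp add: s2_def)
  have 3: "exec (Assign (b + 1) ?e) s2 ?m3 s3"
    using exec.Assign[of "b + 1" ?e s2] e by (simp add: s3_def)
  have s3: "\<forall>j<b. s3 j = s0 j" "s3 b = loop (Suc i) F a" "s3 (b + 1) = Suc i" "s3 (b + 2) = n"
    using 1 Suc.prems unfolding s3_def s2_def by auto
  have "d = n - Suc i" using Suc by simp
  then obtain m4 s4 where 4: "exec w s3 m4 s4" "\<forall>j<b. s4 j = s0 j" "s4 b = loop n F a"
    "m4 \<le> (n - Suc i) * (T + 2 * B + 10 * n + 20) + 4 * n + 4"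
    using Suc.hyps(1)[of "Suc i" s3] i s3 by auto
  have ex: "exec w s (1 + acost ?c s + (m1 + (?m2 + ?m3)) + m4) s4"
    unfolding w_def
    by (rule exec.WhileTrue[OF v]) (use 1 2 3 4 w_def in \<open>blast intro: exec.Seq\<close>)+
  have "bits i \<le> n" "bits (Suc i) \<le> n" "bits n \<le> n"
    using i bits_le_self[of i] bits_le_self[of "Suc i"] bits_le_self[of n] by auto
  moreover have "bits (loop (Suc i) F a) \<le> B" by (rule bd) (use i in simp)
  moreover have "bits (Suc 0) = 1" by (simp add: floorlog_def)
  moreover have "s1 (b + 1) = i" using 1 Suc.prems by simp
  ultimately have "1 + acost ?c s + (m1 + (?m2 + ?m3)) \<le> T + 2 * B + 10 * n + 20"
    using 1(3,4) e Suc.prems by (simp add: s2_def)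
  moreover have "(n - i) * (T + 2 * B + 10 * n + 20) =
      (T + 2 * B + 10 * n + 20) + (n - Suc i) * (T + 2 * B + 10 * n + 20)"
    using i by (metis Suc_diff_Suc mult_Suc)
  ultimately have "1 + acost ?c s + (m1 + (?m2 + ?m3)) + m4 \<le> (n - i) * (T + 2 * B + 10 * n + 20) + 4 * n + 4"
    using 4(4) by linarith
  then show ?case using ex 4(2,3) by blast
qed

text \<open>The bound \<open>B\<close> on all intermediate values has to be assumed: a body of
  polynomial cost may still let its accumulator grow exponentially over the rounds. In the step the
  accumulator may be taken as polynomial-time, because while the body runs it is simply a stored
  register.\<close>

lemma polytime_loop:
  assumes n: "unary C n" and a: "polytime C a"
    and B: "pbd C B" "\<And>xs i. xs \<in> insts C \<Longrightarrow> i \<le> n xs \<Longrightarrow> bits (loop i (F xs) (a xs)) \<le> B xs"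
    and step: "\<And>C'. extends C n C' \<Longrightarrow> unary C' hd \<Longrightarrow>
       polytime C' (\<lambda>ys. loop (hd ys) (F (tl ys)) (a (tl ys))) \<Longrightarrow>
       polytime C' (\<lambda>ys. F (tl ys) (hd ys) (loop (hd ys) (F (tl ys)) (a (tl ys))))"
  shows "polytime C (\<lambda>xs. loop (n xs) (F xs) (a xs))"
  unfolding polytime_def
proof (intro conjI allI impI)
  show "pbd C (\<lambda>xs. bits (loop (n xs) (F xs) (a xs)))"
    using B(1) by (rule poly_bounded_mono) (simp add: B(2))
  fix b assume b: "below C b"
  define acc where "acc = (\<lambda>ys. loop (hd ys) (F (tl ys)) (a (tl ys)))"
  define C' :: ctx where "C' = ({ys. tl ys \<in> insts C \<and> ys \<noteq> [] \<and> hd ys < n (tl ys)}, size_of C \<circ> tl,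
     (\<lambda>(j, g). (j, \<lambda>ys. g (tl ys))) ` stored C \<union> {(b, acc), (b + 1, hd)})"
  have C': "insts C' = {ys. tl ys \<in> insts C \<and> ys \<noteq> [] \<and> hd ys < n (tl ys)}" "size_of C' = size_of C \<circ> tl"
    "stored C' = (\<lambda>(j, g). (j, \<lambda>ys. g (tl ys))) ` stored C \<union> {(b, acc), (b + 1, hd)}"
    by (simp_all add: C'_def insts_def size_of_def stored_def)
  have ext: "extends C n C'" unfolding extends_def C' by force
  have hd: "unary C' hd"
  proof -
    have *: "pbd C' hd"
      using pbd_lift[OF ext unaryD(2)[OF n]] by (rule poly_bounded_mono) (simp add: C')
    moreover have "polytime C' hd"
      by (rule polytime_stored[of "b + 1"], simp add: C')
        (use * in \<open>rule poly_bounded_mono\<close>, rule bits_le_self)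
    ultimately show ?thesis by (simp add: unary_def)
  qed
  have "polytime C' acc"
    by (rule polytime_stored[of b], simp add: C')
      (use pbd_lift[OF ext B(1)] in \<open>rule poly_bounded_mono\<close>, auto simp: acc_def C' intro!: B(2))
  then have "polytime C' (\<lambda>ys. F (tl ys) (hd ys) (acc ys))"
    using step[OF ext hd] unfolding acc_def by simp
  moreover have "below C' (b + 3)"
    using b unfolding below_def C' by fastforce
  ultimately obtain P T where P: "pbd C' T" "runs C' (b + 3) P T (\<lambda>ys. F (tl ys) (hd ys) (acc ys))"
    by (rule polytimeE)
  \<comment> \<open>\<open>T\<close> is a function of the extended instance. Since pushing the
    counter leaves the size unchanged, one power of the size bounds the cost of every round.\<close>
  obtain k where k: "\<And>ys. ys \<in> insts C' \<Longrightarrow> T ys \<le> (size_of C' ys + 2) ^ k"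
    using P(1) unfolding poly_bounded_def by blast
  obtain Pa Ta where Pa: "pbd C Ta" "runs C b Pa Ta a" using a b by (rule polytimeE)
  obtain Pn Tn where Pn: "pbd C Tn" "runs C (b + 2) Pn Tn n"
    by (rule polytimeE[OF unaryD(1)[OF n] below_mono[OF b le_add1]])
  define w where "w = While (Sub (Reg (b + 2)) (Reg (b + 1)))
      (Seq P (Seq (Assign b (Reg (b + 3))) (Assign (b + 1) (Add (Reg (b + 1)) (Const 1)))))"
  define prog where "prog = Seq Pa (Seq Pn (Seq (Assign (b + 1) (Const 0)) w))"
  define W where "W = (\<lambda>xs. Ta xs + (Tn xs + (2 + (n xs * ((size_of C xs + 2) ^ k + 2 * B xs + 10 * n xs + 20) + 4 * n xs + 4))))"
  have "runs C b prog W (\<lambda>xs. loop (n xs) (F xs) (a xs))"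
    unfolding runs_def
  proof (intro ballI allI impI)
    fix xs s assume xs: "xs \<in> insts C" and s: "matches C xs s"
    obtain n1 s1 where 1: "exec Pa s n1 s1" "\<forall>j<b. s1 j = s j" "s1 b = a xs" "n1 \<le> Ta xs"
      by (rule runsE[OF Pa(2) xs s])
    have s1: "matches C xs s1" using matches_cong[OF s b] 1(2) by blast
    obtain n2 s2 where 2: "exec Pn s1 n2 s2" "\<forall>j<b + 2. s2 j = s1 j"
      "s2 (b + 2) = n xs" "n2 \<le> Tn xs"
      by (rule runsE[OF Pn(2) xs s1])
    define s3 where "s3 = s2(b + 1 := 0)"
    have 3: "exec (Assign (b + 1) (Const 0)) s2 2 s3"
      using exec.Assign[of "b + 1" "Const 0" s2] by (simp add: s3_def floorlog_def numeral_2_eq_2)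
    have s3: "matches C xs s3"
      by (rule matches_cong[OF s b]) (use 1 2 in \<open>auto simp: s3_def\<close>)
    have "\<exists>m s'. exec w s3 m s' \<and> (\<forall>j<b. s' j = s3 j) \<and> s' b = loop (n xs) (F xs) (a xs) \<and>
       m \<le> (n xs - 0) * ((size_of C xs + 2) ^ k + 2 * B xs + 10 * n xs + 20) + 4 * n xs + 4"
      unfolding w_def
    proof (rule loop_program)
      fix i s' assume i: "i < n xs" and s': "\<forall>j<b. s' j = s3 j" "s' b = loop i (F xs) (a xs)" "s' (b + 1) = i"
      have "matches C xs s'" by (rule matches_cong[OF s3 b]) (use s' in auto)
      then have "matches C' (i # xs) s'"
        using s' unfolding matches_def C' acc_def by auto
      moreover have ixs: "i # xs \<in> insts C'" using xs i by (simp add: C')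
      moreover have "T (i # xs) \<le> (size_of C xs + 2) ^ k" using k[OF ixs] by (simp add: C')
      ultimately show "\<exists>m s''. exec P s' m s'' \<and> (\<forall>j<b + 3. s'' j = s' j) \<and>
          s'' (b + 3) = loop (Suc i) (F xs) (a xs) \<and> m \<le> (size_of C xs + 2) ^ k"
        using runsE[OF P(2), of "i # xs" s'] unfolding acc_def by (metis list.sel loop.simps(2) order_trans)
    qed (use 1 2 B(2) xs in \<open>auto simp: s3_def\<close>)
    then obtain n4 s4 where 4: "exec w s3 n4 s4" "\<forall>j<b. s4 j = s3 j" "s4 b = loop (n xs) (F xs) (a xs)"
      "n4 \<le> n xs * ((size_of C xs + 2) ^ k + 2 * B xs + 10 * n xs + 20) + 4 * n xs + 4" by auto
    have "exec prog s (n1 + (n2 + (2 + n4))) s4"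
      unfolding prog_def using 1 2 3 4 by (blast intro: exec.Seq)
    moreover have "n1 + (n2 + (2 + n4)) \<le> W xs" unfolding W_def using 1(4) 2(4) 4(4) by linarith
    moreover have "\<forall>j<b. s4 j = s j" using 1(2) 2(2) 4(2) by (simp add: s3_def)
    ultimately show "\<exists>n' s'. exec prog s n' s' \<and> (\<forall>j<b. s' j = s j) \<and> s' b = loop (n xs) (F xs) (a xs) \<and> n' \<le> W xs"
      using 4(3) by blast
  qed
  moreover have "pbd C W"
    unfolding W_def
    by (intro poly_bounded_add poly_bounded_mult poly_bounded_power poly_bounded_const poly_bounded_size
        B Pa Pn unaryD(2)[OF n])
  ultimately show "\<exists>prog T. pbd C T \<and> runs C b prog T (\<lambda>xs. loop (n xs) (F xs) (a xs))" by blast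
qed

lemma bits_rec: "bits n = (if n = 0 then 0 else Suc (bits (n div 2)))"
  by (subst compute_floorlog) simp

text \<open>Every round moves one unit from \<open>bits n\<close> to register \<open>b\<close>.
  Their sum is invariant, which keeps the estimate per round stable during the induction.\<close>

lemma bits_program:
  fixes b :: nat
  assumes "s (b + 1) = n"
  shows "\<exists>m s'. exec (While (Reg (b + 1)) (Seq (Assign b (Add (Reg b) (Const 1)))
       (Assign (b + 1) (Div (Reg (b + 1)) (Const 2))))) s m s' \<and> (\<forall>j<b. s' j = s j) \<and>
     s' b = s b + bits n \<and> m \<le> bits n * (3 * (s b + bits n) + 6 * bits n + 30) + 2"
  using assms
proof (induction n arbitrary: s rule: less_induct)
  case (less n)
  let ?w = "While (Reg (b + 1)) (Seq (Assign b (Add (Reg b) (Const 1)))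
       (Assign (b + 1) (Div (Reg (b + 1)) (Const 2))))"
  show ?case
  proof (cases "n = 0")
    case True
    then have "exec ?w s (1 + acost (Reg (b + 1)) s) s" by (intro exec.WhileFalse) (use less in simp)
    then show ?thesis using True less.prems by (auto simp: floorlog_def)
  next
    case False
    let ?e1 = "Add (Reg b) (Const 1)" and ?e2 = "Div (Reg (b + 1)) (Const 2)"
    define s1 where "s1 = s(b := Suc (s b))"
    define s2 where "s2 = s1(b + 1 := n div 2)"
    have 1: "exec (Assign b ?e1) s (1 + acost ?e1 s + bits (aval ?e1 s)) s1"
      using exec.Assign[of b ?e1 s] by (simp add: s1_def)
    have 2: "exec (Assign (b + 1) ?e2) s1 (1 + acost ?e2 s1 + bits (aval ?e2 s1)) s2"
      using exec.Assign[of "b + 1" ?e2 s1] less.prems by (simp add: s1_def s2_def)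
    have "s2 (b + 1) = n div 2" "n div 2 < n" using False by (simp_all add: s2_def)
    from less.IH[OF this(2), of s2] this(1) obtain m s' where 3: "exec ?w s2 m s'" "\<forall>j<b. s' j = s2 j"
      "s' b = s2 b + bits (n div 2)"
      "m \<le> bits (n div 2) * (3 * (s2 b + bits (n div 2)) + 6 * bits (n div 2) + 30) + 2" by auto
    have v: "aval (Reg (b + 1)) s \<noteq> 0" using False less.prems by simp
    let ?m = "1 + acost (Reg (b + 1)) s + (1 + acost ?e1 s + bits (aval ?e1 s) + (1 + acost ?e2 s1 + bits (aval ?e2 s1))) + m"
    have ex: "exec ?w s ?m s'" by (rule exec.WhileTrue[OF v exec.Seq[OF 1 2] 3(1)])
    have bn: "bits n = Suc (bits (n div 2))" using False bits_rec by simp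
    have b12: "bits (Suc 0) = 1" "bits 2 = 2" using bits_rec[of 2] bits_rec[of 1] by (auto simp: floorlog_def)
    have s: "s2 b = Suc (s b)" "s1 (b + 1) = n" using less.prems by (simp_all add: s1_def s2_def)
    have le: "bits (s b) \<le> s b" "bits (Suc (s b)) \<le> Suc (s b)" by (rule bits_le_self)+
    have "1 + acost (Reg (b + 1)) s + (1 + acost ?e1 s + bits (aval ?e1 s) + (1 + acost ?e2 s1 + bits (aval ?e2 s1)))
        \<le> 3 * (s b + bits n) + 6 * bits n + 30"
      using le b12 s less.prems bn by (simp add: algebra_simps)
    moreover have "m \<le> bits (n div 2) * (3 * (s b + bits n) + 6 * bits n + 30) + 2"
    proof -
      have "bits (n div 2) * (3 * (s2 b + bits (n div 2)) + 6 * bits (n div 2) + 30)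
        \<le> bits (n div 2) * (3 * (s b + bits n) + 6 * bits n + 30)"
        using s bn by (intro mult_left_mono) auto
      then show ?thesis using 3(4) by linarith
    qed
    ultimately have "?m \<le> bits n * (3 * (s b + bits n) + 6 * bits n + 30) + 2"
      unfolding bn by simp
    moreover have "\<forall>j<b. s' j = s j" "s' b = s b + bits n"
      using 3 s bn by (auto simp: s1_def s2_def)
    ultimately show ?thesis using ex by blast
  qed
qed

text \<open>This turns data into loop bounds: the length of a number of polynomial length is small
  as a number.\<close>

lemma unary_bits:
  assumes f: "polytime C f"
  shows "unary C (\<lambda>xs. bits (f xs))"
  unfolding unary_def polytime_def
proof (intro conjI allI impI)
  note bd = polytime_bits[OF f]
  show "pbd C (\<lambda>xs. bits (f xs))" by (rule bd)
  then show "pbd C (\<lambda>xs. bits (bits (f xs)))" by (rule poly_bounded_mono) (rule bits_le_self)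
  fix b assume b: "below C b"
  obtain P T where P: "pbd C T" "runs C (b + 1) P T f"
    by (rule polytimeE[OF f below_mono[OF b le_add1]])
  define w where "w = While (Reg (b + 1)) (Seq (Assign b (Add (Reg b) (Const 1)))
       (Assign (b + 1) (Div (Reg (b + 1)) (Const 2))))"
  define prog where "prog = Seq P (Seq (Assign b (Const 0)) w)"
  define W where "W = (\<lambda>xs. T xs + (2 + (bits (f xs) * (3 * (0 + bits (f xs)) + 6 * bits (f xs) + 30) + 2)))"
  have "runs C b prog W (\<lambda>xs. bits (f xs))"
    unfolding runs_def
  proof (intro ballI allI impI)
    fix xs s assume xs: "xs \<in> insts C" and s: "matches C xs s"
    obtain n1 s1 where 1: "exec P s n1 s1" "\<forall>j<b + 1. s1 j = s j" "s1 (b + 1) = f xs" "n1 \<le> T xs"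
      by (rule runsE[OF P(2) xs s])
    define s2 where "s2 = s1(b := 0)"
    have 2: "exec (Assign b (Const 0)) s1 2 s2"
      using exec.Assign[of b "Const 0" s1] by (simp add: s2_def floorlog_def numeral_2_eq_2)
    have "s2 (b + 1) = f xs" "s2 b = 0" using 1 by (auto simp: s2_def)
    then obtain m s3 where 3: "exec w s2 m s3" "\<forall>j<b. s3 j = s2 j" "s3 b = 0 + bits (f xs)"
      "m \<le> bits (f xs) * (3 * (0 + bits (f xs)) + 6 * bits (f xs) + 30) + 2"
      using bits_program[of s2 b "f xs"] unfolding w_def by auto
    have "exec prog s (n1 + (2 + m)) s3" unfolding prog_def using 1 2 3 by (blast intro: exec.Seq)
    moreover have "n1 + (2 + m) \<le> W xs" unfolding W_def using 1(4) 3(4) by linarith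
    moreover have "\<forall>j<b. s3 j = s j" using 1(2) 3(2) by (simp add: s2_def)
    ultimately show "\<exists>n s'. exec prog s n s' \<and> (\<forall>j<b. s' j = s j) \<and> s' b = bits (f xs) \<and> n \<le> W xs"
      using 3(3) by auto
  qed
  moreover have "pbd C W" unfolding W_def
    by (intro poly_bounded_add poly_bounded_mult poly_bounded_const P bd)
  ultimately show "\<exists>prog T. pbd C T \<and> runs C b prog T (\<lambda>xs. bits (f xs))" by blast
qed

lemma unary_const: "unary C (\<lambda>_. c)"
  by (simp add: unary_def polytime_const poly_bounded_const)

lemma unary_add: "unary C f \<Longrightarrow> unary C g \<Longrightarrow> unary C (\<lambda>xs. f xs + g xs)"
  by (simp add: unary_def polytime_add poly_bounded_add)

lemma unary_mult: "unary C f \<Longrightarrow> unary C g \<Longrightarrow> unary C (\<lambda>xs. f xs * g xs)"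
  by (simp add: unary_def polytime_mult poly_bounded_mult)

lemma unary_diff:
  assumes "unary C f" "polytime C g"
  shows "unary C (\<lambda>xs. f xs - g xs)"
proof -
  have "pbd C (\<lambda>xs. f xs - g xs)"
    using unaryD(2)[OF assms(1)] by (rule poly_bounded_mono) simp
  then show ?thesis using assms by (simp add: unary_def polytime_diff)
qed

lemma unary_power_const: "unary C f \<Longrightarrow> unary C (\<lambda>xs. f xs ^ k)"
  by (induction k) (auto intro: unary_mult unary_const)

lemma loop_mult_const: "loop k (\<lambda>_ acc. acc * x) 1 = x ^ k"
  by (induction k) auto

text \<open>The exponent must be \<open>unary\<close>, since the length of the power is proportional
  to it.\<close>

lemma polytime_power:
  assumes f: "polytime C f" and n: "unary C n"
  shows "polytime C (\<lambda>xs. f xs ^ n xs)"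
  unfolding loop_mult_const[symmetric]
proof (rule polytime_loop[OF n polytime_const])
  show "pbd C (\<lambda>xs. n xs * bits (f xs) + 1)"
    by (intro poly_bounded_add poly_bounded_mult poly_bounded_const polytime_bits unaryD assms)
  fix xs i assume "i \<le> n xs"
  then have "i * bits (f xs) \<le> n xs * bits (f xs)" by (rule mult_le_mono1)
  then show "bits (loop i (\<lambda>_ acc. acc * f xs) 1) \<le> n xs * bits (f xs) + 1"
    unfolding loop_mult_const using bits_power_le[of "f xs" i] by linarith
next
  fix C' assume C': "extends C n C'"
    "polytime C' (\<lambda>ys. loop (hd ys) (\<lambda>_ acc. acc * f (tl ys)) 1)"
  show "polytime C' (\<lambda>ys. loop (hd ys) (\<lambda>_ acc. acc * f (tl ys)) 1 * f (tl ys))"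
    by (rule polytime_mult[OF C'(2) polytime_lift[OF C'(1) f]])
qed

section \<open>Digit arrays and algebraic extensions\<close>

text \<open>A context with one arbitrary loop counter, from which a size estimate is to be drawn.
  The counter is placed in register 0 even if the old context stores something there. The resulting
  clash can only make \<open>matches\<close> unsatisfiable, which does not affect the length bound
  contained in \<open>polytime\<close>.\<close>

lemma extension_exists:
  assumes "unary C n"
  obtains C' where "extends C n C'" "unary C' hd"
    "\<And>xs i. xs \<in> insts C \<Longrightarrow> i < n xs \<Longrightarrow> i # xs \<in> insts C' \<and> size_of C' (i # xs) = size_of C xs"
proof -
  define C' :: ctx where "C' = ({ys. tl ys \<in> insts C \<and> ys \<noteq> [] \<and> hd ys < n (tl ys)}, size_of C \<circ> tl,
     (\<lambda>(j, g). (j, \<lambda>ys. g (tl ys))) ` stored C \<union> {(0, hd)})"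
  have C': "insts C' = {ys. tl ys \<in> insts C \<and> ys \<noteq> [] \<and> hd ys < n (tl ys)}" "size_of C' = size_of C \<circ> tl"
    "stored C' = (\<lambda>(j, g). (j, \<lambda>ys. g (tl ys))) ` stored C \<union> {(0, hd)}"
    by (simp_all add: C'_def insts_def size_of_def stored_def)
  have ext: "extends C n C'" unfolding extends_def C' by force
  have *: "pbd C' hd"
    using pbd_lift[OF ext unaryD(2)[OF assms]] by (rule poly_bounded_mono) (simp add: C')
  moreover have "polytime C' hd"
    by (rule polytime_stored[of 0], simp add: C')
      (use * in \<open>rule poly_bounded_mono\<close>, rule bits_le_self)
  ultimately show ?thesis using that[OF ext] by (simp add: unary_def C')
qed

text \<open>Being polynomial-time in the context extended by a counter bounds the values uniformly
  in the counter, as the size does not depend on it.\<close>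

lemma extension_bound:
  assumes n: "unary C n"
    and step: "\<And>C'. extends C n C' \<Longrightarrow> unary C' hd \<Longrightarrow> polytime C' (\<lambda>ys. g (tl ys) (hd ys))"
  obtains B where "pbd C B" "\<And>xs i. xs \<in> insts C \<Longrightarrow> i < n xs \<Longrightarrow> bits (g xs i) \<le> B xs"
proof -
  obtain C' where C': "extends C n C'" "unary C' hd"
    "\<And>xs i. xs \<in> insts C \<Longrightarrow> i < n xs \<Longrightarrow> i # xs \<in> insts C' \<and> size_of C' (i # xs) = size_of C xs"
    using extension_exists[OF n] by blast
  obtain k where k: "\<forall>ys\<in>insts C'. bits (g (tl ys) (hd ys)) \<le> (size_of C' ys + 2) ^ k"
    using polytime_bits[OF step[OF C'(1,2)]] unfolding poly_bounded_def by blast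
  show ?thesis
  proof (rule that[of "\<lambda>xs. (size_of C xs + 2) ^ k"])
    show "pbd C (\<lambda>xs. (size_of C xs + 2) ^ k)"
      by (intro poly_bounded_power poly_bounded_add poly_bounded_const poly_bounded_size)
    show "bits (g xs i) \<le> (size_of C xs + 2) ^ k" if "xs \<in> insts C" "i < n xs" for xs i
      using k C'(3)[OF that] by fastforce
  qed
qed

text \<open>If the body is bounded whatever its accumulator is, no growth argument is needed: only
  round 0 returns the initial value.\<close>

lemma polytime_loop_bounded:
  assumes "unary C n" "polytime C a" "pbd C B"
    and B: "\<And>xs i v. xs \<in> insts C \<Longrightarrow> bits (F xs i v) \<le> B xs"
    and "\<And>C'. extends C n C' \<Longrightarrow> unary C' hd \<Longrightarrow>
       polytime C' (\<lambda>ys. loop (hd ys) (F (tl ys)) (a (tl ys))) \<Longrightarrow>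
       polytime C' (\<lambda>ys. F (tl ys) (hd ys) (loop (hd ys) (F (tl ys)) (a (tl ys))))"
  shows "polytime C (\<lambda>xs. loop (n xs) (F xs) (a xs))"
proof (rule polytime_loop[OF assms(1,2)])
  show "pbd C (\<lambda>xs. B xs + bits (a xs))"
    by (intro poly_bounded_add assms polytime_bits)
  fix xs i assume "xs \<in> insts C"
  then show "bits (loop i (F xs) (a xs)) \<le> B xs + bits (a xs)"
    using B by (cases i) (auto intro: trans_le_add1)
qed (rule assms(5))

text \<open>The value 0 stands for failure. This is adequate for the search, because a root of a
  nonzero element never has code 0.\<close>

definition first :: "nat \<Rightarrow> (nat \<Rightarrow> nat) \<Rightarrow> nat" where
  "first n g = loop n (\<lambda>i acc. if acc \<noteq> 0 then acc else g i) 0"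

lemma first_cases: "first n g = 0 \<or> (\<exists>i<n. first n g = g i)"
proof (induction n)
  case (Suc n)
  then show ?case using less_Suc_eq unfolding first_def by force
qed (simp add: first_def)

lemma first_nonzero: "i < n \<Longrightarrow> g i \<noteq> 0 \<Longrightarrow> first n g \<noteq> 0"
proof (induction n)
  case (Suc n)
  then show ?case by (auto simp: first_def less_Suc_eq)
qed simp

lemma first_satisfies: "(\<And>i. i < n \<Longrightarrow> g i \<noteq> 0 \<Longrightarrow> P (g i)) \<Longrightarrow> first n g \<noteq> 0 \<Longrightarrow> P (first n g)"
  using first_cases[of n g] by auto

lemma polytime_first:
  assumes n: "unary C n"
    and step: "\<And>C'. extends C n C' \<Longrightarrow> unary C' hd \<Longrightarrow> polytime C' (\<lambda>ys. g (tl ys) (hd ys))"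
  shows "polytime C (\<lambda>xs. first (n xs) (g xs))"
proof -
  obtain B where B: "pbd C B" "\<And>xs i. xs \<in> insts C \<Longrightarrow> i < n xs \<Longrightarrow> bits (g xs i) \<le> B xs"
    using extension_bound[OF n step] by blast
  show ?thesis
    unfolding first_def
  proof (rule polytime_loop[OF n polytime_const B(1)])
    fix xs i assume xs: "xs \<in> insts C" "i \<le> n xs"
    have "first i (g xs) = 0 \<or> (\<exists>j<i. first i (g xs) = g xs j)" by (rule first_cases)
    then have "bits (first i (g xs)) \<le> B xs"
      using B(2)[OF xs(1)] xs(2) by (auto simp: floorlog_eq_zero_iff[THEN iffD2])
    then show "bits (loop i (\<lambda>i acc. if acc \<noteq> 0 then acc else g xs i) 0) \<le> B xs"
      by (simp add: first_def)
  qed (intro polytime_if_nonzero step)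
qed

section \<open>Arrays as numbers in base \<open>m\<close>\<close>

definition dig :: "nat \<Rightarrow> nat \<Rightarrow> nat \<Rightarrow> nat" where
  "dig m a j = a div m ^ j mod m"

text \<open>Capping the digits bounds the value for arbitrary \<open>g\<close>, so that
  running times need no side conditions on the data.\<close>

definition tab :: "nat \<Rightarrow> nat \<Rightarrow> (nat \<Rightarrow> nat) \<Rightarrow> nat" where
  "tab n m g = (\<Sum>j<n. min (g j) (m - 1) * m ^ j)"

lemma tab_less: "m > 0 \<Longrightarrow> tab n m g < m ^ n"
proof (induction n)
  case (Suc n)
  have "tab (Suc n) m g < m ^ n + (m - 1) * m ^ n"
    using Suc by (auto simp: tab_def intro!: add_less_le_mono)
  also have "\<dots> = m ^ Suc n" using Suc.prems by (cases m) auto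
  finally show ?case .
qed (simp add: tab_def)

lemma tab_le: "tab n m g \<le> m ^ n"
  using tab_less[of m n g] by (cases "m = 0") (auto simp: tab_def)

lemma dig_less: "m > 0 \<Longrightarrow> dig m a j < m"
  by (simp add: dig_def)

lemma tab_Suc: "tab (Suc n) m g = tab n m g + min (g n) (m - 1) * m ^ n"
  by (simp add: tab_def)

lemma dig_tab: "j < n \<Longrightarrow> g j < m \<Longrightarrow> dig m (tab n m g) j = g j"
proof (induction n)
  case (Suc n)
  have m: "m > 0" using Suc.prems by simp
  show ?case
  proof (cases "j = n")
    case True
    then show ?thesis using Suc.prems tab_less[OF m, of n g] m
      by (simp add: dig_def tab_Suc)
  next
    case False
    then have j: "j < n" using Suc.prems by simp
    let ?c = "min (g n) (m - 1)"
    have "m ^ n = m ^ j * (m * m ^ (n - Suc j))"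
      using j by (metis Suc_diff_Suc power_Suc power_add le_add_diff_inverse less_imp_le)
    then have "tab (Suc n) m g = tab n m g + m ^ j * (m * (?c * m ^ (n - Suc j)))"
      by (simp add: tab_Suc)
    then have "tab (Suc n) m g div m ^ j = m * (?c * m ^ (n - Suc j)) + tab n m g div m ^ j"
      using m by simp
    then show ?thesis using Suc j unfolding dig_def by simp
  qed
qed simp

lemma tab_dig: "m > 0 \<Longrightarrow> tab n m (dig m a) = a mod m ^ n"
proof (induction n)
  case (Suc n)
  have "min (dig m a n) (m - 1) = dig m a n" using dig_less[OF Suc.prems, of a n] by simp
  moreover have "a mod m ^ Suc n = m ^ n * (a div m ^ n mod m) + a mod m ^ n"
    by (metis mod_mult2_eq mult.commute power_Suc)
  ultimately show ?case using Suc by (simp add: tab_Suc dig_def)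
qed (simp add: tab_def)

lemma dig_small: "c < m \<Longrightarrow> dig m c j = (if j = 0 then c else 0)"
proof -
  assume c: "c < m"
  have "c < m ^ j" if "j > 0" using c that by (metis One_nat_def Suc_leI less_le_trans neq0_conv not_less0 power_increasing power_one_right)
  then show ?thesis using c by (auto simp: dig_def)
qed

lemma polytime_tab:
  assumes n: "unary C n" and m: "polytime C m"
    and step: "\<And>C'. extends C n C' \<Longrightarrow> unary C' hd \<Longrightarrow> polytime C' (\<lambda>ys. g (tl ys) (hd ys))"
  shows "polytime C (\<lambda>xs. tab (n xs) (m xs) (g xs))"
proof -
  have eq: "tab k q f = loop k (\<lambda>i acc. acc + min (f i) (q - 1) * q ^ i) 0" for k q f
    by (induction k) (auto simp: tab_def)
  show ?thesis
    unfolding eq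
  proof (rule polytime_loop[OF n polytime_const])
    show "pbd C (\<lambda>xs. n xs * bits (m xs) + 1)"
      by (intro poly_bounded_add poly_bounded_mult poly_bounded_const polytime_bits unaryD n m)
    fix xs i assume "i \<le> n xs"
    then have "i * bits (m xs) \<le> n xs * bits (m xs)" by (rule mult_le_mono1)
    then show "bits (loop i (\<lambda>i acc. acc + min (g xs i) (m xs - 1) * m xs ^ i) 0) \<le> n xs * bits (m xs) + 1"
      unfolding eq[symmetric]
      using bits_mono[OF tab_le[of i "m xs" "g xs"]] bits_power_le[of "m xs" i] by linarith
  next
    fix C' assume C': "extends C n C'" "unary C' hd"
      "polytime C' (\<lambda>ys. loop (hd ys) (\<lambda>i acc. acc + min (g (tl ys) i) (m (tl ys) - 1) * m (tl ys) ^ i) 0)"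
    show "polytime C' (\<lambda>ys. loop (hd ys) (\<lambda>i acc. acc + min (g (tl ys) i) (m (tl ys) - 1) * m (tl ys) ^ i) 0
        + min (g (tl ys) (hd ys)) (m (tl ys) - 1) * m (tl ys) ^ hd ys)"
      by (intro polytime_add polytime_min polytime_mult polytime_power polytime_diff polytime_const
          C' step polytime_lift[OF C'(1)] m)
  qed
qed

lemma polytime_dig:
  "polytime C m \<Longrightarrow> polytime C a \<Longrightarrow> unary C j \<Longrightarrow> polytime C (\<lambda>xs. dig (m xs) (a xs) (j xs))"
  unfolding dig_def by (intro polytime_mod polytime_div polytime_power)

section \<open>Nested contexts and operations as parameters\<close>

inductive descends :: "ctx \<Rightarrow> nat \<Rightarrow> ctx \<Rightarrow> bool" where
  "descends C 0 C"
| "extends C n C1 \<Longrightarrow> descends C1 k C2 \<Longrightarrow> descends C (Suc k) C2"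

lemma descends_lift: "descends C k C' \<Longrightarrow> polytime C f \<Longrightarrow> polytime C' (\<lambda>ys. f ((tl ^^ k) ys))"
proof (induction arbitrary: f rule: descends.induct)
  case (2 C n C1 k C2)
  show ?case using 2(3)[OF polytime_lift[OF 2(1,4)]] by simp
qed simp

lemma descends_lift_unary: "descends C k C' \<Longrightarrow> unary C f \<Longrightarrow> unary C' (\<lambda>ys. f ((tl ^^ k) ys))"
proof (induction arbitrary: f rule: descends.induct)
  case (2 C n C1 k C2)
  show ?case using 2(3)[OF unary_lift[OF 2(1,4)]] by simp
qed simp

text \<open>Arithmetic that depends on the instance has to be applied inside nested loops to
  operands that depend on the loop counters. Hence the quantification over all deeper contexts,
  where \<open>tl ^^ k\<close> recovers the outer instance.\<close>

definition polytime_op :: "ctx \<Rightarrow> (nat list \<Rightarrow> nat \<Rightarrow> nat \<Rightarrow> nat) \<Rightarrow> bool" where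
  "polytime_op C f \<longleftrightarrow> (\<forall>k C' a b. descends C k C' \<longrightarrow> polytime C' a \<longrightarrow> polytime C' b \<longrightarrow>
     polytime C' (\<lambda>ys. f ((tl ^^ k) ys) (a ys) (b ys)))"

lemma polytime_op_lift: "extends C n C' \<Longrightarrow> polytime_op C f \<Longrightarrow> polytime_op C' (\<lambda>ys. f (tl ys))"
  unfolding polytime_op_def
proof (intro allI impI)
  fix k C2 a b assume f: "\<forall>k C2 a b. descends C k C2 \<longrightarrow> polytime C2 a \<longrightarrow> polytime C2 b \<longrightarrow>
     polytime C2 (\<lambda>ys. f ((tl ^^ k) ys) (a ys) (b ys))"
    and C: "extends C n C'" "descends C' k C2" and ab: "polytime C2 a" "polytime C2 b"
  have "polytime C2 (\<lambda>ys. f ((tl ^^ Suc k) ys) (a ys) (b ys))"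
    using f descends.intros(2)[OF C] ab by blast
  then show "polytime C2 (\<lambda>ys. f (tl ((tl ^^ k) ys)) (a ys) (b ys))" by simp
qed

lemma polytime_op_descends: "descends C k C' \<Longrightarrow> polytime_op C f \<Longrightarrow> polytime_op C' (\<lambda>ys. f ((tl ^^ k) ys))"
proof (induction arbitrary: f rule: descends.induct)
  case (2 C n C1 k C2)
  show ?case using 2(3)[OF polytime_op_lift[OF 2(1,4)]] by simp
qed simp

lemma polytime_op_apply:
  assumes "polytime_op C f" "polytime C a" "polytime C b"
  shows "polytime C (\<lambda>xs. f xs (a xs) (b xs))"
proof -
  have "polytime C (\<lambda>ys. f ((tl ^^ 0) ys) (a ys) (b ys))"
    using assms descends.intros(1)[of C] unfolding polytime_op_def by blast
  then show ?thesis by simp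
qed

text \<open>The bound is independent of the operands, so a loop of products cannot blow up.\<close>

definition bounded_op :: "ctx \<Rightarrow> (nat list \<Rightarrow> nat \<Rightarrow> nat \<Rightarrow> nat) \<Rightarrow> bool" where
  "bounded_op C f \<longleftrightarrow> (\<exists>B. pbd C B \<and> (\<forall>xs\<in>insts C. \<forall>a b. bits (f xs a b) \<le> B xs))"

text \<open>Binary exponentiation from the leading digit. Exactly \<open>l\<close> digits are
  scanned, so it needs n < 2^l, and leading zeros only square 1.\<close>

definition repeated_squaring :: "(nat \<Rightarrow> nat \<Rightarrow> nat) \<Rightarrow> nat \<Rightarrow> nat \<Rightarrow> nat \<Rightarrow> nat" where
  "repeated_squaring mul l x n = loop l (\<lambda>i acc.
     if n div 2 ^ (l - 1 - i) mod 2 = 1 then mul (mul acc acc) x else mul acc acc) 1"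

lemma polytime_repeated_squaring:
  assumes f: "polytime_op C f" "bounded_op C f" and l: "unary C l"
    and x: "polytime C x" and n: "polytime C n"
  shows "polytime C (\<lambda>xs. repeated_squaring (f xs) (l xs) (x xs) (n xs))"
proof -
  obtain B where B: "pbd C B" "\<forall>xs\<in>insts C. \<forall>a b. bits (f xs a b) \<le> B xs"
    using f(2) unfolding bounded_op_def by blast
  show ?thesis
    unfolding repeated_squaring_def
  proof (rule polytime_loop_bounded[OF l polytime_const B(1)])
    fix C' assume C': "extends C l C'" "unary C' hd"
    let ?a = "\<lambda>ys. loop (hd ys) (\<lambda>i acc. if n (tl ys) div 2 ^ (l (tl ys) - 1 - i) mod 2 = 1
        then f (tl ys) (f (tl ys) acc acc) (x (tl ys)) else f (tl ys) acc acc) 1"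
    assume a: "polytime C' ?a"
    note lift = polytime_lift[OF C'(1)] polytime_op_lift[OF C'(1)] unary_lift[OF C'(1)]
    show "polytime C' (\<lambda>ys. if n (tl ys) div 2 ^ (l (tl ys) - 1 - hd ys) mod 2 = 1
        then f (tl ys) (f (tl ys) (?a ys) (?a ys)) (x (tl ys)) else f (tl ys) (?a ys) (?a ys))"
      by (intro polytime_if_eq polytime_mod polytime_div polytime_power polytime_const unary_diff
          unary_const lift(1)[OF n] lift(1)[OF x] lift(3)[OF l] C'(2) unaryD(1)[OF C'(2)]
          polytime_op_apply[OF lift(2)[OF f(1)]] a)
  qed (use B(2) in simp)
qed

definition ext_add :: "(nat \<Rightarrow> nat \<Rightarrow> nat) \<Rightarrow> nat \<Rightarrow> nat \<Rightarrow> nat \<Rightarrow> nat \<Rightarrow> nat" where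
  "ext_add ad m n a b = tab n m (\<lambda>j. ad (dig m a j) (dig m b j))"

text \<open>Horner's scheme for the product in \<open>R[X]\<close> modulo \<open>X^n - g\<close>, where
  \<open>g\<close> has degree less than \<open>n\<close>.\<close>

definition ext_step ::
  "(nat \<Rightarrow> nat \<Rightarrow> nat) \<Rightarrow> (nat \<Rightarrow> nat \<Rightarrow> nat) \<Rightarrow> nat \<Rightarrow> nat \<Rightarrow> nat \<Rightarrow> nat \<Rightarrow> nat \<Rightarrow> nat \<Rightarrow> nat" where
  "ext_step ad mu m n g a c acc = tab n m (\<lambda>j.
     ad (ad (if j = 0 then 0 else dig m acc (j - 1)) (mu (dig m acc (n - 1)) (dig m g j)))
       (mu c (dig m a j)))"

definition ext_mul ::
  "(nat \<Rightarrow> nat \<Rightarrow> nat) \<Rightarrow> (nat \<Rightarrow> nat \<Rightarrow> nat) \<Rightarrow> nat \<Rightarrow> nat \<Rightarrow> nat \<Rightarrow> nat \<Rightarrow> nat \<Rightarrow> nat" where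
  "ext_mul ad mu m n g a b =
     loop n (\<lambda>i. ext_step ad mu m n g a (dig m b (n - 1 - i))) 0"

lemma polytime_op_ext_add:
  assumes f: "polytime_op C f" and m: "polytime C m" and n: "unary C n"
  shows "polytime_op C (\<lambda>xs. ext_add (f xs) (m xs) (n xs))"
  unfolding polytime_op_def
proof (intro allI impI)
  fix k C1 a b assume D: "descends C k C1" and ab: "polytime C1 a" "polytime C1 b"
  note f1 = polytime_op_descends[OF D f] and m1 = descends_lift[OF D m] and n1 = descends_lift_unary[OF D n]
  show "polytime C1 (\<lambda>ys. ext_add (f ((tl ^^ k) ys)) (m ((tl ^^ k) ys)) (n ((tl ^^ k) ys)) (a ys) (b ys))"
    unfolding ext_add_def
    by (intro polytime_tab n1 m1)
      (intro polytime_op_apply[OF polytime_op_lift[OF _ f1]] polytime_dig polytime_lift[OF _ m1]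
        polytime_lift[OF _ ab(1)] polytime_lift[OF _ ab(2)]; assumption)
qed

lemma polytime_ext_step:
  assumes f: "polytime_op C f" and g: "polytime_op C g" and m: "polytime C m" and n: "unary C n"
    and h: "polytime C h" and a: "polytime C a" and c: "polytime C c" and acc: "polytime C acc"
  shows "polytime C (\<lambda>xs. ext_step (f xs) (g xs) (m xs) (n xs) (h xs) (a xs) (c xs) (acc xs))"
  unfolding ext_step_def
proof (intro polytime_tab n m)
  fix C' assume C': "extends C n C'" "unary C' hd"
  note lift = polytime_lift[OF C'(1)] polytime_op_lift[OF C'(1)] unary_lift[OF C'(1)]
  note f' = polytime_op_apply[OF lift(2)[OF f]] and g' = polytime_op_apply[OF lift(2)[OF g]]
  show "polytime C' (\<lambda>ys. f (tl ys) (f (tl ys) (if hd ys = 0 then 0 else dig (m (tl ys)) (acc (tl ys)) (hd ys - 1))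
       (g (tl ys) (dig (m (tl ys)) (acc (tl ys)) (n (tl ys) - 1)) (dig (m (tl ys)) (h (tl ys)) (hd ys))))
       (g (tl ys) (c (tl ys)) (dig (m (tl ys)) (a (tl ys)) (hd ys))))"
    by (intro f' g' polytime_if_eq polytime_dig polytime_const unary_diff unary_const C'(2) unaryD(1)[OF C'(2)]
        lift(1)[OF m] lift(1)[OF h] lift(1)[OF a] lift(1)[OF c] lift(1)[OF acc] lift(3)[OF n])
qed

lemma bits_tab_le: "bits (tab n m g) \<le> n * bits m + 1"
  using bits_mono[OF tab_le] bits_power_le order_trans by blast

text \<open>No condition on the operands or on the base arithmetic is required, since the last
  Horner step returns a capped array.\<close>

lemma ext_mul_le: "bits (ext_mul f g m n h a b) \<le> n * bits m + 1"
proof (cases n)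
  case 0
  then show ?thesis by (simp add: ext_mul_def floorlog_def)
next
  case (Suc k)
  then show ?thesis unfolding ext_mul_def Suc loop.simps ext_step_def by (metis bits_tab_le)
qed

lemma polytime_op_ext_mul:
  assumes f: "polytime_op C f" and g: "polytime_op C g" and m: "polytime C m" and n: "unary C n"
    and h: "polytime C h"
  shows "polytime_op C (\<lambda>xs. ext_mul (f xs) (g xs) (m xs) (n xs) (h xs))"
  unfolding polytime_op_def
proof (intro allI impI)
  fix k C1 a b assume D: "descends C k C1" and ab: "polytime C1 a" "polytime C1 b"
  define f' g' m' n' h' where d: "f' = (\<lambda>ys. f ((tl ^^ k) ys))" "g' = (\<lambda>ys. g ((tl ^^ k) ys))"
    "m' = (\<lambda>ys. m ((tl ^^ k) ys))" "n' = (\<lambda>ys. n ((tl ^^ k) ys))" "h' = (\<lambda>ys. h ((tl ^^ k) ys))"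
  note 1 = polytime_op_descends[OF D f, folded d] polytime_op_descends[OF D g, folded d]
    descends_lift[OF D m, folded d] descends_lift_unary[OF D n, folded d] descends_lift[OF D h, folded d]
  have "polytime C1 (\<lambda>ys. ext_mul (f' ys) (g' ys) (m' ys) (n' ys) (h' ys) (a ys) (b ys))"
    unfolding ext_mul_def
  proof (rule polytime_loop_bounded[OF 1(4) polytime_const])
    show "pbd C1 (\<lambda>xs. n' xs * bits (m' xs) + 1)"
      by (intro poly_bounded_add poly_bounded_mult poly_bounded_const polytime_bits unaryD 1)
    show "bits (ext_step (f' xs) (g' xs) (m' xs) (n' xs) (h' xs) (a xs) (dig (m' xs) (b xs) (n' xs - 1 - i)) v)
        \<le> n' xs * bits (m' xs) + 1" for xs i v
      unfolding ext_step_def by (rule bits_tab_le)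
    fix C' let ?acc = "\<lambda>ys. loop (hd ys) (\<lambda>i. ext_step (f' (tl ys)) (g' (tl ys)) (m' (tl ys)) (n' (tl ys)) (h' (tl ys))
         (a (tl ys)) (dig (m' (tl ys)) (b (tl ys)) (n' (tl ys) - 1 - i))) 0"
    assume C': "extends C1 n' C'" "unary C' hd" and acc: "polytime C' ?acc"
    note lift = polytime_lift[OF C'(1)] polytime_op_lift[OF C'(1)] unary_lift[OF C'(1)]
    show "polytime C' (\<lambda>ys. ext_step (f' (tl ys)) (g' (tl ys)) (m' (tl ys)) (n' (tl ys)) (h' (tl ys))
         (a (tl ys)) (dig (m' (tl ys)) (b (tl ys)) (n' (tl ys) - 1 - hd ys)) (?acc ys))"
      by (intro polytime_const polytime_ext_step lift(2)[OF 1(1)] lift(2)[OF 1(2)] lift(1)[OF 1(3)] lift(3)[OF 1(4)]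
          lift(1)[OF 1(5)] lift(1)[OF ab(1)] lift(1)[OF ab(2)] polytime_dig unary_diff unary_const acc
          C'(2) unaryD(1)[OF C'(2)])
  qed
  then show "polytime C1 (\<lambda>ys. ext_mul (f ((tl ^^ k) ys)) (g ((tl ^^ k) ys)) (m ((tl ^^ k) ys)) (n ((tl ^^ k) ys))
      (h ((tl ^^ k) ys)) (a ys) (b ys))"
    unfolding d .
qed

lemma bounded_op_ext_mul:
  assumes m: "polytime C m" and n: "unary C n"
  shows "bounded_op C (\<lambda>xs. ext_mul (f xs) (g xs) (m xs) (n xs) (h xs))"
  unfolding bounded_op_def
  by (rule exI[of _ "\<lambda>xs. n xs * bits (m xs) + 1"])
    (intro conjI ballI allI ext_mul_le poly_bounded_add poly_bounded_mult poly_bounded_const polytime_bits unaryD m n)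

section \<open>Clocked simulation of a given program\<close>

primrec aexp_below :: "nat \<Rightarrow> aexp \<Rightarrow> bool" where
  "aexp_below k (Const n) = True"
| "aexp_below k (Reg x) = (x < k)"
| "aexp_below k (Add a b) = (aexp_below k a \<and> aexp_below k b)"
| "aexp_below k (Sub a b) = (aexp_below k a \<and> aexp_below k b)"
| "aexp_below k (Mul a b) = (aexp_below k a \<and> aexp_below k b)"
| "aexp_below k (Div a b) = (aexp_below k a \<and> aexp_below k b)"
| "aexp_below k (aexp.Mod a b) = (aexp_below k a \<and> aexp_below k b)"

primrec program_below :: "nat \<Rightarrow> program \<Rightarrow> bool" where
  "program_below k Skip = True"
| "program_below k (Assign x a) = (x < k \<and> aexp_below k a)"
| "program_below k (Seq c d) = (program_below k c \<and> program_below k d)"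
| "program_below k (Cond b c d) = (aexp_below k b \<and> program_below k c \<and> program_below k d)"
| "program_below k (While b c) = (aexp_below k b \<and> program_below k c)"

lemma aexp_below_mono: "aexp_below k a \<Longrightarrow> k \<le> l \<Longrightarrow> aexp_below l a"
  by (induction a) auto

lemma program_below_mono: "program_below k c \<Longrightarrow> k \<le> l \<Longrightarrow> program_below l c"
  by (induction c) (auto intro: aexp_below_mono)

lemma aexp_below_exists: "\<exists>k. aexp_below k a"
proof (induction a)
  case (Const n) then show ?case by simp
next
  case (Reg x) then show ?case by (auto intro: exI[of _ "Suc x"])
qed (use aexp_below_mono max.cobounded1 max.cobounded2 in \<open>simp, meson\<close>)+

lemma program_below_exists: "\<exists>k\<ge>l. program_below k c"
proof -
  have "\<exists>k. program_below k c"
  proof (induction c)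
    case (Assign x a)
    obtain k where "aexp_below k a" using aexp_below_exists by blast
    then show ?case by (auto intro!: exI[of _ "max k (Suc x)"] elim: aexp_below_mono)
  next
    case (Seq c d)
    then obtain k l where "program_below k c" "program_below l d" by blast
    then show ?case by (auto intro!: exI[of _ "max k l"] elim: program_below_mono)
  next
    case (Cond b c d)
    then obtain k l where "program_below k c" "program_below l d" by blast
    moreover obtain j where "aexp_below j b" using aexp_below_exists by blast
    ultimately show ?case
      by (auto intro!: exI[of _ "max j (max k l)"] elim: program_below_mono aexp_below_mono)
  next
    case (While b c)
    then obtain k where "program_below k c" by blast
    moreover obtain j where "aexp_below j b" using aexp_below_exists by blast
    ultimately show ?case
      by (auto intro!: exI[of _ "max j k"] elim: program_below_mono aexp_below_mono)
  qed simp
  then show ?thesis by (meson max.cobounded1 max.cobounded2 program_below_mono)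
qed

text \<open>A total interpreter for an arbitrary program: every loop is cut off after \<open>l\<close> rounds, and the
  first \<open>k\<close> registers are the base \<open>m\<close> digits of one number.\<close>

fun clocked :: "nat \<Rightarrow> nat \<Rightarrow> nat \<Rightarrow> program \<Rightarrow> nat \<Rightarrow> nat" where
  "clocked k l m Skip st = st"
| "clocked k l m (Assign x a) st = tab k m (\<lambda>j. if j = x then aval a (dig m st) else dig m st j)"
| "clocked k l m (Seq c d) st = clocked k l m d (clocked k l m c st)"
| "clocked k l m (Cond b c d) st =
     (if aval b (dig m st) \<noteq> 0 then clocked k l m c st else clocked k l m d st)"
| "clocked k l m (While b c) st =
     loop l (\<lambda>_ st. if aval b (dig m st) \<noteq> 0 then clocked k l m c st else st) st"

text \<open>Every change of the state is made by \<open>tab\<close>, whose value is at most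
  \<open>m ^ k\<close> in all circumstances. So the state stays short even if the simulated run
  overflows or is cut off.\<close>

lemma clocked_le: "clocked k l m c st \<le> max st (m ^ k)"
proof (induction c arbitrary: st)
  case (Assign x a)
  then show ?case using tab_le by (simp add: max.coboundedI2)
next
  case (Seq c d)
  then show ?case by (metis clocked.simps(3) max.bounded_iff max.cobounded2 order_trans max_def)
next
  case (While b c)
  have "loop i (\<lambda>_ st. if aval b (dig m st) \<noteq> 0 then clocked k l m c st else st) st \<le> max st (m ^ k)" for i
  proof (induction i)
    case (Suc i)
    then show ?case using While[of "loop i (\<lambda>_ st. if aval b (dig m st) \<noteq> 0 then clocked k l m c st else st) st"]
      by auto
  qed simp
  then show ?case by simp
qed auto

lemma polytime_aval:
  assumes "polytime C m" "polytime C st"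
  shows "polytime C (\<lambda>xs. aval a (dig (m xs) (st xs)))"
  by (induction a)
    (simp_all add: assms polytime_const polytime_add polytime_diff polytime_mult polytime_div polytime_mod
      polytime_dig unary_const)

text \<open>The program \<open>c\<close> is fixed, so its loops nest to a constant depth and
  polynomial bounds are composed only constantly often.\<close>

lemma polytime_clocked:
  assumes "unary C l" "polytime C m" "polytime C st"
  shows "polytime C (\<lambda>xs. clocked k (l xs) (m xs) c (st xs))"
  using assms
proof (induction c arbitrary: C l m st)
  case (Assign x a)
  show ?case
    unfolding clocked.simps
  proof (rule polytime_tab[OF unary_const Assign(2)])
    fix C' :: ctx assume C': "extends C (\<lambda>_. k) C'" "unary C' hd"
    note lift = polytime_lift[OF C'(1)]
    show "polytime C' (\<lambda>ys. if hd ys = x then aval a (dig (m (tl ys)) (st (tl ys))) else dig (m (tl ys)) (st (tl ys)) (hd ys))"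
      by (intro polytime_if_eq polytime_aval polytime_dig polytime_const C'(2) unaryD(1)[OF C'(2)]
          lift[OF Assign(2)] lift[OF Assign(3)])
  qed
next
  case (Cond b c d)
  then show ?case by (simp only: clocked.simps) (intro polytime_if_nonzero polytime_aval)
next
  case (While b c)
  let ?F = "\<lambda>xs _ v. if aval b (dig (m xs) v) \<noteq> 0 then clocked k (l xs) (m xs) c v else v"
  show ?case
    unfolding clocked.simps
  proof (rule polytime_loop[OF While(2,4)])
    show "pbd C (\<lambda>xs. bits (st xs) + (k * bits (m xs) + 1))"
      by (intro poly_bounded_add poly_bounded_mult poly_bounded_const polytime_bits While)
    have "loop i (?F xs) (st xs) \<le> max (st xs) (m xs ^ k)" for xs i
    proof (induction i)
      case (Suc i)
      then show ?case using clocked_le[of k "l xs" "m xs" c "loop i (?F xs) (st xs)"] by auto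
    qed simp
    then have "bits (loop i (?F xs) (st xs)) \<le> bits (max (st xs) (m xs ^ k))" for xs i
      by (rule bits_mono)
    moreover have "bits (max v (m xs ^ k)) \<le> bits v + (k * bits (m xs) + 1)" for v xs
      using bits_power_le[of "m xs" k] by (cases "v \<le> m xs ^ k") (simp_all add: max_def)
    ultimately show "bits (loop i (?F xs) (st xs)) \<le> bits (st xs) + (k * bits (m xs) + 1)" for xs i
      using order_trans by blast
  next
    fix C' assume C': "extends C l C'" "unary C' hd" and acc: "polytime C' (\<lambda>ys. loop (hd ys) (?F (tl ys)) (st (tl ys)))"
    note lift = polytime_lift[OF C'(1)] unary_lift[OF C'(1)]
    show "polytime C' (\<lambda>ys. ?F (tl ys) (hd ys) (loop (hd ys) (?F (tl ys)) (st (tl ys))))"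
      by (intro polytime_if_nonzero polytime_aval lift(1)[OF While(3)] acc While(1) lift(2)[OF While(2)])
  qed
qed simp_all

lemma aval_cong: "aexp_below k a \<Longrightarrow> (\<And>x. x < k \<Longrightarrow> s x = t x) \<Longrightarrow> aval a s = aval a t"
  by (induction a) auto

lemma loop_const_shift: "loop (Suc i) (\<lambda>_. G) a = loop i (\<lambda>_. G) (G a)"
  by (induction i) auto

lemma loop_const_stable: "G (loop i (\<lambda>_. G) a) = loop i (\<lambda>_. G) a \<Longrightarrow> i \<le> l \<Longrightarrow>
    loop l (\<lambda>_. G) a = loop i (\<lambda>_. G) a"
proof (induction l)
  case (Suc l)
  then show ?case by (cases "i = Suc l") auto
qed simp

text \<open>The number of rounds of a loop is at most the running time, hence cutting off after
  \<open>l\<close> rounds loses nothing, and no digit overflows because writing a number costs at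
  least its length.\<close>

lemma clocked_exec:
  assumes "exec c s n s'" "n \<le> l" "program_below k c" "\<And>x. x < k \<Longrightarrow> dig (2 ^ w) st x = s x" "l \<le> w"
  shows "x < k \<Longrightarrow> dig (2 ^ w) (clocked k l (2 ^ w) c st) x = s' x"
proof -
  let ?d = "dig (2 ^ w)"
  let ?G = "\<lambda>b c st. if aval b (?d st) \<noteq> 0 then clocked k l (2 ^ w) c st else st"
  \<comment> \<open>For loops the induction needs more: the right state with a false guard is
    already reached after some number of rounds within the running time, so that all further rounds
    up to \<open>l\<close> are idle.\<close>
  have "(\<forall>x<k. ?d (clocked k l (2 ^ w) c st) x = s' x) \<and>
    (\<forall>b c0. c = While b c0 \<longrightarrow> (\<exists>j\<le>n. (\<forall>x<k. ?d (loop j (\<lambda>_. ?G b c0) st) x = s' x) \<and> aval b s' = 0))"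
    using assms
  proof (induction arbitrary: st rule: exec.induct)
    case (Skip s)
    then show ?case by simp
  next
    case (Assign y a s)
    have v: "aval a (?d st) = aval a s" using Assign by (intro aval_cong[of k]) auto
    \<comment> \<open>The length of the assigned value is part of the cost, which is at most
      \<open>l\<close> and hence at most \<open>w\<close>.\<close>
    have "bits (aval a s) \<le> w" using Assign by simp
    then have "aval a s < 2 ^ w" by (simp add: bits_le_iff)
    then have "?d (clocked k l (2 ^ w) (Assign y a) st) x = (s(y := aval a s)) x" if "x < k" for x
    proof -
      have "?d (clocked k l (2 ^ w) (Assign y a) st) x = (if x = y then aval a (?d st) else ?d st x)"
        unfolding clocked.simps
        by (rule dig_tab[OF that]) (use \<open>aval a s < 2 ^ w\<close> v dig_less in auto)
      then show ?thesis using v Assign.prems(3) that by simp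
    qed
    then show ?case by simp
  next
    case (Seq c1 s n1 s1 c2 n2 s2)
    have "\<forall>x<k. ?d (clocked k l (2 ^ w) c1 st) x = s1 x" using Seq by auto
    then show ?case using Seq by auto
  next
    case (CondTrue b s c1 n s1 c2)
    have v: "aval b (?d st) = aval b s" using CondTrue by (intro aval_cong[of k]) auto
    then show ?case using CondTrue by auto
  next
    case (CondFalse b s c1 n s1 c2)
    have v: "aval b (?d st) = aval b s" using CondFalse by (intro aval_cong[of k]) auto
    then show ?case using CondFalse by auto
  next
    case (WhileFalse b s c)
    have v: "aval b (?d st) = 0" using WhileFalse by (subst aval_cong[of k _ _ s]) auto
    then have "loop l (\<lambda>_. ?G b c) st = st" using loop_const_stable[of "?G b c" 0 st l] by simp
    then show ?case using WhileFalse by (auto intro!: exI[of _ 0])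
  next
    case (WhileTrue b s c n1 s1 n2 s2)
    have v: "aval b (?d st) = aval b s" using WhileTrue by (intro aval_cong[of k]) auto
    have 1: "?d (clocked k l (2 ^ w) c st) x = s1 x" if "x < k" for x
      using WhileTrue that by auto
    have "\<exists>j\<le>n2. (\<forall>x<k. ?d (loop j (\<lambda>_. ?G b c) (clocked k l (2 ^ w) c st)) x = s2 x) \<and> aval b s2 = 0"
      using WhileTrue.IH(2)[of "clocked k l (2 ^ w) c st"] WhileTrue.prems 1 by auto
    then obtain j where j: "j \<le> n2" "\<forall>x<k. ?d (loop j (\<lambda>_. ?G b c) (clocked k l (2 ^ w) c st)) x = s2 x" "aval b s2 = 0"
      by blast
    have st: "clocked k l (2 ^ w) c st = ?G b c st" using v WhileTrue by simp
    have fin: "\<forall>x<k. ?d (loop (Suc j) (\<lambda>_. ?G b c) st) x = s2 x"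
      unfolding loop_const_shift st[symmetric] by (rule j)
    have "aval b (?d (loop (Suc j) (\<lambda>_. ?G b c) st)) = 0"
      using fin j(3) WhileTrue.prems by (subst aval_cong[of k _ _ s2]) auto
    then have "loop l (\<lambda>_. ?G b c) st = loop (Suc j) (\<lambda>_. ?G b c) st"
      by (intro loop_const_stable) (use j WhileTrue.prems in auto)
    then have "\<forall>x<k. ?d (clocked k l (2 ^ w) (While b c) st) x = s2 x"
      using fin by (simp only: clocked.simps)
    moreover have "\<exists>i\<le>1 + acost b s + n1 + n2. (\<forall>x<k. ?d (loop i (\<lambda>_. ?G b c) st) x = s2 x) \<and> aval b s2 = 0"
      using fin j(1,3) by (intro exI[of _ "Suc j"]) (simp only: simp_thms, simp)
    ultimately show ?case by (simp only: program.inject) blast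
  qed
  then show "x < k \<Longrightarrow> dig (2 ^ w) (clocked k l (2 ^ w) c st) x = s' x" by blast
qed

section \<open>Codes for ring elements\<close>

primrec rsum :: "('a, 'b) ring_scheme \<Rightarrow> nat \<Rightarrow> (nat \<Rightarrow> 'a) \<Rightarrow> 'a" where
  "rsum S 0 f = \<zero>\<^bsub>S\<^esub>"
| "rsum S (Suc n) f = rsum S n f \<oplus>\<^bsub>S\<^esub> f n"

lemma rsum_cong: "(\<And>j. j < n \<Longrightarrow> f j = g j) \<Longrightarrow> rsum S n f = rsum S n g"
  by (induction n) auto

context cring
begin

lemma rsum_closed [simp]: "(\<And>j. f j \<in> carrier R) \<Longrightarrow> rsum R n f \<in> carrier R"
  by (induction n) auto

lemma rsum_add:
  "(\<And>j. f j \<in> carrier R) \<Longrightarrow> (\<And>j. g j \<in> carrier R) \<Longrightarrow>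
    rsum R n (\<lambda>j. f j \<oplus> g j) = rsum R n f \<oplus> rsum R n g"
proof (induction n)
  case (Suc n)
  have "rsum R n f \<in> carrier R" "rsum R n g \<in> carrier R" using Suc.prems by auto
  then show ?case using Suc.IH Suc.prems by (simp add: a_ac)
qed simp

lemma rsum_mult:
  "c \<in> carrier R \<Longrightarrow> (\<And>j. f j \<in> carrier R) \<Longrightarrow> rsum R n (\<lambda>j. c \<otimes> f j) = c \<otimes> rsum R n f"
  by (induction n) (auto simp: r_distr)

lemma rsum_shift:
  "(\<And>j. f j \<in> carrier R) \<Longrightarrow> rsum R (Suc n) f = f 0 \<oplus> rsum R n (\<lambda>j. f (Suc j))"
proof (induction n)
  case (Suc n)
  have "rsum R n (\<lambda>j. f (Suc j)) \<in> carrier R" using Suc.prems by auto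
  then show ?case using Suc.IH[OF Suc.prems] Suc.prems by (simp add: a_assoc)
qed simp

lemma rsum_zero: "rsum R n (\<lambda>_. \<zero>) = \<zero>"
  by (induction n) auto

lemma rsum_swap:
  assumes f: "\<And>i j. f i j \<in> carrier R"
  shows "rsum R n (\<lambda>i. rsum R k (\<lambda>j. f i j)) = rsum R k (\<lambda>j. rsum R n (\<lambda>i. f i j))"
proof (induction n)
  case (Suc n)
  have "rsum R k (\<lambda>j. rsum R n (\<lambda>i. f i j)) \<oplus> rsum R k (\<lambda>j. f n j) =
      rsum R k (\<lambda>j. rsum R n (\<lambda>i. f i j) \<oplus> f n j)"
    by (intro rsum_add[symmetric]) (auto simp: f)
  then show ?case using Suc by simp
qed (simp add: rsum_zero)

end

text \<open>Numbers below \<open>m\<close> code elements of \<open>S\<close> by \<open>\<kappa>\<close>, and \<open>ad\<close> and \<open>mu\<close> compute sums and products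
  of codes. The map \<open>\<kappa>\<close> need not be injective: a quotient algebra is coded by any of its points.\<close>

locale coded = cring S for S (structure) +
  fixes \<kappa> :: "nat \<Rightarrow> 'a" and m :: nat and ad mu :: "nat \<Rightarrow> nat \<Rightarrow> nat"
  assumes m: "1 < m"
    and code_closed: "x < m \<Longrightarrow> \<kappa> x \<in> carrier S"
    and code_0: "\<kappa> 0 = \<zero>" and code_1: "\<kappa> 1 = \<one>"
    and ad_less: "x < m \<Longrightarrow> y < m \<Longrightarrow> ad x y < m"
    and mu_less: "x < m \<Longrightarrow> y < m \<Longrightarrow> mu x y < m"
    and code_ad: "x < m \<Longrightarrow> y < m \<Longrightarrow> \<kappa> (ad x y) = \<kappa> x \<oplus> \<kappa> y"
    and code_mu: "x < m \<Longrightarrow> y < m \<Longrightarrow> \<kappa> (mu x y) = \<kappa> x \<otimes> \<kappa> y"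
begin

definition ev :: "'a \<Rightarrow> nat \<Rightarrow> nat \<Rightarrow> 'a" where
  "ev \<theta> n a = rsum S n (\<lambda>j. \<kappa> (dig m a j) \<otimes> \<theta> [^] j)"

lemma dig_m: "dig m a j < m"
  using m by (simp add: dig_less)

lemma ev_closed: "\<theta> \<in> carrier S \<Longrightarrow> ev \<theta> n a \<in> carrier S"
  unfolding ev_def by (intro rsum_closed) (simp add: code_closed dig_m)

lemma ev_tab: "(\<And>j. j < n \<Longrightarrow> g j < m) \<Longrightarrow> ev \<theta> n (tab n m g) = rsum S n (\<lambda>j. \<kappa> (g j) \<otimes> \<theta> [^] j)"
  unfolding ev_def by (intro rsum_cong) (simp add: dig_tab)

lemma ev_ext_add:
  assumes "\<theta> \<in> carrier S"
  shows "ev \<theta> n (ext_add ad m n a b) = ev \<theta> n a \<oplus> ev \<theta> n b"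
proof -
  have "ev \<theta> n (ext_add ad m n a b) = rsum S n (\<lambda>j. \<kappa> (ad (dig m a j) (dig m b j)) \<otimes> \<theta> [^] j)"
    unfolding ext_add_def by (intro ev_tab) (simp add: ad_less dig_m)
  also have "\<dots> = rsum S n (\<lambda>j. \<kappa> (dig m a j) \<otimes> \<theta> [^] j \<oplus> \<kappa> (dig m b j) \<otimes> \<theta> [^] j)"
    using assms by (intro rsum_cong) (simp add: code_ad dig_m l_distr code_closed)
  also have "\<dots> = ev \<theta> n a \<oplus> ev \<theta> n b"
    unfolding ev_def by (intro rsum_add) (simp_all add: code_closed dig_m assms)
  finally show ?thesis .
qed

lemma ev_0: "\<theta> \<in> carrier S \<Longrightarrow> ev \<theta> n 0 = \<zero>"
  unfolding ev_def by (induction n) (auto simp: dig_def code_0)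

lemma ev_linear:
  assumes "\<theta> \<in> carrier S" "a < m" "b < m" "2 \<le> n"
  shows "ev \<theta> n (a + b * m) = \<kappa> a \<oplus> \<kappa> b \<otimes> \<theta>"
proof -
  have d: "dig m (a + b * m) j = (if j = 0 then a else if j = 1 then b else 0)" for j
  proof (cases "j \<ge> 1")
    case True
    then obtain i where i: "j = Suc i" by (cases j) auto
    have "(a + b * m) div m ^ j = b div m ^ i"
      using assms m by (simp add: i div_mult2_eq)
    then have "dig m (a + b * m) j = dig m b i" by (simp add: dig_def)
    then show ?thesis using assms dig_small[of b m i] by (simp add: i)
  next
    case False
    then have "j = 0" by simp
    then show ?thesis using assms by (simp add: dig_def)
  qed
  obtain k where n: "n = Suc (Suc k)" using assms(4) by (metis add_2_eq_Suc le_Suc_ex)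
  define F where "F = (\<lambda>j. \<kappa> (dig m (a + b * m) j) \<otimes> \<theta> [^] j)"
  have F: "F j \<in> carrier S" for j
    unfolding F_def using assms by (simp add: code_closed dig_m)
  have "F 0 = \<kappa> a" "F (Suc 0) = \<kappa> b \<otimes> \<theta>"
    using assms d[of 0] d[of 1] by (simp_all add: F_def code_closed)
  moreover have "rsum S k (\<lambda>j. F (Suc (Suc j))) = rsum S k (\<lambda>_. \<zero>)"
    unfolding F_def using assms by (intro rsum_cong) (simp add: d code_0 del: nat_pow_Suc)
  moreover have "rsum S n F = F 0 \<oplus> (F (Suc 0) \<oplus> rsum S k (\<lambda>j. F (Suc (Suc j))))"
    unfolding n using F rsum_shift[of F "Suc k"] rsum_shift[of "\<lambda>j. F (Suc j)" k] by (simp del: rsum.simps)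
  ultimately show ?thesis
    using assms F[of 1] by (simp add: ev_def F_def[symmetric] rsum_zero code_closed)
qed

lemma ev_const:
  assumes "\<theta> \<in> carrier S" "a < m" "1 \<le> n"
  shows "ev \<theta> n a = \<kappa> a"
proof -
  obtain k where n: "n = Suc k" using assms by (cases n) auto
  have "rsum S k (\<lambda>j. \<kappa> (dig m a (Suc j)) \<otimes> \<theta> [^] Suc j) = rsum S k (\<lambda>_. \<zero>)"
    using assms by (intro rsum_cong) (simp add: dig_small code_0 del: nat_pow_Suc)
  moreover have "\<kappa> (dig m a j) \<otimes> \<theta> [^] j \<in> carrier S" for j
    using assms by (simp add: code_closed dig_m)
  ultimately show ?thesis
    unfolding ev_def n using assms
    by (subst rsum_shift, simp) (simp add: dig_small rsum_zero code_closed)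
qed

text \<open>Multiplication by \<theta> shifts the digits by one place, and the digit pushed out to
  place \<open>n\<close> re-enters as a multiple of \<open>h\<close>.\<close>

lemma ev_ext_step:
  assumes \<theta>: "\<theta> \<in> carrier S" and h: "\<theta> [^] n = ev \<theta> n h" and n: "n \<ge> 1" and c: "c < m"
  shows "ev \<theta> n (ext_step ad mu m n h a c acc) = \<theta> \<otimes> ev \<theta> n acc \<oplus> \<kappa> c \<otimes> ev \<theta> n a"
proof -
  obtain k where k: "n = Suc k" using n by (cases n) auto
  let ?t = "dig m acc k"
  let ?s = "\<lambda>j. if j = 0 then 0 else dig m acc (j - 1)"
  have s: "?s j < m" for j using m dig_m by simp
  note cl = code_closed[OF s] code_closed[OF dig_m] code_closed[OF c] \<theta>
  have "ev \<theta> n (ext_step ad mu m n h a c acc) =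
      rsum S n (\<lambda>j. \<kappa> (ad (ad (?s j) (mu ?t (dig m h j))) (mu c (dig m a j))) \<otimes> \<theta> [^] j)"
    unfolding ext_step_def using s c k by (subst ev_tab) (simp_all add: ad_less mu_less dig_m)
  also have "\<dots> = rsum S n (\<lambda>j. (\<kappa> (?s j) \<otimes> \<theta> [^] j \<oplus> \<kappa> ?t \<otimes> (\<kappa> (dig m h j) \<otimes> \<theta> [^] j)) \<oplus>
      \<kappa> c \<otimes> (\<kappa> (dig m a j) \<otimes> \<theta> [^] j))"
  proof (rule rsum_cong)
    fix j
    have "\<kappa> (ad (ad (?s j) (mu ?t (dig m h j))) (mu c (dig m a j))) =
        (\<kappa> (?s j) \<oplus> \<kappa> ?t \<otimes> \<kappa> (dig m h j)) \<oplus> \<kappa> c \<otimes> \<kappa> (dig m a j)"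
      using s[of j] c by (simp only: code_ad code_mu ad_less mu_less dig_m)
    then show "\<kappa> (ad (ad (?s j) (mu ?t (dig m h j))) (mu c (dig m a j))) \<otimes> \<theta> [^] j =
        (\<kappa> (?s j) \<otimes> \<theta> [^] j \<oplus> \<kappa> ?t \<otimes> (\<kappa> (dig m h j) \<otimes> \<theta> [^] j)) \<oplus> \<kappa> c \<otimes> (\<kappa> (dig m a j) \<otimes> \<theta> [^] j)"
      using cl(1)[of j] cl(2)[of acc k] cl(2)[of h j] cl(2)[of a j] cl(3,4)
      by (simp only: l_distr m_assoc m_closed a_closed nat_pow_closed)
  qed
  also have "\<dots> = (rsum S n (\<lambda>j. \<kappa> (?s j) \<otimes> \<theta> [^] j) \<oplus> \<kappa> ?t \<otimes> ev \<theta> n h) \<oplus> \<kappa> c \<otimes> ev \<theta> n a"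
    unfolding ev_def using cl
    by (simp only: rsum_add rsum_mult rsum_closed m_closed a_closed nat_pow_closed)
  also have "rsum S n (\<lambda>j. \<kappa> (?s j) \<otimes> \<theta> [^] j) \<oplus> \<kappa> ?t \<otimes> ev \<theta> n h = \<theta> \<otimes> ev \<theta> n acc"
  proof -
    have "rsum S n (\<lambda>j. \<kappa> (?s j) \<otimes> \<theta> [^] j) = \<kappa> 0 \<otimes> \<theta> [^] (0::nat) \<oplus> rsum S k (\<lambda>j. \<kappa> (dig m acc j) \<otimes> \<theta> [^] Suc j)"
      unfolding k using cl by (subst rsum_shift) (simp_all del: nat_pow_Suc)
    also have "\<dots> = rsum S k (\<lambda>j. \<theta> \<otimes> (\<kappa> (dig m acc j) \<otimes> \<theta> [^] j))"
      using cl by (simp add: code_0 m_ac)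
    also have "\<dots> = \<theta> \<otimes> ev \<theta> k acc"
      unfolding ev_def using cl by (intro rsum_mult) auto
    finally have "rsum S n (\<lambda>j. \<kappa> (?s j) \<otimes> \<theta> [^] j) \<oplus> \<kappa> ?t \<otimes> ev \<theta> n h =
        \<theta> \<otimes> ev \<theta> k acc \<oplus> \<kappa> ?t \<otimes> \<theta> [^] n" by (simp add: h)
    also have "\<dots> = \<theta> \<otimes> (ev \<theta> k acc \<oplus> \<kappa> ?t \<otimes> \<theta> [^] k)"
      using cl ev_closed[OF \<theta>] by (simp add: k r_distr m_ac)
    also have "ev \<theta> k acc \<oplus> \<kappa> ?t \<otimes> \<theta> [^] k = ev \<theta> n acc" by (simp add: ev_def k)
    finally show ?thesis .
  qed
  finally show ?thesis .
qed

lemma ev_ext_mul: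
  assumes \<theta>: "\<theta> \<in> carrier S" and h: "\<theta> [^] n = ev \<theta> n h" and n: "n \<ge> 1"
  shows "ev \<theta> n (ext_mul ad mu m n h a b) = ev \<theta> n a \<otimes> ev \<theta> n b"
proof -
  let ?l = "\<lambda>i. loop i (\<lambda>i. ext_step ad mu m n h a (dig m b (n - 1 - i))) 0"
  \<comment> \<open>The part of \<open>b\<close> that Horner's scheme has processed after
    \<open>i\<close> rounds: the polynomial formed by its \<open>i\<close> leading digits.\<close>
  let ?h = "\<lambda>i. rsum S i (\<lambda>j. \<kappa> (dig m b (n - i + j)) \<otimes> \<theta> [^] j)"
  note cl = code_closed[OF dig_m] \<theta> ev_closed[OF \<theta>]
  have "ev \<theta> n (?l i) = ev \<theta> n a \<otimes> ?h i" if "i \<le> n" for i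
    using that
  proof (induction i)
    case 0
    then show ?case using cl by (simp add: ev_0)
  next
    case (Suc i)
    let ?c = "\<kappa> (dig m b (n - Suc i))"
    have "?h (Suc i) = ?c \<oplus> rsum S i (\<lambda>j. \<kappa> (dig m b (n - i + j)) \<otimes> \<theta> [^] Suc j)"
      using Suc.prems cl by (subst rsum_shift) (simp_all add: Suc_diff_Suc del: nat_pow_Suc flip: add_Suc)
    also have "rsum S i (\<lambda>j. \<kappa> (dig m b (n - i + j)) \<otimes> \<theta> [^] Suc j) =
        rsum S i (\<lambda>j. \<theta> \<otimes> (\<kappa> (dig m b (n - i + j)) \<otimes> \<theta> [^] j))"
      using cl by (simp add: m_ac)
    also have "\<dots> = \<theta> \<otimes> ?h i" using cl by (intro rsum_mult) auto
    finally have hs: "?h (Suc i) = ?c \<oplus> \<theta> \<otimes> ?h i" .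
    have hc: "?h i \<in> carrier S" using cl by auto
    have "ev \<theta> n (?l (Suc i)) = \<theta> \<otimes> ev \<theta> n (?l i) \<oplus> ?c \<otimes> ev \<theta> n a"
      by (simp add: ev_ext_step[OF \<theta> h n dig_m])
    also have "\<dots> = \<theta> \<otimes> (ev \<theta> n a \<otimes> ?h i) \<oplus> ?c \<otimes> ev \<theta> n a" using Suc by simp
    also have "\<dots> = ev \<theta> n a \<otimes> ?h (Suc i)"
      unfolding hs using cl hc by (simp add: r_distr m_ac a_ac)
    finally show ?case .
  qed
  from this[of n] show ?thesis by (simp add: ext_mul_def ev_def)
qed

text \<open>The operations on codes do not mention \<theta>; only the coding map does. The lemma is
  used with the class of X to code the field, and with every conjugate of \<alpha> to read one
  computation in A at all these points simultaneously.\<close>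

lemma coded_ext:
  assumes \<theta>: "\<theta> \<in> carrier S" and h: "\<theta> [^] n = ev \<theta> n h" and n: "n \<ge> 1"
  shows "coded S (ev \<theta> n) (m ^ n) (ext_add ad m n) (ext_mul ad mu m n h)"
proof unfold_locales
  show "1 < m ^ n" using one_less_power[OF m, of n] n by simp
  show "ev \<theta> n x \<in> carrier S" for x by (rule ev_closed[OF \<theta>])
  show "ev \<theta> n 0 = \<zero>" by (rule ev_0[OF \<theta>])
  show "ev \<theta> n 1 = \<one>" using ev_const[OF \<theta> m n] code_1 by simp
  show "ext_add ad m n x y < m ^ n" for x y
    unfolding ext_add_def using m by (intro tab_less) simp
  show "ext_mul ad mu m n h x y < m ^ n" for x y
  proof -
    obtain k where "n = Suc k" using n by (cases n) auto
    then show ?thesis using m unfolding ext_mul_def ext_step_def by (simp only: loop.simps tab_less)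
  qed
  show "ev \<theta> n (ext_add ad m n x y) = ev \<theta> n x \<oplus> ev \<theta> n y" for x y
    by (rule ev_ext_add[OF \<theta>])
  show "ev \<theta> n (ext_mul ad mu m n h x y) = ev \<theta> n x \<otimes> ev \<theta> n y" for x y
    by (rule ev_ext_mul[OF \<theta> h n])
qed

text \<open>After \<open>i\<close> rounds the exponent reached consists of the \<open>i\<close>
  leading ones among the \<open>l\<close> binary digits, that is,
  \<open>k div 2 ^ (l - i)\<close>.\<close>

lemma repeated_squaring_correct:
  assumes x: "x < m" and k: "k < 2 ^ l"
  shows "repeated_squaring mu l x k < m" "\<kappa> (repeated_squaring mu l x k) = \<kappa> x [^] k"
proof -
  let ?F = "\<lambda>i acc. if k div 2 ^ (l - 1 - i) mod 2 = 1 then mu (mu acc acc) x else mu acc acc"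
  have "loop i ?F 1 < m \<and> \<kappa> (loop i ?F 1) = \<kappa> x [^] (k div 2 ^ (l - i))" if "i \<le> l" for i
    using that
  proof (induction i)
    case 0
    then show ?case using k m code_1 by simp
  next
    case (Suc i)
    let ?v = "loop i ?F 1" and ?e = "k div 2 ^ (l - i)" and ?d = "k div 2 ^ (l - Suc i)"
    have v: "?v < m" "\<kappa> ?v = \<kappa> x [^] ?e" using Suc by auto
    have "l - i = Suc (l - Suc i)" using Suc.prems by simp
    then have "2 ^ (l - i) = (2 ^ (l - Suc i) * 2 :: nat)" by simp
    then have "?e = ?d div 2" by (simp only: div_mult2_eq)
    then have d: "?d = ?e + ?e + ?d mod 2" using div_mult_mod_eq[of ?d 2] by linarith
    have sq: "\<kappa> (mu ?v ?v) = \<kappa> x [^] (?e + ?e)"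
      using v x by (simp add: code_mu nat_pow_mult code_closed)
    have "loop (Suc i) ?F 1 < m" using v x by (simp add: mu_less)
    moreover have "\<kappa> (loop (Suc i) ?F 1) = \<kappa> x [^] ?d"
    proof (cases "?d mod 2 = 1")
      case True
      then have "\<kappa> (loop (Suc i) ?F 1) = \<kappa> x [^] Suc (?e + ?e)"
        using sq v x by (simp add: code_mu mu_less)
      also have "Suc (?e + ?e) = ?d" using d True by linarith
      finally show ?thesis .
    next
      case False
      then have "?d mod 2 = 0" by simp
      then show ?thesis using d sq False by simp
    qed
    ultimately show ?case by blast
  qed
  from this[of l] show "repeated_squaring mu l x k < m" "\<kappa> (repeated_squaring mu l x k) = \<kappa> x [^] k"
    by (simp_all add: repeated_squaring_def)
qed

end

section \<open>Codes for the presented field\<close>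

hide_const (open) up_ring.coeff up_ring.monom module.smult

locale presented =
  fixes p :: nat and f :: "int poly"
  assumes presentation: "field_presentation (p, f)"
begin

abbreviation "F \<equiv> Fq (p, f)"
abbreviation "d \<equiv> degree f"

lemma prime_p: "prime p" and monic: "lead_coeff f = 1" and coeff_f: "coeff f i \<in> {0..<int p}"
  and field_F: "field F"
  using presentation by (auto simp: field_presentation_def)

sublocale F: field F by (rule field_F)

lemma p_gt_1: "1 < p" using prime_p by (rule prime_gt_1_nat)

lemma carrier_F: "carrier F = {a. degree a < d \<and> (\<forall>i. coeff a i \<in> {0..<int p})}"
  and zero_F [simp]: "\<zero>\<^bsub>F\<^esub> = 0" and one_F [simp]: "\<one>\<^bsub>F\<^esub> = 1"
  and mult_F: "a \<otimes>\<^bsub>F\<^esub> b = reduce p f (a * b)" and add_F: "a \<oplus>\<^bsub>F\<^esub> b = reduce p f (a + b)"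
  by (simp_all add: Fq_def)

lemma d_pos: "1 \<le> d"
  using F.zero_closed unfolding carrier_F by auto

section \<open>Congruence modulo the ideal generated by \<open>f\<close> and
  \<open>p\<close>\<close>

definition cg :: "int poly \<Rightarrow> int poly \<Rightarrow> bool" where
  "cg a b \<longleftrightarrow> (\<exists>u v. a - b = u * f + smult (int p) v)"

lemma cg_refl: "cg a a"
  unfolding cg_def by (rule exI[of _ 0], rule exI[of _ 0]) simp

lemma cg_sym: "cg a b \<Longrightarrow> cg b a"
proof -
  assume "cg a b"
  then obtain u v where "a - b = u * f + smult (int p) v" unfolding cg_def by blast
  then have "b - a = (- u) * f + smult (int p) (- v)" by (simp add: algebra_simps)
  then show ?thesis unfolding cg_def by blast
qed

lemma cg_add: "cg a b \<Longrightarrow> cg a' b' \<Longrightarrow> cg (a + a') (b + b')"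
proof -
  assume "cg a b" "cg a' b'"
  then obtain u v u' v' where "a - b = u * f + smult (int p) v" "a' - b' = u' * f + smult (int p) v'"
    unfolding cg_def by blast
  then have "(a + a') - (b + b') = (u + u') * f + smult (int p) (v + v')"
    by (simp add: algebra_simps smult_add_right)
  then show ?thesis unfolding cg_def by blast
qed

lemma cg_trans: "cg a b \<Longrightarrow> cg b c \<Longrightarrow> cg a c"
  using cg_add[of a b b c] unfolding cg_def by (simp add: algebra_simps)

lemma cg_mult_left: "cg a b \<Longrightarrow> cg (c * a) (c * b)"
proof -
  assume "cg a b"
  then obtain u v where "a - b = u * f + smult (int p) v" unfolding cg_def by blast
  then have "c * a - c * b = (c * u) * f + smult (int p) (c * v)"
    by (simp add: algebra_simps flip: right_diff_distrib)
  then show ?thesis unfolding cg_def by blast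
qed

lemma cg_mult: "cg a b \<Longrightarrow> cg a' b' \<Longrightarrow> cg (a * a') (b * b')"
  using cg_trans[of "a * a'" "a * b'" "b * b'"] cg_mult_left[of a' b' a] cg_mult_left[of a b b']
  by (simp add: mult.commute)

lemma cgI:
  assumes "\<And>i. int p dvd coeff (a - b - u * f) i"
  shows "cg a b"
proof -
  have "a - b = u * f + smult (int p) (map_poly (\<lambda>c. c div int p) (a - b - u * f))"
  proof (rule poly_eqI)
    fix i
    have "int p * (coeff (a - b - u * f) i div int p) = coeff (a - b - u * f) i"
      using assms by simp
    then show "coeff (a - b) i = coeff (u * f + smult (int p) (map_poly (\<lambda>c. c div int p) (a - b - u * f))) i"
      by (simp add: coeff_map_poly)
  qed
  then show ?thesis unfolding cg_def by blast
qed

lemma pseudo_mod_f: "degree (pseudo_mod a f) < d" "\<exists>q. a = f * q + pseudo_mod a f"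
proof -
  have f: "f \<noteq> 0" using monic by auto
  obtain q r where qr: "pseudo_divmod a f = (q, r)" by fastforce
  then have r: "pseudo_mod a f = r" by (simp add: pseudo_mod_def)
  from pseudo_divmod[OF f qr] show "\<exists>q. a = f * q + pseudo_mod a f" "degree (pseudo_mod a f) < d"
    unfolding r using monic d_pos by auto
qed

lemma reduce_in_carrier: "reduce p f a \<in> carrier F"
proof -
  have "degree (reduce p f a) \<le> degree (pseudo_mod a f)"
    unfolding reduce_def by (rule map_poly_degree_leq)
  then have "degree (reduce p f a) < d" using pseudo_mod_f(1)[of a] by simp
  moreover have "coeff (reduce p f a) i \<in> {0..<int p}" for i
    using p_gt_1 by (simp add: reduce_def coeff_map_poly)
  ultimately show ?thesis unfolding carrier_F by blast
qed

lemma cg_reduce: "cg (reduce p f a) a"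
proof -
  obtain q where q: "a = f * q + pseudo_mod a f" using pseudo_mod_f(2) by blast
  show ?thesis
  proof (rule cgI[where u = "- q"])
    fix i
    have e: "reduce p f a - a - (- q) * f = reduce p f a - pseudo_mod a f"
      using q by (simp add: algebra_simps)
    show "int p dvd coeff (reduce p f a - a - (- q) * f) i"
      unfolding e by (simp add: reduce_def coeff_map_poly mod_eq_dvd_iff[symmetric])
  qed
qed

text \<open>Representatives are unique: once the cofactor of \<open>f\<close> is reduced modulo
  \<open>p\<close>, its leading coefficient would survive in a degree of at least \<open>d\<close>,
  as \<open>f\<close> is monic, whereas a difference of representatives has degree below
  \<open>d\<close>.\<close>

lemma carrier_eqI:
  assumes a: "a \<in> carrier F" and b: "b \<in> carrier F" and "cg a b"
  shows "a = b"
proof -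
  obtain u v where uv: "a - b = u * f + smult (int p) v" using assms unfolding cg_def by blast
  define w where "w = map_poly (\<lambda>c. c mod int p) u"
  define v' where "v' = v + map_poly (\<lambda>c. c div int p) u * f"
  have "u = w + smult (int p) (map_poly (\<lambda>c. c div int p) u)"
    by (rule poly_eqI) (simp add: w_def coeff_map_poly)
  then have "u * f = w * f + smult (int p) (map_poly (\<lambda>c. c div int p) u * f)"
    by (metis distrib_right mult_smult_left)
  then have e: "a - b = w * f + smult (int p) v'"
    using uv by (simp add: v'_def smult_add_right)
  have "w = 0"
  proof (rule ccontr)
    assume w: "w \<noteq> 0"
    let ?n = "degree w + d"
    have "degree (a - b) < d" using a b degree_diff_less unfolding carrier_F by blast
    then have "0 = coeff (a - b) ?n" by (simp add: coeff_eq_0 del: coeff_diff)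
    also have "\<dots> = lead_coeff w + int p * coeff v' ?n"
      unfolding e using coeff_mult_degree_sum[of w f] monic by simp
    finally have "int p dvd lead_coeff w" by (metis add.commute add_0_right dvd_add_right_iff dvd_triv_left)
    moreover have "0 \<le> lead_coeff w" "lead_coeff w < int p"
      using p_gt_1 by (simp_all add: w_def coeff_map_poly)
    ultimately have "lead_coeff w = 0" by (metis dvd_imp_mod_0 mod_pos_pos_trivial)
    then show False using w by simp
  qed
  then have "int p dvd coeff a i - coeff b i" for i
    using e by (metis coeff_diff coeff_smult dvd_triv_left mult_zero_left add_0)
  then have "coeff a i mod int p = coeff b i mod int p" for i
    by (simp add: mod_eq_dvd_iff)
  then have "coeff a i = coeff b i" for i
    using a b unfolding carrier_F by (auto simp: mod_pos_pos_trivial)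
  then show ?thesis by (rule poly_eqI)
qed

lemma reduce_eqI: "x \<in> carrier F \<Longrightarrow> cg x y \<Longrightarrow> reduce p f y = x"
  using carrier_eqI cg_reduce cg_trans cg_sym reduce_in_carrier by meson

lemma reduce_add: "reduce p f (a + b) = reduce p f a \<oplus>\<^bsub>F\<^esub> reduce p f b"
  unfolding add_F
  by (rule reduce_eqI[OF reduce_in_carrier]) (meson cg_trans cg_reduce cg_add)

lemma reduce_mult: "reduce p f (a * b) = reduce p f a \<otimes>\<^bsub>F\<^esub> reduce p f b"
  unfolding mult_F
  by (rule reduce_eqI[OF reduce_in_carrier]) (meson cg_trans cg_reduce cg_mult)

lemma reduce_carrier: "x \<in> carrier F \<Longrightarrow> reduce p f x = x"
  by (rule reduce_eqI[OF _ cg_refl])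

lemma reduce_1: "reduce p f 1 = 1"
  using F.one_closed reduce_carrier by simp

lemma reduce_0: "reduce p f 0 = 0"
  using F.zero_closed reduce_carrier by simp

lemma reduce_power: "reduce p f (a ^ n) = reduce p f a [^]\<^bsub>F\<^esub> n"
  by (induction n) (simp_all add: reduce_1 reduce_mult power_Suc2 del: power_Suc)

definition const_code :: "nat \<Rightarrow> int poly" where
  "const_code c = [:int c:]"

lemma const_in_carrier: "c < p \<Longrightarrow> const_code c \<in> carrier F"
  using d_pos by (auto simp: carrier_F const_code_def coeff_pCons split: nat.split)

lemma const_mod: "const_code (c mod p) = reduce p f [:int c:]"
proof (rule reduce_eqI[symmetric])
  show "const_code (c mod p) \<in> carrier F" using p_gt_1 by (intro const_in_carrier) simp
  have "int p dvd int (c mod p) - int c" by (simp add: zmod_int mod_eq_dvd_iff[symmetric])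
  then show "cg (const_code (c mod p)) [:int c:]"
    by (intro cgI[where u = 0]) (auto simp: const_code_def coeff_pCons split: nat.split)
qed

sublocale const: coded F const_code p "\<lambda>a b. (a + b) mod p" "\<lambda>a b. (a * b) mod p"
proof unfold_locales
  show "const_code 0 = \<zero>\<^bsub>F\<^esub>" "const_code 1 = \<one>\<^bsub>F\<^esub>" by (simp_all add: const_code_def one_pCons)
  fix x y assume xy: "x < p" "y < p"
  have r: "reduce p f [:int z:] = const_code z" if "z < p" for z
    using const_mod[of z] that by simp
  show "const_code ((x + y) mod p) = const_code x \<oplus>\<^bsub>F\<^esub> const_code y"
    unfolding const_mod using reduce_add[of "[:int x:]" "[:int y:]"] xy by (simp add: r)
  show "const_code ((x * y) mod p) = const_code x \<otimes>\<^bsub>F\<^esub> const_code y"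
    unfolding const_mod using reduce_mult[of "[:int x:]" "[:int y:]"] xy by (simp add: r mult.commute)
qed (use p_gt_1 const_in_carrier in simp_all)

text \<open>The class of X. It has to be reduced, since for d = 1 the polynomial X is not itself a
  representative.\<close>

definition \<theta> :: "int poly" where "\<theta> = reduce p f [:0, 1:]"

lemma \<theta>_closed: "\<theta> \<in> carrier F" unfolding \<theta>_def by (rule reduce_in_carrier)

lemma rsum_\<theta>:
  assumes "\<And>j. c j < p"
  shows "rsum F n (\<lambda>j. const_code (c j) \<otimes>\<^bsub>F\<^esub> \<theta> [^]\<^bsub>F\<^esub> j) = reduce p f (\<Sum>j<n. monom (int (c j)) j)"
proof (induction n)
  case (Suc n)
  have "reduce p f (monom (int (c n)) n) = const_code (c n) \<otimes>\<^bsub>F\<^esub> \<theta> [^]\<^bsub>F\<^esub> n"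
  proof -
    have "monom (int (c n)) n = [:int (c n):] * [:0, 1:] ^ n"
      by (simp add: monom_altdef)
    then show ?thesis
      using const_mod[of "c n"] assms[of n] by (simp only: reduce_mult reduce_power \<theta>_def mod_less)
  qed
  then show ?case using Suc by (simp add: reduce_add)
qed (simp add: reduce_0)

lemma coeff_sum_monom: "coeff (\<Sum>j<n. monom (c j) j) i = (if i < n then c i else 0)"
  by (simp add: coeff_sum)

text \<open>The code of X^d - f modulo \<open>p\<close>: the negated coefficients of
  \<open>f\<close> below the leading one, which is what X^d is replaced by in products.\<close>

definition low_code :: nat where
  "low_code = tab d p (\<lambda>j. (p - dig p (encode_poly p f) j) mod p)"

lemma dig_encode: "(\<And>i. coeff a i \<in> {0..<int p}) \<Longrightarrow> int (dig p (encode_poly p a) j) = coeff a j"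
proof (induction a arbitrary: j)
  case 0
  then show ?case by (simp add: encode_poly_def dig_def)
next
  case (pCons c a)
  have a: "coeff a i \<in> {0..<int p}" for i using pCons.prems[of "Suc i"] by simp
  have c: "0 \<le> c" "c < int p" using pCons.prems[of 0] by simp_all
  have pos: "0 \<le> poly a (int p)"
    unfolding poly_altdef using a by (intro sum_nonneg mult_nonneg_nonneg) auto
  have e: "encode_poly p (pCons c a) = nat c + p * encode_poly p a"
    unfolding encode_poly_def using c pos by (simp add: nat_add_distrib nat_mult_distrib)
  have cp: "nat c < p" using c by simp
  show ?case
  proof (cases j)
    case 0
    then show ?thesis using c cp by (simp add: e dig_def)
  next
    case (Suc i)
    have "(nat c + p * encode_poly p a) div p ^ Suc i = encode_poly p a div p ^ i"
      using cp by (simp add: div_mult2_eq)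
    then have "dig p (encode_poly p (pCons c a)) j = dig p (encode_poly p a) i"
      by (simp add: e Suc dig_def)
    then show ?thesis using pCons.IH[OF a] Suc by simp
  qed
qed

lemma \<theta>_power_d: "\<theta> [^]\<^bsub>F\<^esub> d = const.ev \<theta> d low_code"
proof -
  let ?c = "\<lambda>j. (p - dig p (encode_poly p f) j) mod p"
  have c: "?c j < p" for j using p_gt_1 by simp
  have "const.ev \<theta> d low_code = reduce p f (\<Sum>j<d. monom (int (?c j)) j)"
    unfolding low_code_def using c by (subst const.ev_tab) (simp_all only: rsum_\<theta>)
  also have "\<dots> = reduce p f ([:0, 1:] ^ d)"
  proof (rule reduce_eqI[OF reduce_in_carrier], rule cg_trans[OF cg_reduce], rule cgI[where u = 1])
    fix i
    have le: "dig p (encode_poly p f) i \<le> p" using p_gt_1 dig_less[of p] by (simp add: less_imp_le)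
    have ic: "int (dig p (encode_poly p f) i) = coeff f i" by (rule dig_encode[OF coeff_f])
    have "int (?c i) = (int p - coeff f i) mod int p"
      using le ic by (simp add: zmod_int of_nat_diff)
    then have "int p dvd int (?c i) + coeff f i"
      by (simp add: dvd_eq_mod_eq_0 mod_simps)
    then have 1: "int p dvd coeff f i + int (?c i)" by (simp add: add.commute)
    have "[:0, 1:] ^ d = monom (1::int) d" by (simp add: monom_altdef)
    then have "coeff ([:0, 1:] ^ d - (\<Sum>j<d. monom (int (?c j)) j) - 1 * f) i =
        (if i = d then 1 else 0) - (if i < d then int (?c i) else 0) - coeff f i"
      by (simp add: coeff_sum_monom)
    also have "\<dots> = (if i < d then - (coeff f i + int (?c i)) else 0)"
      using monic by (auto simp: coeff_eq_0)
    finally have e: "coeff ([:0, 1:] ^ d - (\<Sum>j<d. monom (int (?c j)) j) - 1 * f) i =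
        (if i < d then - (coeff f i + int (?c i)) else 0)" .
    show "int p dvd coeff ([:0, 1:] ^ d - (\<Sum>j<d. monom (int (?c j)) j) - 1 * f) i"
      unfolding e using 1 by (cases "i < d") (simp_all only: if_True if_False dvd_minus_iff dvd_0_right)
  qed
  finally show ?thesis by (simp add: reduce_power \<theta>_def)
qed

abbreviation "q \<equiv> p ^ d"
abbreviation "dec \<equiv> const.ev \<theta> d"
abbreviation "fadd \<equiv> ext_add (\<lambda>a b. (a + b) mod p) p d"
abbreviation "fmul \<equiv> ext_mul (\<lambda>a b. (a + b) mod p) (\<lambda>a b. (a * b) mod p) p d low_code"

sublocale fq: coded F dec q fadd fmul
  by (rule const.coded_ext[OF \<theta>_closed \<theta>_power_d d_pos])

lemma dec_eq: "dec a = (\<Sum>j<d. monom (int (dig p a j)) j)"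
proof -
  have dg: "dig p a j < p" for j using p_gt_1 by (simp add: dig_less)
  have "(\<Sum>j<d. monom (int (dig p a j)) j) \<in> carrier F"
  proof -
    have "degree (\<Sum>j<d. monom (int (dig p a j)) j) \<le> d - 1"
      by (rule degree_le) (auto simp: coeff_sum_monom)
    then show ?thesis using d_pos dg p_gt_1 unfolding carrier_F by (auto simp: coeff_sum_monom)
  qed
  then show ?thesis unfolding const.ev_def using dg by (simp only: rsum_\<theta> reduce_carrier)
qed

lemma encode_dec: "a < q \<Longrightarrow> encode_poly p (dec a) = a"
proof -
  assume a: "a < q"
  have "poly (dec a) (int p) = int (\<Sum>j<d. dig p a j * p ^ j)"
    by (simp add: dec_eq poly_sum poly_monom)
  also have "(\<Sum>j<d. dig p a j * p ^ j) = tab d p (dig p a)"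
  proof -
    have "dig p a j \<le> p - 1" for j using dig_less[of p a j] p_gt_1 by simp
    then show ?thesis unfolding tab_def by (simp add: min_absorb1)
  qed
  finally show ?thesis using a tab_dig[of p d a] p_gt_1 by (simp add: encode_poly_def)
qed

text \<open>The internal codes coincide with the prescribed encoding of field elements, so inputs
  and outputs need no conversion.\<close>

lemma carrier_coded:
  assumes x: "x \<in> carrier F"
  shows "encode_poly p x < q" "dec (encode_poly p x) = x"
proof -
  have cx: "coeff x i \<in> {0..<int p}" and dx: "degree x < d" for i using x by (auto simp: carrier_F)
  show dec: "dec (encode_poly p x) = x"
    unfolding dec_eq
    by (rule poly_eqI) (use dx in \<open>auto simp: coeff_sum_monom dig_encode[OF cx] coeff_eq_0\<close>)
  have "poly (dec (encode_poly p x)) (int p) = int (\<Sum>j<d. dig p (encode_poly p x) j * p ^ j)"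
    by (simp add: dec_eq poly_sum poly_monom)
  then have "encode_poly p x = (\<Sum>j<d. dig p (encode_poly p x) j * p ^ j)"
    unfolding dec by (metis encode_poly_def nat_int)
  also have "\<dots> = tab d p (dig p (encode_poly p x))"
  proof -
    have "dig p (encode_poly p x) j \<le> p - 1" for j using dig_less[of p "encode_poly p x" j] p_gt_1 by simp
    then show ?thesis unfolding tab_def by (simp add: min_absorb1)
  qed
  also have "\<dots> < q" using p_gt_1 by (intro tab_less) simp
  finally show "encode_poly p x < q" .
qed

lemma bij_dec: "bij_betw dec {..<q} (carrier F)"
  by (rule bij_betwI[where g = "encode_poly p"])
    (auto simp: encode_dec carrier_coded fq.code_closed)

lemma field_size_eq: "field_size (p, f) = q"
  using bij_betw_same_card[OF bij_dec] by (simp add: field_size_def)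

lemma finite_F: "finite (carrier F)"
  using bij_betw_finite[OF bij_dec] by simp

lemma dec_minus_one: "dec (p - 1) = \<ominus>\<^bsub>F\<^esub> \<one>\<^bsub>F\<^esub>"
proof -
  have "dec (p - 1) = const_code (p - 1)"
    using p_gt_1 d_pos by (intro const.ev_const[OF \<theta>_closed]) simp_all
  moreover have "const_code (p - 1) \<oplus>\<^bsub>F\<^esub> const_code 1 = \<zero>\<^bsub>F\<^esub>"
    using p_gt_1 const.code_ad[of "p - 1" 1] const.code_0 by simp
  moreover have "const_code (p - 1) \<in> carrier F" "const_code 1 = \<one>\<^bsub>F\<^esub>"
    using p_gt_1 const.code_1 by (simp_all add: const_in_carrier)
  ultimately show ?thesis
    by (metis F.minus_equality F.one_closed)
qed

text \<open>Applied to n = r, this makes r invertible in the field, as needed when a coefficient is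
  recovered from a sum over all conjugates.\<close>

lemma rsum_one_nonzero:
  assumes "\<not> p dvd n"
  shows "rsum F n (\<lambda>_. \<one>\<^bsub>F\<^esub>) \<noteq> \<zero>\<^bsub>F\<^esub>"
proof -
  have "rsum F n (\<lambda>_. \<one>\<^bsub>F\<^esub>) = reduce p f [:int n:]" for n
  proof (induction n)
    case (Suc n)
    have "[:int (Suc n):] = [:int n:] + 1" by (simp add: one_pCons)
    then show ?case using Suc reduce_add[of "[:int n:]" 1] by (simp add: reduce_1)
  qed (simp add: reduce_0)
  then show ?thesis using assms const_mod[of n] by (auto simp: const_code_def dvd_eq_mod_eq_0)
qed

end

section \<open>Roots of unity and powers\<close>

text \<open>Only multiplication matters here: \<open>B\<close> is the cyclic sequence of the a -
  \<theta>_j, and \<open>Y\<close>, \<open>U\<close> are the evaluations of y and u. The conclusion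
  lists the parameters that the search has to hit, since W^N - \<omega>^k then vanishes at
  \<open>j\<close> but not at \<open>j'\<close>.\<close>

lemma (in comm_group) splitting_power:
  fixes B Y U :: "nat \<Rightarrow> 'a" and n t r :: nat and P :: "nat set" and z :: "nat \<Rightarrow> nat" and \<omega> :: "nat \<Rightarrow> 'a"
  assumes Y_def: "\<And>j. Y j = B j \<otimes> inv (B (Suc j))"
    and U_def: "\<And>j. U j = Y j \<otimes> inv (Y (Suc j))"
    and n: "n > 0" "\<And>x. x \<in> carrier G \<Longrightarrow> x [^] n = \<one>"
    and B: "\<And>j. B j \<in> carrier G" "\<And>j. B (j + r) = B j"
    and r: "prime r" and t: "t > 0"
    and P: "\<And>s. prime s \<Longrightarrow> s \<notin> P \<Longrightarrow> multiplicity s n = multiplicity s t"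
    and z: "\<And>s. s \<in> P \<Longrightarrow> z s = (if s = 2 then 4 else s)"
    and \<omega>: "\<And>s x. s \<in> P \<Longrightarrow> x \<in> carrier G \<Longrightarrow> x [^] z s = \<one> \<Longrightarrow> \<exists>k<z s. x = \<omega> s [^] k"
    and ne: "U 0 [^] t \<noteq> \<one>"
  obtains s i k W j j' where "s \<in> P" "prime s" "s ^ i dvd n" "k < z s" "W = Y \<or> W = U" "j < r" "j' < r"
    "W j [^] (n div s ^ i) = \<omega> s [^] k" "W j' [^] (n div s ^ i) \<noteq> \<omega> s [^] k"
proof -
  have Y: "Y j \<in> carrier G" for j unfolding Y_def using B by simp
  have U: "U j \<in> carrier G" for j unfolding U_def using Y by simp
  have Yr: "Y (j + r) = Y j" for j unfolding Y_def using B(2)[of j] B(2)[of "Suc j"] by simp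
  have Ur: "U (j + r) = U j" for j unfolding U_def using Yr[of j] Yr[of "Suc j"] by simp
  have Umod: "U j = U (j mod r)" for j
  proof -
    have "U (j mod r + k * r) = U (j mod r)" for k
    proof (induction k)
      case (Suc k)
      then show ?case using Ur[of "j mod r + k * r"] by (simp add: ac_simps)
    qed simp
    from this[of "j div r"] show ?thesis by simp
  qed
  have r0: "r > 1" using r by (rule prime_gt_1_nat)
  define w where "w = ord (U 0)"
  have w: "w dvd n" "\<not> w dvd t" using n(2)[OF U] ne U by (auto simp: w_def pow_eq_id)
  then have w0: "w \<noteq> 0" using n by auto
  \<comment> \<open>Otherwise the order \<open>w\<close> would divide \<open>t\<close>. Outside
    \<open>P\<close> the multiplicities of \<open>n\<close> and \<open>t\<close> agree and
    \<open>w\<close> divides \<open>n\<close>, so the excess places \<open>s\<close> in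
    \<open>P\<close>.\<close>
  have "\<exists>s. prime s \<and> \<not> multiplicity s w \<le> multiplicity s t"
    using w(2) w0 t multiplicity_le_imp_dvd[of w t] by auto
  then obtain s where s: "prime s" "multiplicity s w > multiplicity s t" by auto
  have "multiplicity s w \<le> multiplicity s n" using w(1) n(1) by (intro dvd_imp_multiplicity_le) auto
  then have sP: "s \<in> P" using P[OF s(1)] s(2) by fastforce
  have sw: "s dvd w" using s by (metis gr_implies_not0 not_dvd_imp_multiplicity_0)
  define v where "v = multiplicity s n"
  have nv: "s ^ v dvd n" by (simp add: v_def multiplicity_dvd)
  \<comment> \<open>Once all factors \<open>s\<close> are removed from the exponent, it is no
    multiple of the order of \<open>U 0\<close>. So \<open>v\<close> satisfies \<open>Q\<close>, and
    the least such exponent is at most \<open>v\<close>, whence \<open>s ^ i\<close> divides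
    \<open>n\<close>.\<close>
  have "\<not> s dvd n div s ^ v"
    using n(1) s(1) by (metis multiplicity_decompose not_gr_zero prime_gt_1_nat less_irrefl nat_dvd_1_iff_1 v_def)
  then have "\<not> w dvd n div s ^ v" using sw dvd_trans by blast
  then have Uv: "U 0 [^] (n div s ^ v) \<noteq> \<one>" using U by (simp add: w_def pow_eq_id)
  define Q where "Q = (\<lambda>i. \<exists>j. U j [^] (n div s ^ i) \<noteq> \<one>)"
  define i where "i = (LEAST i. Q i)"
  have Qv: "Q v" unfolding Q_def using Uv by blast
  have Qi: "Q i" and iv: "i \<le> v" unfolding i_def using Qv by (auto intro: LeastI Least_le)
  have si: "s ^ i dvd n" using nv iv by (meson dvd_trans le_imp_power_dvd)
  have "i \<noteq> 0"
  proof
    assume "i = 0"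
    then show False using Qi n(2)[OF U] unfolding Q_def by simp
  qed
  then obtain i' where i': "i = Suc i'" by (cases i) auto
  define N where "N = n div s ^ i"
  \<comment> \<open>By minimality all powers of \<open>U\<close> with exponent \<open>N * s\<close>
    are trivial, so all \<open>U j [^] N\<close> are \<open>s\<close>-th roots of unity.\<close>
  have "\<not> Q i'" using not_less_Least[of i' Q] i' unfolding i_def by simp
  moreover have "n div s ^ i' = N * s"
  proof -
    obtain c where c: "n = s ^ i * c" using si by blast
    moreover have "s > 0" using s(1) prime_gt_0_nat by simp
    ultimately show ?thesis by (simp add: N_def i' ac_simps)
  qed
  ultimately have Us: "(U j [^] N) [^] s = \<one>" for j
    unfolding Q_def using U by (simp add: nat_pow_pow)
  have szs: "s dvd z s" using z[OF sP] by auto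
  have pow_z: "x [^] z s = \<one>" if "x \<in> carrier G" "x [^] s = \<one>" for x
  proof -
    obtain c where "z s = s * c" using szs by blast
    then show ?thesis using that by (metis nat_pow_one nat_pow_pow)
  qed
  show ?thesis
  proof (cases "\<forall>j. U j [^] N = U 0 [^] N")
    case False
    then obtain j where "U j [^] N \<noteq> U 0 [^] N" by blast
    then have j: "U (j mod r) [^] N \<noteq> U 0 [^] N" using Umod[of j] by simp
    obtain k where k: "k < z s" "U 0 [^] N = \<omega> s [^] k"
      using \<omega>[OF sP _ pow_z[OF _ Us[of 0]]] U by auto
    show ?thesis
      by (rule that[OF sP s(1) si k(1), of U 0 "j mod r"]) (use j k r0 in \<open>auto simp: N_def\<close>)
  next
    case True
    define c where "c = U 0 [^] N"
    have c: "c \<in> carrier G" "c [^] s = \<one>" using U Us by (simp_all add: c_def)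
    have Uc: "U j [^] N = c" for j using True c_def by simp
    have c1: "c \<noteq> \<one>" using Qi Uc unfolding Q_def N_def[symmetric] by auto
    define y where "y = (\<lambda>j. Y j [^] N)"
    have y: "y j \<in> carrier G" for j using Y by (simp add: y_def)
    have step: "y j = c \<otimes> y (Suc j)" for j
    proof -
      have "c = y j \<otimes> inv (y (Suc j))"
        using Uc[of j] Y by (simp add: U_def y_def nat_pow_distrib nat_pow_inv)
      then show ?thesis using y by (simp add: m_assoc)
    qed
    have y0: "y 0 = c [^] j \<otimes> y j" for j
    proof (induction j)
      case 0
      then show ?case using y c by simp
    next
      case (Suc j)
      then show ?case using step[of j] y[of "Suc j"] c by (simp add: m_assoc)
    qed
    have "y r = y 0" using Yr[of 0] by (simp add: y_def)
    \<comment> \<open>The relation \<open>y 0 = c [^] r \<otimes> y r\<close> closes up after one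
      turn around the cycle.\<close>
    then have cr: "c [^] r = \<one>" using y0[of r] y[of 0] c by (metis nat_pow_closed r_cancel_one')
    have "ord c dvd s" "ord c dvd r" using c cr by (simp_all add: pow_eq_id)
    moreover have "ord c \<noteq> 1" using ord_eq_1[OF c(1)] c1 by blast
    ultimately have "ord c = s" "ord c = r" using s(1) r by (meson One_nat_def prime_nat_iff)+
    then have sr: "s = r" by simp
    define b where "b = (\<lambda>j. B j [^] N)"
    have b: "b j \<in> carrier G" for j using B by (simp add: b_def)
    have bstep: "b j = y j \<otimes> b (Suc j)" for j
    proof -
      have "y j = b j \<otimes> inv (b (Suc j))"
        using B(1) by (simp add: Y_def y_def b_def nat_pow_distrib nat_pow_inv)
      then show ?thesis using b by (simp add: m_assoc)
    qed
    \<comment> \<open>Multiply the relations y_0 = c^i y_i over i < j. The product of the y_i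
      telescopes to b_0 / b_j, and the exponents of c add up to a triangular number.\<close>
    have "c [^] (j * (j - 1) div 2) \<otimes> b 0 = y 0 [^] j \<otimes> b j" for j
    proof (induction j)
      case 0
      then show ?case using b by simp
    next
      case (Suc j)
      have "Suc j * (Suc j - 1) div 2 = j * (j - 1) div 2 + j"
      proof -
        have "Suc j * j = j * (j - 1) + j * 2" by (cases j) auto
        then show ?thesis by simp
      qed
      then have "c [^] (Suc j * (Suc j - 1) div 2) \<otimes> b 0 = c [^] j \<otimes> (c [^] (j * (j - 1) div 2) \<otimes> b 0)"
        using c b by (simp add: nat_pow_mult[symmetric] m_ac)
      also have "\<dots> = c [^] j \<otimes> (y 0 [^] j \<otimes> (y j \<otimes> b (Suc j)))" using Suc bstep[of j] by simp
      also have "\<dots> = y 0 [^] j \<otimes> ((c [^] j \<otimes> y j) \<otimes> b (Suc j))"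
        using c y b by (simp add: m_ac)
      also have "\<dots> = y 0 [^] Suc j \<otimes> b (Suc j)"
        using y b by (simp add: y0[of j, symmetric] m_assoc)
      finally show ?case .
    qed
    from this[of r] have "c [^] (r * (r - 1) div 2) \<otimes> b 0 = y 0 [^] r \<otimes> b 0"
      using B(2)[of 0] by (simp add: b_def)
    then have yr: "y 0 [^] r = c [^] (r * (r - 1) div 2)"
      using b y c by (metis nat_pow_closed right_cancel)
    have "y 0 [^] z s = \<one>"
    \<comment> \<open>The triangular number is 1 for r = 2, so only the fourth power of y_0 is
      trivial; for odd r it is a multiple of r.\<close>
    proof (cases "r = 2")
      case True
      then have "y 0 [^] z s = (y 0 [^] r) [^] (2::nat)"
        using y z[OF sP] sr by (simp add: nat_pow_pow)
      also have "\<dots> = c [^] r" using yr True c by (simp add: nat_pow_pow)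
      finally show ?thesis using cr by simp
    next
      case False
      then have "odd r" using r primes_dvd_imp_eq two_is_prime_nat by blast
      then have "r * (r - 1) div 2 = r * ((r - 1) div 2)" by (simp add: div_mult_swap)
      then have "y 0 [^] r = \<one>" using yr c cr by (metis nat_pow_one nat_pow_pow)
      then show ?thesis using z[OF sP] sr False by simp
    qed
    then obtain k where k: "k < z s" "y 0 = \<omega> s [^] k" using \<omega>[OF sP y] by blast
    have "y 1 \<noteq> y 0"
    proof
      assume "y 1 = y 0"
      then have "y 0 = c \<otimes> y 0" using step[of 0] by simp
      then show False using c1 c y by (metis r_cancel_one')
    qed
    then show ?thesis
      by (intro that[OF sP s(1) si k(1), of Y 0 1]) (use k r0 in \<open>auto simp: N_def y_def\<close>)
  qed
qed

text \<open>The first \<open>z\<close> powers of \<omega> are distinct roots of X^z - 1, which has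
  at most \<open>z\<close> roots in a field.\<close>

lemma (in field) primitive_root_power:
  assumes fin: "finite (carrier R)" and \<omega>: "primitive_root_of_unity R z \<omega>"
    and x: "x \<in> carrier R" "x [^] z = \<one>"
  obtains k where "k < z" "x = \<omega> [^] k"
proof -
  have w: "\<omega> \<in> carrier R" "z > 0" "\<omega> [^] z = \<one>"
    "\<And>k. 0 < k \<Longrightarrow> k < z \<Longrightarrow> \<omega> [^] k \<noteq> \<one>"
    using \<omega> unfolding primitive_root_of_unity_def by auto
  have w0: "\<omega> [^] k \<noteq> \<zero>" for k :: nat
  proof
    assume "\<omega> [^] k = \<zero>"
    then have "(\<omega> [^] k) [^] z = \<zero>" using w(2) by (simp add: nat_pow_zero)
    moreover have "(\<omega> [^] k) [^] z = (\<omega> [^] z) [^] k" using w(1) by (simp add: nat_pow_pow mult.commute)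
    ultimately show False using w(3) by simp
  qed
  have "inj_on (\<lambda>k. \<omega> [^] k) {..<z}"
  proof (rule linorder_inj_onI')
    fix i j :: nat assume ij: "i < j" "i \<in> {..<z}" "j \<in> {..<z}"
    show "\<omega> [^] i \<noteq> \<omega> [^] j"
    proof
      assume "\<omega> [^] i = \<omega> [^] j"
      moreover have "\<omega> [^] j = \<omega> [^] i \<otimes> \<omega> [^] (j - i)"
        using ij w(1) by (simp add: nat_pow_mult)
      ultimately have "\<omega> [^] i \<otimes> \<one> = \<omega> [^] i \<otimes> \<omega> [^] (j - i)" using w(1) by simp
      then have "\<one> = \<omega> [^] (j - i)"
        using m_lcancel[OF w0[of i] nat_pow_closed[OF w(1)] one_closed nat_pow_closed[OF w(1)]] by blast
      then show False using w(4)[of "j - i"] ij by (auto simp: less_imp_diff_less)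
    qed
  qed
  then have c: "card ((\<lambda>k. \<omega> [^] k) ` {..<z}) = z" by (simp add: card_image)
  let ?S = "{a \<in> carrier R. a [^] z = \<one>}"
  have S: "finite ?S" "card ?S \<le> z"
    using fin num_roots_le_deg[OF fin, of z] w(2) by auto
  have "(\<lambda>k. \<omega> [^] k) ` {..<z} \<subseteq> ?S"
  proof (rule image_subsetI)
    fix k :: nat
    have "(\<omega> [^] k) [^] z = (\<omega> [^] z) [^] k" using w(1) by (simp add: nat_pow_pow mult.commute)
    then show "\<omega> [^] k \<in> ?S" using w by simp
  qed
  then have "(\<lambda>k. \<omega> [^] k) ` {..<z} = ?S" using S c by (intro card_seteq) auto
  then have "x \<in> (\<lambda>k. \<omega> [^] k) ` {..<z}" using x by blast
  then show ?thesis using that by auto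
qed

context domain
begin

text \<open>Appending the term x^n = 1 and splitting off the first term instead of the last gives s
  = x s for the sum s.\<close>

lemma rsum_geometric_zero:
  assumes x: "x \<in> carrier R" "x [^] n = \<one>" "x \<noteq> \<one>"
  shows "rsum R n (\<lambda>j. x [^] j) = \<zero>"
proof (rule ccontr)
  let ?s = "rsum R n (\<lambda>j. x [^] j)"
  assume s0: "?s \<noteq> \<zero>"
  have s: "?s \<in> carrier R" using x by auto
  have "?s \<oplus> \<one> = rsum R (Suc n) (\<lambda>j. x [^] j)" using x by simp
  also have "\<dots> = x [^] (0::nat) \<oplus> rsum R n (\<lambda>j. x [^] Suc j)"
    using x by (intro rsum_shift) simp
  also have "rsum R n (\<lambda>j. x [^] Suc j) = rsum R n (\<lambda>j. x \<otimes> x [^] j)"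
    using x by (intro rsum_cong) (simp add: m_comm)
  also have "\<dots> = x \<otimes> ?s" using x by (intro rsum_mult) auto
  finally have "?s \<oplus> \<one> = x \<otimes> ?s \<oplus> \<one>" using x s by (simp add: a_comm)
  then have "\<one> \<otimes> ?s = x \<otimes> ?s" using x s by (simp add: add.right_cancel)
  then show False using x s s0 m_rcancel by blast
qed

lemma rsum_const_mult: "c \<in> carrier R \<Longrightarrow> rsum R n (\<lambda>_. c) = c \<otimes> rsum R n (\<lambda>_. \<one>)"
  using rsum_mult[of c "\<lambda>_. \<one>" n] by simp

text \<open>Summing the evaluations over all conjugates annihilates every positive power by
  orthogonality of roots of unity, leaving r v = r c_0. It is used to read a norm off its lowest
  digit.\<close>

lemma constant_coefficient:
  assumes r: "prime r" "rsum R r (\<lambda>_. \<one>) \<noteq> \<zero>" and \<zeta>: "primitive_root_of_unity R r \<zeta>"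
    and \<alpha>: "\<alpha> \<in> carrier R" and c: "\<And>k. c k \<in> carrier R" and v: "v \<in> carrier R"
    and H: "\<And>j. j < r \<Longrightarrow> rsum R r (\<lambda>k. c k \<otimes> (\<zeta> [^] j \<otimes> \<alpha>) [^] k) = v"
  shows "c 0 = v"
proof -
  have z: "\<zeta> \<in> carrier R" "\<zeta> [^] r = \<one>" "\<And>k. 0 < k \<Longrightarrow> k < r \<Longrightarrow> \<zeta> [^] k \<noteq> \<one>"
    using \<zeta> unfolding primitive_root_of_unity_def by auto
  have r0: "r > 0" using r(1) prime_gt_0_nat by simp
  then obtain r' where r': "r = Suc r'" by (cases r) auto
  let ?o = "rsum R r (\<lambda>_. \<one>)"
  have o: "?o \<in> carrier R" by auto
  have "v \<otimes> ?o = rsum R r (\<lambda>j. v)" by (rule rsum_const_mult[OF v, symmetric])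
  also have "\<dots> = rsum R r (\<lambda>j. rsum R r (\<lambda>k. c k \<otimes> (\<zeta> [^] j \<otimes> \<alpha>) [^] k))"
    using H by (intro rsum_cong) simp
  also have "\<dots> = rsum R r (\<lambda>k. rsum R r (\<lambda>j. c k \<otimes> (\<zeta> [^] j \<otimes> \<alpha>) [^] k))"
    using c z \<alpha> by (intro rsum_swap) simp
  also have "\<dots> = rsum R r (\<lambda>k. (c k \<otimes> \<alpha> [^] k) \<otimes> rsum R r (\<lambda>j. (\<zeta> [^] k) [^] j))"
  proof (rule rsum_cong)
    fix k
    have "rsum R r (\<lambda>j. c k \<otimes> (\<zeta> [^] j \<otimes> \<alpha>) [^] k) = rsum R r (\<lambda>j. (c k \<otimes> \<alpha> [^] k) \<otimes> (\<zeta> [^] k) [^] j)"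
      using c[of k] z \<alpha> by (intro rsum_cong) (simp add: nat_pow_distrib nat_pow_pow m_ac mult.commute)
    also have "\<dots> = (c k \<otimes> \<alpha> [^] k) \<otimes> rsum R r (\<lambda>j. (\<zeta> [^] k) [^] j)"
      using c[of k] z \<alpha> by (intro rsum_mult) auto
    finally show "rsum R r (\<lambda>j. c k \<otimes> (\<zeta> [^] j \<otimes> \<alpha>) [^] k) = (c k \<otimes> \<alpha> [^] k) \<otimes> rsum R r (\<lambda>j. (\<zeta> [^] k) [^] j)" .
  qed
  also have "\<dots> = (c 0 \<otimes> \<alpha> [^] (0::nat)) \<otimes> rsum R r (\<lambda>j. (\<zeta> [^] (0::nat)) [^] j) \<oplus>
      rsum R r' (\<lambda>k. (c (Suc k) \<otimes> \<alpha> [^] Suc k) \<otimes> rsum R r (\<lambda>j. (\<zeta> [^] Suc k) [^] j))"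
    unfolding r' using c z \<alpha> by (intro rsum_shift) (auto intro!: m_closed rsum_closed simp del: rsum.simps)
  also have "rsum R r' (\<lambda>k. (c (Suc k) \<otimes> \<alpha> [^] Suc k) \<otimes> rsum R r (\<lambda>j. (\<zeta> [^] Suc k) [^] j)) = rsum R r' (\<lambda>_. \<zero>)"
  proof (rule rsum_cong)
    fix k assume k: "k < r'"
    have "(\<zeta> [^] Suc k) [^] r = (\<zeta> [^] r) [^] Suc k" using z(1) by (simp only: nat_pow_pow mult.commute)
    then have "rsum R r (\<lambda>j. (\<zeta> [^] Suc k) [^] j) = \<zero>"
    proof (intro rsum_geometric_zero)
      show "\<zeta> [^] Suc k \<in> carrier R" using z(1) by (rule nat_pow_closed)
      show "(\<zeta> [^] Suc k) [^] r = \<one>"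
        using z(2) \<open>(\<zeta> [^] Suc k) [^] r = (\<zeta> [^] r) [^] Suc k\<close> by (simp del: nat_pow_Suc)
      show "\<zeta> [^] Suc k \<noteq> \<one>" using k r' by (intro z(3)) simp_all
    qed
    then show "(c (Suc k) \<otimes> \<alpha> [^] Suc k) \<otimes> rsum R r (\<lambda>j. (\<zeta> [^] Suc k) [^] j) = \<zero>"
      using c \<alpha> by (simp del: nat_pow_Suc)
  qed
  finally have "v \<otimes> ?o = c 0 \<otimes> ?o" using c o by (simp add: rsum_zero)
  then show ?thesis using m_rcancel[OF r(2) o v c] by simp
qed

end

section \<open>Products over the conjugates\<close>

primrec rprod :: "('a, 'b) ring_scheme \<Rightarrow> nat \<Rightarrow> (nat \<Rightarrow> 'a) \<Rightarrow> 'a" where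
  "rprod S 0 f = \<one>\<^bsub>S\<^esub>"
| "rprod S (Suc n) f = rprod S n f \<otimes>\<^bsub>S\<^esub> f n"

context domain
begin

lemma rprod_closed [simp]: "(\<And>j. f j \<in> carrier R) \<Longrightarrow> rprod R n f \<in> carrier R"
  by (induction n) auto

lemma rprod_shift:
  "(\<And>j. f j \<in> carrier R) \<Longrightarrow> rprod R (Suc n) f = f 0 \<otimes> rprod R n (\<lambda>j. f (Suc j))"
proof (induction n)
  case (Suc n)
  have "rprod R n (\<lambda>j. f (Suc j)) \<in> carrier R" using Suc.prems by auto
  then show ?case using Suc.IH[OF Suc.prems] Suc.prems by (simp add: m_assoc)
qed simp

text \<open>Shifting the window by one replaces \<open>g j\<close> by the equal factor
  \<open>g (j + r)\<close>; nonzero values permit the cancellation. This is the invariance of the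
  norm.\<close>

lemma rprod_periodic:
  assumes g: "\<And>j. g j \<in> carrier R" "\<And>j. g j \<noteq> \<zero>" "\<And>j. g (j + r) = g j"
  shows "rprod R r (\<lambda>i. g (j + i)) = rprod R r g"
proof (induction j)
  case (Suc j)
  let ?P = "\<lambda>j. rprod R r (\<lambda>i. g (j + i))"
  have P: "?P j \<in> carrier R" for j using g by auto
  have "g j \<otimes> ?P (Suc j) = rprod R (Suc r) (\<lambda>i. g (j + i))"
    using rprod_shift[of "\<lambda>i. g (j + i)" r] g by simp
  also have "\<dots> = g j \<otimes> ?P j" using g P[of j] by (simp add: m_comm)
  finally have "?P (Suc j) = ?P j" using m_lcancel[OF g(2,1) P P] by blast
  then show ?case using Suc by simp
qed simp

lemma rprod_conjugates:
  assumes "\<zeta> \<in> carrier R" "\<alpha> \<in> carrier R"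
    and "\<And>j. g j = (if j \<in> J then \<zeta> [^] j \<otimes> \<alpha> else \<one>)"
  shows "\<exists>m::nat. rprod R n g = \<zeta> [^] m \<otimes> \<alpha> [^] card {j \<in> J. j < n}"
proof (induction n)
  case 0
  then show ?case using assms by (intro exI[of _ 0]) simp
next
  case (Suc n)
  then obtain m :: nat where m: "rprod R n g = \<zeta> [^] m \<otimes> \<alpha> [^] card {j \<in> J. j < n}" by blast
  show ?case
  proof (cases "n \<in> J")
    case True
    then have "{j \<in> J. j < Suc n} = insert n {j \<in> J. j < n}" by auto
    then have "card {j \<in> J. j < Suc n} = Suc (card {j \<in> J. j < n})" by simp
    then have "rprod R (Suc n) g = \<zeta> [^] (m + n) \<otimes> \<alpha> [^] card {j \<in> J. j < Suc n}"
      using assms m True by (simp add: nat_pow_mult[symmetric] m_ac)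
    then show ?thesis by blast
  next
    case False
    then have "{j \<in> J. j < Suc n} = {j \<in> J. j < n}" using less_Suc_eq by auto
    then show ?thesis
      using m assms(1,2) assms(3)[of n] False by (intro exI[of _ m]) simp
  qed
qed

end

section \<open>The search for a root\<close>

text \<open>
  Elements of \<open>A\<close> are coded in base \<open>q\<close>, so \<open>q\<close> itself codes \<open>x\<close>, and \<open>neg\<close> codes \<open>-1\<close>. Inverses are
  \<open>(q - 2)\<close>-th powers. The code \<open>substitute mu l q r z h\<close> is that of \<open>h(zx)\<close>.
\<close>

definition substitute :: "(nat \<Rightarrow> nat \<Rightarrow> nat) \<Rightarrow> nat \<Rightarrow> nat \<Rightarrow> nat \<Rightarrow> nat \<Rightarrow> nat \<Rightarrow> nat" where
  "substitute mu l q r z h = tab r q (\<lambda>k. mu (dig q h k) (repeated_squaring mu l z k))"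

text \<open>The quotient h(x)/h(zx). Applied to a - x it yields y, applied twice it yields
  u.\<close>

definition shift_quotient ::
  "(nat \<Rightarrow> nat \<Rightarrow> nat) \<Rightarrow> (nat \<Rightarrow> nat \<Rightarrow> nat) \<Rightarrow> nat \<Rightarrow> nat \<Rightarrow> nat \<Rightarrow> nat \<Rightarrow> nat \<Rightarrow> nat \<Rightarrow> nat" where
  "shift_quotient ad mu l q r b z h = ext_mul ad mu q r b h
     (repeated_squaring (ext_mul ad mu q r b) l (substitute mu l q r z h) (q - 2))"

text \<open>The product of the h(z^i x) is invariant under x \<mapsto> zx and hence a constant,
  which digit 0 returns.\<close>

definition norm_code ::
  "(nat \<Rightarrow> nat \<Rightarrow> nat) \<Rightarrow> (nat \<Rightarrow> nat \<Rightarrow> nat) \<Rightarrow> nat \<Rightarrow> nat \<Rightarrow> nat \<Rightarrow> nat \<Rightarrow> nat \<Rightarrow> nat \<Rightarrow> nat" where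
  "norm_code ad mu l q r b z h = dig q (loop r (\<lambda>i acc. ext_mul ad mu q r b acc
     (substitute mu l q r (repeated_squaring mu l z i) h)) 1) 0"

definition idempotent_code ::
  "(nat \<Rightarrow> nat \<Rightarrow> nat) \<Rightarrow> (nat \<Rightarrow> nat \<Rightarrow> nat) \<Rightarrow> nat \<Rightarrow> nat \<Rightarrow> nat \<Rightarrow> nat \<Rightarrow> nat \<Rightarrow> nat \<Rightarrow> nat" where
  "idempotent_code ad mu l q r b neg e =
     ext_add ad q r (ext_mul ad mu q r b q (ext_add ad q r 1 (ext_mul ad mu q r b neg e))) e"

definition split_code ::
  "(nat \<Rightarrow> nat \<Rightarrow> nat) \<Rightarrow> (nat \<Rightarrow> nat \<Rightarrow> nat) \<Rightarrow> nat \<Rightarrow> nat \<Rightarrow> nat \<Rightarrow> nat \<Rightarrow> nat \<Rightarrow> nat \<Rightarrow> nat \<Rightarrow> nat" where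
  "split_code ad mu l q r b z neg h = norm_code ad mu l q r b z
     (idempotent_code ad mu l q r b neg (repeated_squaring (ext_mul ad mu q r b) l h (q - 1)))"

definition power_minus ::
  "(nat \<Rightarrow> nat \<Rightarrow> nat) \<Rightarrow> (nat \<Rightarrow> nat \<Rightarrow> nat) \<Rightarrow> nat \<Rightarrow> nat \<Rightarrow> nat \<Rightarrow> nat \<Rightarrow> nat \<Rightarrow> nat \<Rightarrow> nat \<Rightarrow> nat \<Rightarrow> nat" where
  "power_minus ad mu l q r b neg w n c =
     ext_add ad q r (repeated_squaring (ext_mul ad mu q r b) l w n) (ext_mul ad mu q r b neg c)"

definition check :: "(nat \<Rightarrow> nat \<Rightarrow> nat) \<Rightarrow> nat \<Rightarrow> nat \<Rightarrow> nat \<Rightarrow> nat \<Rightarrow> nat" where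
  "check mu l r b c = (if repeated_squaring mu l c r = b then c else 0)"

text \<open>This codes n^u b^(-v). For n = \<zeta>^m \<alpha>^k and k u = 1 + v r it is the
  conjugate \<zeta>^(m u) \<alpha>. As k is not known, \<open>candidates\<close> tries all u and
  v.\<close>

definition candidate :: "(nat \<Rightarrow> nat \<Rightarrow> nat) \<Rightarrow> nat \<Rightarrow> nat \<Rightarrow> nat \<Rightarrow> nat \<Rightarrow> nat \<Rightarrow> nat \<Rightarrow> nat" where
  "candidate mu l q b n u v =
     mu (repeated_squaring mu l n u) (repeated_squaring mu l (repeated_squaring mu l b (q - 2)) v)"

definition candidates :: "(nat \<Rightarrow> nat \<Rightarrow> nat) \<Rightarrow> nat \<Rightarrow> nat \<Rightarrow> nat \<Rightarrow> nat \<Rightarrow> nat \<Rightarrow> nat" where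
  "candidates mu l q r b n = first r (\<lambda>u. first r (\<lambda>v. check mu l r b (candidate mu l q b n u v)))"

definition try_power ::
  "(nat \<Rightarrow> nat \<Rightarrow> nat) \<Rightarrow> (nat \<Rightarrow> nat \<Rightarrow> nat) \<Rightarrow> nat \<Rightarrow> nat \<Rightarrow> nat \<Rightarrow> nat \<Rightarrow> nat \<Rightarrow> nat \<Rightarrow> nat \<Rightarrow> nat \<Rightarrow> nat \<Rightarrow> nat" where
  "try_power ad mu l q r b z neg w n c =
     candidates mu l q r b (split_code ad mu l q r b z neg (power_minus ad mu l q r b neg w n c))"

text \<open>Here \<open>t\<close> bounds the primes. As s^i \<le> q - 1 < 2^l, exponents up to
  \<open>l\<close> suffice, and \<open>t + 3\<close> exceeds every exponent below
  \<open>z_s\<close>, which is 4 for s = 2. The roots of unity come as a binary operation because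
  \<open>polytime_op\<close> is the form in which a function is applied to loop variables.\<close>

definition try_powers ::
  "(nat \<Rightarrow> nat \<Rightarrow> nat) \<Rightarrow> (nat \<Rightarrow> nat \<Rightarrow> nat) \<Rightarrow> nat \<Rightarrow> nat \<Rightarrow> nat \<Rightarrow> nat \<Rightarrow> nat \<Rightarrow> nat \<Rightarrow>
    nat \<Rightarrow> (nat \<Rightarrow> nat \<Rightarrow> nat) \<Rightarrow> nat \<Rightarrow> nat" where
  "try_powers ad mu l q r b z neg t om w = first (t + 1) (\<lambda>s. first (l + 1) (\<lambda>i. first (t + 3) (\<lambda>k.
     try_power ad mu l q r b z neg w ((q - 1) div s ^ i) (repeated_squaring mu l (om s 0) k))))"

text \<open>The element \<open>a\<close> itself is tested at the start: if it is one of the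
  \<theta>_j, then a - x is no unit and the quotients lose their meaning.\<close>

definition try_shift ::
  "(nat \<Rightarrow> nat \<Rightarrow> nat) \<Rightarrow> (nat \<Rightarrow> nat \<Rightarrow> nat) \<Rightarrow> nat \<Rightarrow> nat \<Rightarrow> nat \<Rightarrow> nat \<Rightarrow> nat \<Rightarrow> nat \<Rightarrow>
    nat \<Rightarrow> (nat \<Rightarrow> nat \<Rightarrow> nat) \<Rightarrow> nat \<Rightarrow> nat" where
  "try_shift ad mu l q r b z neg t om a =
     (if check mu l r b a \<noteq> 0 then check mu l r b a else
      if try_powers ad mu l q r b z neg t om (shift_quotient ad mu l q r b z (a + neg * q)) \<noteq> 0
      then try_powers ad mu l q r b z neg t om (shift_quotient ad mu l q r b z (a + neg * q))
      else try_powers ad mu l q r b z neg t om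
        (shift_quotient ad mu l q r b z (shift_quotient ad mu l q r b z (a + neg * q))))"

text \<open>At most 2t shifts can be bad, whence \<open>2 * t + 1\<close> trials. For a field with
  no more elements than that, the reduction modulo \<open>q\<close> makes the trials exhaust the
  field.\<close>

definition find_root ::
  "(nat \<Rightarrow> nat \<Rightarrow> nat) \<Rightarrow> (nat \<Rightarrow> nat \<Rightarrow> nat) \<Rightarrow> nat \<Rightarrow> nat \<Rightarrow> nat \<Rightarrow> nat \<Rightarrow> nat \<Rightarrow> nat \<Rightarrow>
    nat \<Rightarrow> (nat \<Rightarrow> nat \<Rightarrow> nat) \<Rightarrow> nat" where
  "find_root ad mu l q r z neg t b om =
     first (2 * t + 1) (\<lambda>a. try_shift ad mu l q r b z neg t om (a mod q))"

section \<open>Running time of the search\<close>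

lemma bounded_op_lift: "extends C n C' \<Longrightarrow> bounded_op C f \<Longrightarrow> bounded_op C' (\<lambda>ys. f (tl ys))"
proof -
  assume ext: "extends C n C'" and "bounded_op C f"
  then obtain B where B: "pbd C B" "\<forall>xs\<in>insts C. \<forall>a b. bits (f xs a b) \<le> B xs"
    unfolding bounded_op_def by blast
  have "\<forall>ys\<in>insts C'. \<forall>a b. bits (f (tl ys) a b) \<le> B (tl ys)"
    using B(2) ext unfolding extends_def by blast
  then show ?thesis using pbd_lift[OF ext B(1)] unfolding bounded_op_def by blast
qed

text \<open>The parameters shared by all parts of the search are bundled, so that entering a loop
  amounts to one interpretation through \<open>lift_ctx\<close>.\<close>

locale algebra_ctx =
  fixes C :: ctx and ad mu :: "nat list \<Rightarrow> nat \<Rightarrow> nat \<Rightarrow> nat" and l q r b z neg :: "nat list \<Rightarrow> nat"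
  assumes ad: "polytime_op C ad" and mu: "polytime_op C mu" and bmu: "bounded_op C mu"
    and l: "unary C l" and r: "unary C r"
    and q: "polytime C q" and b: "polytime C b" and z: "polytime C z" and neg: "polytime C neg"
begin

lemma lift_ctx:
  assumes "extends C n C'"
  shows "algebra_ctx C' (\<lambda>ys. ad (tl ys)) (\<lambda>ys. mu (tl ys)) (\<lambda>ys. l (tl ys)) (\<lambda>ys. q (tl ys))
    (\<lambda>ys. r (tl ys)) (\<lambda>ys. b (tl ys)) (\<lambda>ys. z (tl ys)) (\<lambda>ys. neg (tl ys))"
  by unfold_locales
    (rule polytime_op_lift[OF assms] bounded_op_lift[OF assms] unary_lift[OF assms] polytime_lift[OF assms],
      rule ad mu bmu l r q b z neg)+

abbreviation "am \<equiv> \<lambda>xs. ext_mul (ad xs) (mu xs) (q xs) (r xs) (b xs)"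
abbreviation "aa \<equiv> \<lambda>xs. ext_add (ad xs) (q xs) (r xs)"

lemma polytime_am: "polytime_op C am" and bounded_am: "bounded_op C am" and polytime_aa: "polytime_op C aa"
  by (intro polytime_op_ext_mul bounded_op_ext_mul polytime_op_ext_add ad mu q r b)+

lemmas ops = polytime_op_apply[OF polytime_am] polytime_op_apply[OF polytime_aa] polytime_op_apply[OF mu]
lemmas rs = polytime_repeated_squaring[OF polytime_am bounded_am l] polytime_repeated_squaring[OF mu bmu l]
lemmas basic = l r q b z neg unaryD(1)[OF l] unaryD(1)[OF r] polytime_const unary_const polytime_diff

lemma polytime_substitute:
  assumes h: "polytime C h" and w: "polytime C w"
  shows "polytime C (\<lambda>xs. substitute (mu xs) (l xs) (q xs) (r xs) (w xs) (h xs))"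
  unfolding substitute_def
proof (intro polytime_tab r q)
  fix C' assume C': "extends C r C'" "unary C' hd"
  interpret C': algebra_ctx C' "\<lambda>ys. ad (tl ys)" "\<lambda>ys. mu (tl ys)" "\<lambda>ys. l (tl ys)" "\<lambda>ys. q (tl ys)"
    "\<lambda>ys. r (tl ys)" "\<lambda>ys. b (tl ys)" "\<lambda>ys. z (tl ys)" "\<lambda>ys. neg (tl ys)" by (rule lift_ctx[OF C'(1)])
  show "polytime C' (\<lambda>ys. mu (tl ys) (dig (q (tl ys)) (h (tl ys)) (hd ys))
      (repeated_squaring (mu (tl ys)) (l (tl ys)) (w (tl ys)) (hd ys)))"
    by (rule C'.ops(3); (rule polytime_dig C'.rs(2))?;
      rule C'.basic polytime_lift[OF C'(1) h] polytime_lift[OF C'(1) w] C'(2) unaryD(1)[OF C'(2)])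
qed

lemma polytime_shift_quotient:
  assumes h: "polytime C h"
  shows "polytime C (\<lambda>xs. shift_quotient (ad xs) (mu xs) (l xs) (q xs) (r xs) (b xs) (z xs) (h xs))"
  unfolding shift_quotient_def by (intro ops(1) rs(1) polytime_substitute basic h)

lemma polytime_norm_code:
  assumes h: "polytime C h"
  shows "polytime C (\<lambda>xs. norm_code (ad xs) (mu xs) (l xs) (q xs) (r xs) (b xs) (z xs) (h xs))"
  unfolding norm_code_def
proof (intro polytime_dig q unary_const)
  let ?F = "\<lambda>xs i acc. am xs acc (substitute (mu xs) (l xs) (q xs) (r xs) (repeated_squaring (mu xs) (l xs) (z xs) i) (h xs))"
  obtain B where B: "pbd C B" "\<forall>xs\<in>insts C. \<forall>a b. bits (am xs a b) \<le> B xs"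
    using bounded_am unfolding bounded_op_def by blast
  show "polytime C (\<lambda>xs. loop (r xs) (?F xs) 1)"
  proof (rule polytime_loop_bounded[OF r polytime_const B(1)])
    fix C' assume C': "extends C r C'" "unary C' hd" and acc: "polytime C' (\<lambda>ys. loop (hd ys) (?F (tl ys)) 1)"
    interpret C': algebra_ctx C' "\<lambda>ys. ad (tl ys)" "\<lambda>ys. mu (tl ys)" "\<lambda>ys. l (tl ys)" "\<lambda>ys. q (tl ys)"
      "\<lambda>ys. r (tl ys)" "\<lambda>ys. b (tl ys)" "\<lambda>ys. z (tl ys)" "\<lambda>ys. neg (tl ys)" by (rule lift_ctx[OF C'(1)])
    show "polytime C' (\<lambda>ys. ?F (tl ys) (hd ys) (loop (hd ys) (?F (tl ys)) 1))"
      by (intro C'.ops(1) acc C'.polytime_substitute C'.rs(2) polytime_lift[OF C'(1) h] C'.z unaryD(1)[OF C'(2)])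
  qed (use B(2) in simp)
qed

lemma polytime_split_code:
  assumes h: "polytime C h"
  shows "polytime C (\<lambda>xs. split_code (ad xs) (mu xs) (l xs) (q xs) (r xs) (b xs) (z xs) (neg xs) (h xs))"
  unfolding split_code_def idempotent_code_def
  by (intro polytime_norm_code ops(1,2) rs(1) basic h)

lemma polytime_power_minus:
  assumes "polytime C w" "polytime C n" "polytime C c"
  shows "polytime C (\<lambda>xs. power_minus (ad xs) (mu xs) (l xs) (q xs) (r xs) (b xs) (neg xs) (w xs) (n xs) (c xs))"
  unfolding power_minus_def by (intro ops(1,2) rs(1) neg assms)

lemma polytime_check:
  assumes "polytime C c"
  shows "polytime C (\<lambda>xs. check (mu xs) (l xs) (r xs) (b xs) (c xs))"
  unfolding check_def by (intro polytime_if_eq rs(2) basic assms)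

lemma polytime_candidate:
  assumes "polytime C n" "polytime C u" "polytime C v"
  shows "polytime C (\<lambda>xs. candidate (mu xs) (l xs) (q xs) (b xs) (n xs) (u xs) (v xs))"
  unfolding candidate_def by (intro ops(3) rs(2) basic assms)

lemma polytime_candidates:
  assumes n: "polytime C n"
  shows "polytime C (\<lambda>xs. candidates (mu xs) (l xs) (q xs) (r xs) (b xs) (n xs))"
  unfolding candidates_def
proof (rule polytime_first[OF r])
  fix C' assume C': "extends C r C'" "unary C' hd"
  interpret C': algebra_ctx C' "\<lambda>ys. ad (tl ys)" "\<lambda>ys. mu (tl ys)" "\<lambda>ys. l (tl ys)" "\<lambda>ys. q (tl ys)"
    "\<lambda>ys. r (tl ys)" "\<lambda>ys. b (tl ys)" "\<lambda>ys. z (tl ys)" "\<lambda>ys. neg (tl ys)" by (rule lift_ctx[OF C'(1)])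
  show "polytime C' (\<lambda>ys. first (r (tl ys)) (\<lambda>v. check (mu (tl ys)) (l (tl ys)) (r (tl ys)) (b (tl ys))
      (candidate (mu (tl ys)) (l (tl ys)) (q (tl ys)) (b (tl ys)) (n (tl ys)) (hd ys) v)))"
  proof (rule polytime_first[OF C'.r])
    fix C2 assume C2: "extends C' (\<lambda>ys. r (tl ys)) C2" "unary C2 hd"
    interpret C2: algebra_ctx C2 "\<lambda>ys. ad (tl (tl ys))" "\<lambda>ys. mu (tl (tl ys))" "\<lambda>ys. l (tl (tl ys))" "\<lambda>ys. q (tl (tl ys))"
      "\<lambda>ys. r (tl (tl ys))" "\<lambda>ys. b (tl (tl ys))" "\<lambda>ys. z (tl (tl ys))" "\<lambda>ys. neg (tl (tl ys))"
      by (rule C'.lift_ctx[OF C2(1)])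
    show "polytime C2 (\<lambda>ys. check (mu (tl (tl ys))) (l (tl (tl ys))) (r (tl (tl ys))) (b (tl (tl ys)))
      (candidate (mu (tl (tl ys))) (l (tl (tl ys))) (q (tl (tl ys))) (b (tl (tl ys))) (n (tl (tl ys))) (hd (tl ys)) (hd ys)))"
      by (intro C2.polytime_check C2.polytime_candidate polytime_lift[OF C2(1)] polytime_lift[OF C'(1) n]
          unaryD(1) C'(2) C2(2))
  qed
qed

lemma polytime_try_power:
  assumes "polytime C w" "polytime C n" "polytime C c"
  shows "polytime C (\<lambda>xs. try_power (ad xs) (mu xs) (l xs) (q xs) (r xs) (b xs) (z xs) (neg xs) (w xs) (n xs) (c xs))"
  unfolding try_power_def by (intro polytime_candidates polytime_split_code polytime_power_minus assms)

lemma polytime_try_powers: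
  assumes t: "unary C t" and om: "polytime_op C om" and w: "polytime C w"
  shows "polytime C (\<lambda>xs. try_powers (ad xs) (mu xs) (l xs) (q xs) (r xs) (b xs) (z xs) (neg xs) (t xs) (om xs) (w xs))"
  unfolding try_powers_def
proof (rule polytime_first)
  show "unary C (\<lambda>xs. t xs + 1)" by (intro unary_add t unary_const)
  fix C1 assume C1: "extends C (\<lambda>xs. t xs + 1) C1" "unary C1 hd"
  interpret C1: algebra_ctx C1 "\<lambda>ys. ad (tl ys)" "\<lambda>ys. mu (tl ys)" "\<lambda>ys. l (tl ys)" "\<lambda>ys. q (tl ys)"
    "\<lambda>ys. r (tl ys)" "\<lambda>ys. b (tl ys)" "\<lambda>ys. z (tl ys)" "\<lambda>ys. neg (tl ys)" by (rule lift_ctx[OF C1(1)])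
  note t1 = unary_lift[OF C1(1) t] and w1 = polytime_lift[OF C1(1) w] and om1 = polytime_op_lift[OF C1(1) om]
    and s1 = unaryD(1)[OF C1(2)]
  show "polytime C1 (\<lambda>ys. first (l (tl ys) + 1) (\<lambda>i. first (t (tl ys) + 3) (\<lambda>k.
     try_power (ad (tl ys)) (mu (tl ys)) (l (tl ys)) (q (tl ys)) (r (tl ys)) (b (tl ys)) (z (tl ys)) (neg (tl ys)) (w (tl ys))
      ((q (tl ys) - 1) div hd ys ^ i) (repeated_squaring (mu (tl ys)) (l (tl ys)) (om (tl ys) (hd ys) 0) k))))"
  proof (rule polytime_first)
    show "unary C1 (\<lambda>ys. l (tl ys) + 1)" by (intro unary_add C1.l unary_const)
    fix C2 assume C2: "extends C1 (\<lambda>ys. l (tl ys) + 1) C2" "unary C2 hd"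
    interpret C2: algebra_ctx C2 "\<lambda>ys. ad (tl (tl ys))" "\<lambda>ys. mu (tl (tl ys))" "\<lambda>ys. l (tl (tl ys))" "\<lambda>ys. q (tl (tl ys))"
      "\<lambda>ys. r (tl (tl ys))" "\<lambda>ys. b (tl (tl ys))" "\<lambda>ys. z (tl (tl ys))" "\<lambda>ys. neg (tl (tl ys))"
      by (rule C1.lift_ctx[OF C2(1)])
    note t2 = unary_lift[OF C2(1) t1] and w2 = polytime_lift[OF C2(1) w1] and om2 = polytime_op_lift[OF C2(1) om1]
      and s2 = polytime_lift[OF C2(1) s1]
    show "polytime C2 (\<lambda>ys. first (t (tl (tl ys)) + 3) (\<lambda>k.
     try_power (ad (tl (tl ys))) (mu (tl (tl ys))) (l (tl (tl ys))) (q (tl (tl ys))) (r (tl (tl ys))) (b (tl (tl ys)))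
      (z (tl (tl ys))) (neg (tl (tl ys))) (w (tl (tl ys))) ((q (tl (tl ys)) - 1) div hd (tl ys) ^ hd ys)
      (repeated_squaring (mu (tl (tl ys))) (l (tl (tl ys))) (om (tl (tl ys)) (hd (tl ys)) 0) k)))"
    proof (rule polytime_first)
      show "unary C2 (\<lambda>ys. t (tl (tl ys)) + 3)" by (intro unary_add t2 unary_const)
      fix C3 assume C3: "extends C2 (\<lambda>ys. t (tl (tl ys)) + 3) C3" "unary C3 hd"
      interpret C3: algebra_ctx C3 "\<lambda>ys. ad (tl (tl (tl ys)))" "\<lambda>ys. mu (tl (tl (tl ys)))" "\<lambda>ys. l (tl (tl (tl ys)))"
        "\<lambda>ys. q (tl (tl (tl ys)))" "\<lambda>ys. r (tl (tl (tl ys)))" "\<lambda>ys. b (tl (tl (tl ys)))" "\<lambda>ys. z (tl (tl (tl ys)))"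
        "\<lambda>ys. neg (tl (tl (tl ys)))"
        by (rule C2.lift_ctx[OF C3(1)])
      note s3 = polytime_lift[OF C3(1) s2] and i3 = unary_lift[OF C3(1) C2(2)]
        and om3 = polytime_op_lift[OF C3(1) om2] and w3 = polytime_lift[OF C3(1) w2]
      show "polytime C3 (\<lambda>ys. try_power (ad (tl (tl (tl ys)))) (mu (tl (tl (tl ys)))) (l (tl (tl (tl ys)))) (q (tl (tl (tl ys))))
        (r (tl (tl (tl ys)))) (b (tl (tl (tl ys)))) (z (tl (tl (tl ys)))) (neg (tl (tl (tl ys)))) (w (tl (tl (tl ys))))
        ((q (tl (tl (tl ys))) - 1) div hd (tl (tl ys)) ^ hd (tl ys))
        (repeated_squaring (mu (tl (tl (tl ys)))) (l (tl (tl (tl ys)))) (om (tl (tl (tl ys))) (hd (tl (tl ys))) 0) (hd ys)))"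
        by (intro C3.polytime_try_power w3 polytime_div polytime_diff C3.q polytime_const polytime_power s3 i3
            C3.rs(2) polytime_op_apply[OF om3] unaryD(1)[OF C3(2)])
    qed
  qed
qed

lemma polytime_try_shift:
  assumes t: "unary C t" and om: "polytime_op C om" and a: "polytime C a"
  shows "polytime C (\<lambda>xs. try_shift (ad xs) (mu xs) (l xs) (q xs) (r xs) (b xs) (z xs) (neg xs) (t xs) (om xs) (a xs))"
  unfolding try_shift_def
  by (intro polytime_if_nonzero polytime_check polytime_try_powers polytime_shift_quotient
      polytime_add polytime_mult basic assms)

lemma polytime_find_root:
  assumes t: "unary C t" and om: "polytime_op C om"
  shows "polytime C (\<lambda>xs. find_root (ad xs) (mu xs) (l xs) (q xs) (r xs) (z xs) (neg xs) (t xs) (b xs) (om xs))"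
  unfolding find_root_def
proof (rule polytime_first)
  show "unary C (\<lambda>xs. 2 * t xs + 1)" by (intro unary_add unary_mult t unary_const)
  fix C' assume C': "extends C (\<lambda>xs. 2 * t xs + 1) C'" "unary C' hd"
  interpret C': algebra_ctx C' "\<lambda>ys. ad (tl ys)" "\<lambda>ys. mu (tl ys)" "\<lambda>ys. l (tl ys)" "\<lambda>ys. q (tl ys)"
    "\<lambda>ys. r (tl ys)" "\<lambda>ys. b (tl ys)" "\<lambda>ys. z (tl ys)" "\<lambda>ys. neg (tl ys)" by (rule lift_ctx[OF C'(1)])
  show "polytime C' (\<lambda>ys. try_shift (ad (tl ys)) (mu (tl ys)) (l (tl ys)) (q (tl ys)) (r (tl ys)) (b (tl ys)) (z (tl ys))
      (neg (tl ys)) (t (tl ys)) (om (tl ys)) (hd ys mod q (tl ys)))"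
    by (intro C'.polytime_try_shift unary_lift[OF C'(1) t] polytime_op_lift[OF C'(1) om] polytime_mod
        C'.q unaryD(1)[OF C'(2)])
qed

end

section \<open>Correctness of the search\<close>

context presented
begin

declare zero_F [simp del] one_F [simp del]

lemma p_pos [simp]: "0 < p"
  using p_gt_1 by simp

lemma q_gt_1: "1 < q" by (rule fq.m)

lemma dec_inj: "a < q \<Longrightarrow> b < q \<Longrightarrow> dec a = dec b \<Longrightarrow> a = b"
  using encode_dec by metis

lemma reduce_minus: "reduce p f (a - b) = reduce p f a \<ominus>\<^bsub>F\<^esub> reduce p f b"
proof -
  have "reduce p f (a - b) \<oplus>\<^bsub>F\<^esub> reduce p f b = reduce p f a"
    by (simp flip: reduce_add)
  then show ?thesis
    using F.minus_closed reduce_in_carrier by (metis F.add.inv_solve_right F.minus_eq)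
qed

lemma F_pow: "x \<in> carrier F \<Longrightarrow> x \<noteq> \<zero>\<^bsub>F\<^esub> \<Longrightarrow> x [^]\<^bsub>F\<^esub> (q - 1) = \<one>\<^bsub>F\<^esub>"
proof -
  assume x: "x \<in> carrier F" "x \<noteq> \<zero>\<^bsub>F\<^esub>"
  interpret M: comm_group "mult_of F" by (rule F.units_comm_group[unfolded F.mult_of_is_Units[symmetric]])
  have "order (mult_of F) = q - 1"
    using F.order_mult_of[OF finite_F] field_size_eq by (simp add: order_def field_size_def)
  then show ?thesis
    using M.pow_order_eq_1[of x] x by (simp add: nat_pow_mult_of)
qed

lemma F_inv: "x \<in> carrier F \<Longrightarrow> x \<noteq> \<zero>\<^bsub>F\<^esub> \<Longrightarrow> inv\<^bsub>mult_of F\<^esub> x = x [^]\<^bsub>F\<^esub> (q - 2)"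
proof -
  assume x: "x \<in> carrier F" "x \<noteq> \<zero>\<^bsub>F\<^esub>"
  interpret M: comm_group "mult_of F" by (rule F.units_comm_group[unfolded F.mult_of_is_Units[symmetric]])
  have "x [^]\<^bsub>F\<^esub> Suc (q - 2) = \<one>\<^bsub>F\<^esub>"
    using F_pow[OF x] q_gt_1 by (simp add: Suc_diff_Suc numeral_2_eq_2 del: F.nat_pow_Suc)
  then have "x [^]\<^bsub>F\<^esub> (q - 2) \<otimes>\<^bsub>F\<^esub> x = \<one>\<^bsub>F\<^esub>" by simp
  moreover have "x [^]\<^bsub>F\<^esub> (q - 2) \<noteq> \<zero>\<^bsub>F\<^esub>"
    using calculation x F.l_null by auto
  ultimately show ?thesis
    using x by (intro M.inv_equality) auto
qed

lemma F_pow_0: "0 < n \<Longrightarrow> \<zero>\<^bsub>F\<^esub> [^]\<^bsub>F\<^esub> (n::nat) = \<zero>\<^bsub>F\<^esub>"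
  using F.nat_pow_zero[of n] by simp

lemma F_pow_nonzero: "x \<in> carrier F \<Longrightarrow> x \<noteq> \<zero>\<^bsub>F\<^esub> \<Longrightarrow> x [^]\<^bsub>F\<^esub> (n::nat) \<noteq> \<zero>\<^bsub>F\<^esub>"
proof (induction n)
  case (Suc n)
  then show ?case using F.integral[of "x [^]\<^bsub>F\<^esub> n" x] by auto
qed (use F.one_not_zero in simp)

lemma F_add_left_cancel:
  "x \<in> carrier F \<Longrightarrow> a \<in> carrier F \<Longrightarrow> c \<in> carrier F \<Longrightarrow> x \<oplus>\<^bsub>F\<^esub> a = x \<oplus>\<^bsub>F\<^esub> c \<longleftrightarrow> a = c"
  by (metis F.a_comm F.add.right_cancel)

text \<open>Divide the difference of the two values by x - y. The factorisation is an identity of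
  integer polynomials, transported to the field through \<open>reduce\<close>.\<close>

lemma quadratic_roots:
  assumes c: "x \<in> carrier F" "y \<in> carrier F" "e \<in> carrier F" "e' \<in> carrier F"
    and eq: "(\<one>\<^bsub>F\<^esub> \<oplus>\<^bsub>F\<^esub> e \<otimes>\<^bsub>F\<^esub> x) \<otimes>\<^bsub>F\<^esub> (\<one>\<^bsub>F\<^esub> \<oplus>\<^bsub>F\<^esub> e' \<otimes>\<^bsub>F\<^esub> x) =
      (\<one>\<^bsub>F\<^esub> \<oplus>\<^bsub>F\<^esub> e \<otimes>\<^bsub>F\<^esub> y) \<otimes>\<^bsub>F\<^esub> (\<one>\<^bsub>F\<^esub> \<oplus>\<^bsub>F\<^esub> e' \<otimes>\<^bsub>F\<^esub> y)"
    and ne: "x \<noteq> y"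
  shows "(e \<oplus>\<^bsub>F\<^esub> e') \<oplus>\<^bsub>F\<^esub> (e \<otimes>\<^bsub>F\<^esub> e') \<otimes>\<^bsub>F\<^esub> (x \<oplus>\<^bsub>F\<^esub> y) = \<zero>\<^bsub>F\<^esub>"
proof -
  let ?g = "(e \<oplus>\<^bsub>F\<^esub> e') \<oplus>\<^bsub>F\<^esub> (e \<otimes>\<^bsub>F\<^esub> e') \<otimes>\<^bsub>F\<^esub> (x \<oplus>\<^bsub>F\<^esub> y)"
  have r: "x = reduce p f x" "y = reduce p f y" "e = reduce p f e" "e' = reduce p f e'" "\<one>\<^bsub>F\<^esub> = reduce p f 1"
    using c by (simp_all add: reduce_carrier reduce_1 one_F)
  have "(x \<ominus>\<^bsub>F\<^esub> y) \<otimes>\<^bsub>F\<^esub> ?g = reduce p f ((x - y) * ((e + e') + (e * e') * (x + y)))"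
    by (simp only: reduce_mult reduce_add reduce_minus r[symmetric])
  also have "\<dots> = reduce p f ((1 + e * x) * (1 + e' * x) - (1 + e * y) * (1 + e' * y))"
    by (rule arg_cong[of _ _ "reduce p f"]) (simp add: algebra_simps)
  also have "\<dots> = (\<one>\<^bsub>F\<^esub> \<oplus>\<^bsub>F\<^esub> e \<otimes>\<^bsub>F\<^esub> x) \<otimes>\<^bsub>F\<^esub> (\<one>\<^bsub>F\<^esub> \<oplus>\<^bsub>F\<^esub> e' \<otimes>\<^bsub>F\<^esub> x) \<ominus>\<^bsub>F\<^esub>
      (\<one>\<^bsub>F\<^esub> \<oplus>\<^bsub>F\<^esub> e \<otimes>\<^bsub>F\<^esub> y) \<otimes>\<^bsub>F\<^esub> (\<one>\<^bsub>F\<^esub> \<oplus>\<^bsub>F\<^esub> e' \<otimes>\<^bsub>F\<^esub> y)"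
    by (simp only: reduce_mult reduce_add reduce_minus r[symmetric])
  also have "\<dots> = \<zero>\<^bsub>F\<^esub>" unfolding eq using c F.r_right_minus_eq by simp
  finally have "(x \<ominus>\<^bsub>F\<^esub> y) \<otimes>\<^bsub>F\<^esub> ?g = \<zero>\<^bsub>F\<^esub>" .
  moreover have "x \<ominus>\<^bsub>F\<^esub> y \<noteq> \<zero>\<^bsub>F\<^esub>" using c ne F.r_right_minus_eq[of x y] by simp
  moreover have "?g \<in> carrier F" using c by simp
  ultimately show ?thesis using F.integral[of "x \<ominus>\<^bsub>F\<^esub> y" ?g] c by simp
qed

text \<open>The quadratic polynomial takes each value at most twice, and the values allowed are the
  at most \<open>t\<close> roots of X^t - 1.\<close>

lemma fiber_bound:
  assumes A: "finite A" and e: "e \<in> carrier F" "e' \<in> carrier F" "e \<noteq> \<zero>\<^bsub>F\<^esub>" "e' \<noteq> \<zero>\<^bsub>F\<^esub>" and t: "t > 0"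
    and v: "\<And>a. a \<in> A \<Longrightarrow> v a \<in> carrier F" "inj_on v A"
    and pow: "\<And>a. a \<in> A \<Longrightarrow> ((\<one>\<^bsub>F\<^esub> \<oplus>\<^bsub>F\<^esub> e \<otimes>\<^bsub>F\<^esub> v a) \<otimes>\<^bsub>F\<^esub> (\<one>\<^bsub>F\<^esub> \<oplus>\<^bsub>F\<^esub> e' \<otimes>\<^bsub>F\<^esub> v a)) [^]\<^bsub>F\<^esub> t = \<one>\<^bsub>F\<^esub>"
  shows "card A \<le> 2 * t"
proof -
  define U where "U = (\<lambda>a. (\<one>\<^bsub>F\<^esub> \<oplus>\<^bsub>F\<^esub> e \<otimes>\<^bsub>F\<^esub> v a) \<otimes>\<^bsub>F\<^esub> (\<one>\<^bsub>F\<^esub> \<oplus>\<^bsub>F\<^esub> e' \<otimes>\<^bsub>F\<^esub> v a))"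
  let ?W = "{w \<in> carrier F. w [^]\<^bsub>F\<^esub> t = \<one>\<^bsub>F\<^esub>}"
  have W: "finite ?W" "card ?W \<le> t" using F.num_roots_le_deg[OF finite_F, of t] t finite_F by auto
  have UW: "U a \<in> ?W" if "a \<in> A" for a
    using pow[OF that] v(1)[OF that] e by (simp add: U_def)
  have fib: "card {a \<in> A. U a = w} \<le> 2" for w
  proof (rule ccontr)
    assume "\<not> card {a \<in> A. U a = w} \<le> 2"
    then obtain T where T: "T \<subseteq> {a \<in> A. U a = w}" "card T = 3"
      by (metis not_less_eq_eq numeral_2_eq_2 numeral_3_eq_3 obtain_subset_with_card_n)
    then obtain x y z where xyz: "T = {x, y, z}" "x \<noteq> y" "y \<noteq> z" "x \<noteq> z"
      unfolding card_3_iff by blast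
    then have in_A: "x \<in> A" "y \<in> A" "z \<in> A" and U: "U x = U y" "U x = U z" using T(1) by auto
    have ne: "v x \<noteq> v y" "v x \<noteq> v z" "v y \<noteq> v z"
      using xyz in_A v(2) by (auto dest: inj_onD)
    note c = v(1)[OF in_A(1)] v(1)[OF in_A(2)] v(1)[OF in_A(3)]
    let ?k = "e \<otimes>\<^bsub>F\<^esub> e'" and ?s = "e \<oplus>\<^bsub>F\<^esub> e'"
    have "?s \<oplus>\<^bsub>F\<^esub> ?k \<otimes>\<^bsub>F\<^esub> (v x \<oplus>\<^bsub>F\<^esub> v y) = \<zero>\<^bsub>F\<^esub>"
      by (rule quadratic_roots[OF c(1,2) e(1,2) U(1)[unfolded U_def] ne(1)])
    moreover have "?s \<oplus>\<^bsub>F\<^esub> ?k \<otimes>\<^bsub>F\<^esub> (v x \<oplus>\<^bsub>F\<^esub> v z) = \<zero>\<^bsub>F\<^esub>"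
      by (rule quadratic_roots[OF c(1,3) e(1,2) U(2)[unfolded U_def] ne(2)])
    ultimately have "?s \<oplus>\<^bsub>F\<^esub> ?k \<otimes>\<^bsub>F\<^esub> (v x \<oplus>\<^bsub>F\<^esub> v y) = ?s \<oplus>\<^bsub>F\<^esub> ?k \<otimes>\<^bsub>F\<^esub> (v x \<oplus>\<^bsub>F\<^esub> v z)" by simp
    then have "?k \<otimes>\<^bsub>F\<^esub> (v x \<oplus>\<^bsub>F\<^esub> v y) = ?k \<otimes>\<^bsub>F\<^esub> (v x \<oplus>\<^bsub>F\<^esub> v z)"
      using c e F_add_left_cancel by simp
    moreover have "?k \<noteq> \<zero>\<^bsub>F\<^esub>" using e F.integral[of e e'] by auto
    ultimately have "v x \<oplus>\<^bsub>F\<^esub> v y = v x \<oplus>\<^bsub>F\<^esub> v z"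
      using F.m_lcancel[of ?k "v x \<oplus>\<^bsub>F\<^esub> v y" "v x \<oplus>\<^bsub>F\<^esub> v z"] c e by simp
    then have "v y = v z" using c F_add_left_cancel by simp
    then show False using ne by simp
  qed
  have "A \<subseteq> (\<Union>w\<in>?W. {a \<in> A. U a = w})" using UW by blast
  then have "card A \<le> card (\<Union>w\<in>?W. {a \<in> A. U a = w})"
    using A W(1) by (intro card_mono) auto
  also have "\<dots> \<le> (\<Sum>w\<in>?W. card {a \<in> A. U a = w})" using W(1) by (rule card_UN_le)
  also have "\<dots> \<le> (\<Sum>w\<in>?W. 2)" using fib by (intro sum_mono)
  also have "\<dots> \<le> 2 * t" using W(2) by simp
  finally show ?thesis .
qed

end

locale radical = presented +
  fixes r l b z :: nat
  assumes prime_r: "prime r" and r_dvd: "r dvd q - 1" and q_less: "q < 2 ^ l"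
    and b: "b < q" "dec b \<noteq> \<zero>\<^bsub>F\<^esub>" and z: "z < q" and \<zeta>: "primitive_root_of_unity F r (dec z)"
begin

abbreviation "\<beta> \<equiv> dec b"
abbreviation "\<zeta> \<equiv> dec z"
abbreviation "aa \<equiv> ext_add fadd q r"
abbreviation "am \<equiv> ext_mul fadd fmul q r b"
abbreviation "rsf \<equiv> repeated_squaring fmul l"
abbreviation "rsa \<equiv> repeated_squaring am l"

lemma r_bounds: "2 \<le> r" "r < q" "r < 2 ^ l"
proof -
  show "2 \<le> r" using prime_r by (rule prime_ge_2_nat)
  have "r \<le> q - 1" using r_dvd q_gt_1 by (intro dvd_imp_le) auto
  then show "r < q" using q_gt_1 by simp
  then show "r < 2 ^ l" using q_less by simp
qed

text \<open>The characteristic divides q, whereas r divides q - 1.\<close>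

lemma p_not_dvd_r: "\<not> p dvd r"
proof
  assume "p dvd r"
  then have "p dvd q - 1" using r_dvd by (rule dvd_trans)
  moreover have "p dvd q" using d_pos by (intro dvd_power) simp
  ultimately have "p dvd 1" using q_gt_1 by (metis dvd_diff_nat diff_diff_cancel less_imp_le)
  then show False using p_gt_1 by simp
qed

lemma \<zeta>_facts: "\<zeta> \<in> carrier F" "\<zeta> [^]\<^bsub>F\<^esub> r = \<one>\<^bsub>F\<^esub>" "\<And>k. 0 < k \<Longrightarrow> k < r \<Longrightarrow> \<zeta> [^]\<^bsub>F\<^esub> k \<noteq> \<one>\<^bsub>F\<^esub>"
  using \<zeta> unfolding primitive_root_of_unity_def by auto

lemma \<zeta>_nonzero: "\<zeta> \<noteq> \<zero>\<^bsub>F\<^esub>"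
  using \<zeta>_facts(2) r_bounds F_pow_0[of r] F.one_not_zero by auto

lemma check_sound:
  assumes "c < q" "check fmul l r b c \<noteq> 0"
  shows "check fmul l r b c < q \<and> dec (check fmul l r b c) [^]\<^bsub>F\<^esub> r = \<beta>"
  using assms fq.repeated_squaring_correct(2)[OF assms(1) r_bounds(3)]
  by (auto simp: check_def split: if_splits)

lemma check_complete:
  assumes "c < q" "dec c [^]\<^bsub>F\<^esub> r = \<beta>"
  shows "check fmul l r b c \<noteq> 0"
proof -
  have "rsf c r = b"
    using fq.repeated_squaring_correct[OF assms(1) r_bounds(3)] assms(2) b(1) by (intro dec_inj) auto
  moreover have "c \<noteq> 0"
    using assms(2) b(2) r_bounds fq.code_0 F_pow_0[of r] by (intro notI) auto
  ultimately show ?thesis by (simp add: check_def)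
qed

lemma candidate_less: "n < q \<Longrightarrow> u < r \<Longrightarrow> v < r \<Longrightarrow> candidate fmul l q b n u v < q"
  unfolding candidate_def using r_bounds q_less b
  by (intro fq.mu_less fq.repeated_squaring_correct) auto

lemma candidates_sound:
  assumes "n < q" "candidates fmul l q r b n \<noteq> 0"
  shows "candidates fmul l q r b n < q \<and> dec (candidates fmul l q r b n) [^]\<^bsub>F\<^esub> r = \<beta>"
  using assms unfolding candidates_def
  by (intro first_satisfies[where P = "\<lambda>c. c < q \<and> dec c [^]\<^bsub>F\<^esub> r = \<beta>"] check_sound candidate_less)

lemma dig_q: "dig q x j < q" using q_gt_1 by (simp add: dig_less)

lemma try_power_sound:
  assumes "try_power fadd fmul l q r b z neg w n c \<noteq> 0"
  shows "try_power fadd fmul l q r b z neg w n c < q \<and> dec (try_power fadd fmul l q r b z neg w n c) [^]\<^bsub>F\<^esub> r = \<beta>"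
  using assms unfolding try_power_def
  by (rule candidates_sound[rotated]) (simp add: split_code_def norm_code_def dig_q)

lemma try_powers_sound:
  assumes "try_powers fadd fmul l q r b z neg t om w \<noteq> 0"
  shows "try_powers fadd fmul l q r b z neg t om w < q \<and> dec (try_powers fadd fmul l q r b z neg t om w) [^]\<^bsub>F\<^esub> r = \<beta>"
  using assms unfolding try_powers_def
  by (intro first_satisfies[where P = "\<lambda>c. c < q \<and> dec c [^]\<^bsub>F\<^esub> r = \<beta>"] try_power_sound)

text \<open>Every output has passed \<open>check\<close>, so nothing is required of the roots of
  unity in \<open>om\<close> or of \<open>b\<close> being a residue.\<close>

lemma find_root_sound:
  assumes "find_root fadd fmul l q r z neg t b om \<noteq> 0"
  shows "find_root fadd fmul l q r z neg t b om < q \<and> dec (find_root fadd fmul l q r z neg t b om) [^]\<^bsub>F\<^esub> r = \<beta>"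
  using assms unfolding find_root_def
proof (rule first_satisfies[where P = "\<lambda>c. c < q \<and> dec c [^]\<^bsub>F\<^esub> r = \<beta>", rotated])
  fix a
  have a: "a mod q < q" using q_gt_1 by simp
  assume ne: "try_shift fadd fmul l q r b z neg t om (a mod q) \<noteq> 0"
  show "try_shift fadd fmul l q r b z neg t om (a mod q) < q \<and> dec (try_shift fadd fmul l q r b z neg t om (a mod q)) [^]\<^bsub>F\<^esub> r = \<beta>"
    using ne check_sound[OF a] try_powers_sound unfolding try_shift_def by (simp split: if_splits)
qed

end

section \<open>Evaluations at the conjugates of a root, used only for analysing the search\<close>

locale radical_root = radical +
  fixes \<alpha> :: "int poly"
  assumes \<alpha>: "\<alpha> \<in> carrier F" "\<alpha> [^]\<^bsub>F\<^esub> r = \<beta>"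
begin

definition conjugate :: "nat \<Rightarrow> int poly" where "conjugate j = \<zeta> [^]\<^bsub>F\<^esub> j \<otimes>\<^bsub>F\<^esub> \<alpha>"

abbreviation "E j \<equiv> fq.ev (conjugate j) r"

lemma \<alpha>_nonzero: "\<alpha> \<noteq> \<zero>\<^bsub>F\<^esub>"
  using \<alpha>(2) b(2) r_bounds F_pow_0[of r] by auto

lemma conjugate_closed: "conjugate j \<in> carrier F" using \<alpha> \<zeta>_facts by (simp add: conjugate_def)

lemma conjugate_nonzero: "conjugate j \<noteq> \<zero>\<^bsub>F\<^esub>"
  using F.integral[of "\<zeta> [^]\<^bsub>F\<^esub> j" \<alpha>] F_pow_nonzero[OF \<zeta>_facts(1) \<zeta>_nonzero] \<alpha> \<alpha>_nonzero \<zeta>_facts(1)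
  by (auto simp: conjugate_def)

lemma conjugate_periodic: "conjugate (j + r) = conjugate j"
  using \<zeta>_facts by (simp add: conjugate_def F.nat_pow_mult[symmetric])

lemma conjugate_power: "conjugate j [^]\<^bsub>F\<^esub> r = \<beta>"
proof -
  have "(\<zeta> [^]\<^bsub>F\<^esub> j) [^]\<^bsub>F\<^esub> r = (\<zeta> [^]\<^bsub>F\<^esub> r) [^]\<^bsub>F\<^esub> j"
    using \<zeta>_facts(1) by (simp add: F.nat_pow_pow mult.commute)
  then have "(\<zeta> [^]\<^bsub>F\<^esub> j) [^]\<^bsub>F\<^esub> r = \<one>\<^bsub>F\<^esub>" using \<zeta>_facts(2) by simp
  then show ?thesis using \<alpha> \<zeta>_facts(1) fq.code_closed[OF b(1)]
    by (simp add: conjugate_def F.nat_pow_distrib)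
qed

lemma A: "coded F (E j) (q ^ r) aa am"
proof (rule fq.coded_ext[OF conjugate_closed])
  show "conjugate j [^]\<^bsub>F\<^esub> r = E j b"
    using fq.ev_const[OF conjugate_closed b(1)] r_bounds conjugate_power by simp
qed (use r_bounds in simp)

lemma q_le: "q \<le> q ^ r" using r_bounds q_gt_1 by (intro self_le_power) auto

lemma q_less_pow: "q < q ^ r" using r_bounds q_gt_1 power_strict_increasing[of 1 r q] by simp

lemma E_periodic: "E (j + r) h = E j h" by (simp add: conjugate_periodic)

lemma E_closed: "E j h \<in> carrier F" by (rule fq.ev_closed[OF conjugate_closed])

lemma E_const: "c < q \<Longrightarrow> E j c = dec c"
  using r_bounds by (intro fq.ev_const[OF conjugate_closed]) auto

lemma E_x: "E j q = conjugate j"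
  using fq.ev_linear[OF conjugate_closed, of 0 1] q_gt_1 r_bounds fq.code_0 fq.code_1 conjugate_closed by simp

lemma neg: "p - 1 < q" "dec (p - 1) = \<ominus>\<^bsub>F\<^esub> \<one>\<^bsub>F\<^esub>"
proof -
  have "p \<le> q" using d_pos p_gt_1 by (intro self_le_power) auto
  then show "p - 1 < q" using p_gt_1 by simp
qed (rule dec_minus_one)

lemma E_linear: "a < q \<Longrightarrow> E j (a + (p - 1) * q) = dec a \<ominus>\<^bsub>F\<^esub> conjugate j"
  using fq.ev_linear[OF conjugate_closed, of a "p - 1"] neg r_bounds conjugate_closed
  by (simp add: F.l_minus F.minus_eq)

lemma linear_less: "a < q \<Longrightarrow> a + (p - 1) * q < q ^ r"
proof -
  assume a: "a < q"
  have "a + (p - 1) * q < q + (q - 1) * q"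
    using a neg(1) by (intro add_less_le_mono mult_right_mono) auto
  also have "\<dots> = q ^ 2" using q_gt_1 by (simp add: power2_eq_square algebra_simps)
  also have "\<dots> \<le> q ^ r" using r_bounds q_gt_1 by (intro power_increasing) auto
  finally show ?thesis .
qed

lemma substitute_less: "substitute fmul l q r w h < q ^ r"
  unfolding substitute_def using q_gt_1 by (intro tab_less) simp

lemma E_substitute:
  assumes w: "w < q" "dec w = \<zeta> [^]\<^bsub>F\<^esub> i"
  shows "E j (substitute fmul l q r w h) = E (j + i) h"
proof -
  have rs: "rsf w k < q" "dec (rsf w k) = dec w [^]\<^bsub>F\<^esub> k" if "k < r" for k
    using fq.repeated_squaring_correct[OF w(1), of k l] that r_bounds by auto
  have "E j (substitute fmul l q r w h) = rsum F r (\<lambda>k. dec (fmul (dig q h k) (rsf w k)) \<otimes>\<^bsub>F\<^esub> conjugate j [^]\<^bsub>F\<^esub> k)"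
    unfolding substitute_def by (rule fq.ev_tab) (simp add: fq.mu_less dig_q rs)
  also have "\<dots> = rsum F r (\<lambda>k. dec (dig q h k) \<otimes>\<^bsub>F\<^esub> conjugate (j + i) [^]\<^bsub>F\<^esub> k)"
  proof (rule rsum_cong)
    fix k assume k: "k < r"
    have "conjugate (j + i) = dec w \<otimes>\<^bsub>F\<^esub> conjugate j"
      using \<zeta>_facts(1) \<alpha>(1) by (simp add: conjugate_def w(2) F.nat_pow_mult[symmetric] F.m_ac)
    then show "dec (fmul (dig q h k) (rsf w k)) \<otimes>\<^bsub>F\<^esub> conjugate j [^]\<^bsub>F\<^esub> k = dec (dig q h k) \<otimes>\<^bsub>F\<^esub> conjugate (j + i) [^]\<^bsub>F\<^esub> k"
      using fq.code_closed[OF w(1)] conjugate_closed fq.code_closed[OF dig_q]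
      by (simp add: fq.code_mu[OF dig_q rs(1)[OF k]] rs(2)[OF k] F.nat_pow_distrib F.m_assoc)
  qed
  finally show ?thesis by (simp add: fq.ev_def)
qed

lemma E_rsa: "h < q ^ r \<Longrightarrow> n < 2 ^ l \<Longrightarrow> rsa h n < q ^ r \<and> E j (rsa h n) = E j h [^]\<^bsub>F\<^esub> n"
  using coded.repeated_squaring_correct[OF A] by blast

lemma E_am: "g < q ^ r \<Longrightarrow> h < q ^ r \<Longrightarrow> am g h < q ^ r \<and> E j (am g h) = E j g \<otimes>\<^bsub>F\<^esub> E j h"
  using coded.mu_less[OF A] coded.code_mu[OF A] by blast

lemma E_aa: "g < q ^ r \<Longrightarrow> h < q ^ r \<Longrightarrow> aa g h < q ^ r \<and> E j (aa g h) = E j g \<oplus>\<^bsub>F\<^esub> E j h"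
  using coded.ad_less[OF A] coded.code_ad[OF A] by blast

lemma E_shift_quotient:
  assumes h: "h < q ^ r"
  shows "shift_quotient fadd fmul l q r b z h < q ^ r"
    "E j (shift_quotient fadd fmul l q r b z h) = E j h \<otimes>\<^bsub>F\<^esub> E (Suc j) h [^]\<^bsub>F\<^esub> (q - 2)"
proof -
  have "E j (substitute fmul l q r z h) = E (j + 1) h" for j
    using \<zeta>_facts(1) z by (intro E_substitute) auto
  then show "shift_quotient fadd fmul l q r b z h < q ^ r"
    "E j (shift_quotient fadd fmul l q r b z h) = E j h \<otimes>\<^bsub>F\<^esub> E (Suc j) h [^]\<^bsub>F\<^esub> (q - 2)"
    unfolding shift_quotient_def using E_am[OF h] E_rsa[OF substitute_less, of "q - 2"] q_less by simp_all
qed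

text \<open>The product of all substitutions has the same value at every conjugate, by periodicity,
  and an element with equal evaluations has that value as its constant coefficient.\<close>

lemma E_norm:
  assumes h: "h < q ^ r" and nz: "\<And>j. E j h \<noteq> \<zero>\<^bsub>F\<^esub>"
  shows "norm_code fadd fmul l q r b z h < q"
    "dec (norm_code fadd fmul l q r b z h) = rprod F r (\<lambda>i. E i h)"
proof -
  let ?F = "\<lambda>i acc. am acc (substitute fmul l q r (rsf z i) h)"
  let ?N = "loop r ?F 1"
  show "norm_code fadd fmul l q r b z h < q" unfolding norm_code_def by (rule dig_q)
  \<comment> \<open>The claim covers all \<open>j\<close>, since extracting the constant coefficient
    requires the evaluations at all conjugates.\<close>
  have "loop i ?F 1 < q ^ r \<and> E j (loop i ?F 1) = rprod F i (\<lambda>i. E (j + i) h)" if "i \<le> r" for i j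
    using that
  proof (induction i)
    case 0
    then show ?case using E_const[of 1] q_gt_1 q_less_pow fq.code_1 by simp
  next
    case (Suc i)
    have "rsf z i < q" "dec (rsf z i) = \<zeta> [^]\<^bsub>F\<^esub> i"
      using fq.repeated_squaring_correct[OF z, of i l] Suc.prems r_bounds by auto
    then have "E j (substitute fmul l q r (rsf z i) h) = E (j + i) h" by (rule E_substitute)
    then show ?case using Suc E_am[OF _ substitute_less] by simp
  qed
  from this[OF order_refl] have N: "?N < q ^ r" "E j ?N = rprod F r (\<lambda>i. E (j + i) h)" for j by auto
  define v where "v = rprod F r (\<lambda>i. E i h)"
  have v: "E j ?N = v" for j
    unfolding N v_def
    by (rule F.rprod_periodic[of "\<lambda>i. E i h"]) (use E_closed nz E_periodic in auto)
  have vc: "v \<in> carrier F" unfolding v_def using E_closed by (intro F.rprod_closed)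
  have "dec (dig q ?N 0) = v"
  proof (rule F.constant_coefficient[OF prime_r _ \<zeta> \<alpha>(1) _ vc])
    show "rsum F r (\<lambda>_. \<one>\<^bsub>F\<^esub>) \<noteq> \<zero>\<^bsub>F\<^esub>" by (rule rsum_one_nonzero[OF p_not_dvd_r])
    show "rsum F r (\<lambda>k. dec (dig q ?N k) \<otimes>\<^bsub>F\<^esub> (\<zeta> [^]\<^bsub>F\<^esub> j \<otimes>\<^bsub>F\<^esub> \<alpha>) [^]\<^bsub>F\<^esub> k) = v" for j :: nat
      using v[of j] by (simp add: fq.ev_def conjugate_def)
  qed (rule fq.code_closed[OF dig_q])
  then show "dec (norm_code fadd fmul l q r b z h) = rprod F r (\<lambda>i. E i h)"
    by (simp add: norm_code_def v_def)
qed

lemma split_code_correct: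
  assumes h: "h < q ^ r" and j: "j < r" "E j h = \<zero>\<^bsub>F\<^esub>" and j': "j' < r" "E j' h \<noteq> \<zero>\<^bsub>F\<^esub>"
  obtains m k :: nat where "split_code fadd fmul l q r b z (p - 1) h < q" "0 < k" "k < r"
    "dec (split_code fadd fmul l q r b z (p - 1) h) = \<zeta> [^]\<^bsub>F\<^esub> m \<otimes>\<^bsub>F\<^esub> \<alpha> [^]\<^bsub>F\<^esub> k"
proof -
  define e where "e = rsa h (q - 1)"
  have q1: "q - 1 < 2 ^ l" "0 < q - 1" using q_less q_gt_1 by auto
  have e: "e < q ^ r" "E i e = (if E i h = \<zero>\<^bsub>F\<^esub> then \<zero>\<^bsub>F\<^esub> else \<one>\<^bsub>F\<^esub>)" for i
    using E_rsa[OF h q1(1)] F_pow[OF E_closed[of i h]] F_pow_0[OF q1(2)] unfolding e_def by auto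
  define g where "g = idempotent_code fadd fmul l q r b (p - 1) e"
  have c: "p - 1 < q ^ r" "1 < q ^ r" using neg(1) q_gt_1 q_le by linarith+
  have 1: "am (p - 1) e < q ^ r" "E i (am (p - 1) e) = \<ominus>\<^bsub>F\<^esub> E i e" for i
    using E_am[OF c(1) e(1)] E_const[OF neg(1)] neg(2) E_closed by (simp_all add: F.l_minus)
  have 2: "aa 1 (am (p - 1) e) < q ^ r" "E i (aa 1 (am (p - 1) e)) = \<one>\<^bsub>F\<^esub> \<ominus>\<^bsub>F\<^esub> E i e" for i
    using E_aa[OF c(2) 1(1)] 1(2) E_const[of 1] q_gt_1 fq.code_1 by (simp_all add: F.minus_eq)
  have 3: "am q (aa 1 (am (p - 1) e)) < q ^ r" "E i (am q (aa 1 (am (p - 1) e))) = conjugate i \<otimes>\<^bsub>F\<^esub> (\<one>\<^bsub>F\<^esub> \<ominus>\<^bsub>F\<^esub> E i e)" for i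
    using E_am[OF q_less_pow 2(1)] 2(2) E_x by (simp_all)
  have g: "g < q ^ r" "E i g = conjugate i \<otimes>\<^bsub>F\<^esub> (\<one>\<^bsub>F\<^esub> \<ominus>\<^bsub>F\<^esub> E i e) \<oplus>\<^bsub>F\<^esub> E i e" for i
    using E_aa[OF 3(1) e(1)] 3(2) by (simp_all add: g_def idempotent_code_def)
  define J where "J = {i. E i h = \<zero>\<^bsub>F\<^esub>}"
  have Eg: "E i g = (if i \<in> J then \<zeta> [^]\<^bsub>F\<^esub> i \<otimes>\<^bsub>F\<^esub> \<alpha> else \<one>\<^bsub>F\<^esub>)" for i
  proof (cases "E i h = \<zero>\<^bsub>F\<^esub>")
    case True
    then have "E i e = \<zero>\<^bsub>F\<^esub>" by (simp add: e)
    then show ?thesis using True conjugate_closed[of i] unfolding g(2) J_def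
      by (simp add: F.minus_eq conjugate_def)
  next
    case False
    then have "E i e = \<one>\<^bsub>F\<^esub>" by (simp add: e)
    then show ?thesis using False conjugate_closed[of i] unfolding g(2) J_def
      by (simp add: F.minus_eq F.r_neg conjugate_def)
  qed
  then have nz: "E i g \<noteq> \<zero>\<^bsub>F\<^esub>" for i
    using conjugate_nonzero[of i] F.one_not_zero by (simp add: conjugate_def)
  obtain m :: nat where m: "rprod F r (\<lambda>i. E i g) = \<zeta> [^]\<^bsub>F\<^esub> m \<otimes>\<^bsub>F\<^esub> \<alpha> [^]\<^bsub>F\<^esub> card {i \<in> J. i < r}"
    using F.rprod_conjugates[OF \<zeta>_facts(1) \<alpha>(1) Eg] by blast
  have "{i \<in> J. i < r} \<noteq> {}" "{i \<in> J. i < r} \<subset> {..<r}" using j j' by (auto simp: J_def)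
  moreover from this(2) have "card {i \<in> J. i < r} < card {..<r}" by (intro psubset_card_mono) auto
  ultimately have k: "0 < card {i \<in> J. i < r}" "card {i \<in> J. i < r} < r"
    by (auto simp: card_gt_0_iff)
  have "split_code fadd fmul l q r b z (p - 1) h = norm_code fadd fmul l q r b z g"
    by (simp only: split_code_def g_def e_def)
  then show ?thesis
    by (intro that[of "card {i \<in> J. i < r}" m]) (use k m E_norm[OF g(1) nz] in simp_all)
qed

text \<open>With u inverse to k modulo r, (\<zeta>^m \<alpha>^k)^u is a conjugate of \<alpha> times
  a power of \<beta>, which can be divided out because \<beta> is known.\<close>

lemma candidates_complete:
  assumes n: "n < q" "dec n = \<zeta> [^]\<^bsub>F\<^esub> (m::nat) \<otimes>\<^bsub>F\<^esub> \<alpha> [^]\<^bsub>F\<^esub> k" and k: "0 < k" "k < r"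
  shows "candidates fmul l q r b n \<noteq> 0"
proof -
  have "coprime k r" using k prime_r by (metis coprime_commute nat_dvd_not_less prime_imp_coprime_nat)
  then obtain x where "[k * x = Suc 0] (mod r)" using cong_solve_coprime_nat by blast
  define u where "u = x mod r"
  have u: "u < r" using r_bounds by (simp add: u_def)
  define v where "v = k * u div r"
  have "[k * u = 1] (mod r)"
    using \<open>[k * x = Suc 0] (mod r)\<close> unfolding u_def cong_def by (simp add: mod_mult_right_eq)
  then have "k * u mod r = 1" using r_bounds by (simp add: cong_def)
  then have ku: "k * u = 1 + v * r" unfolding v_def by (metis add.commute div_mult_mod_eq)
  \<comment> \<open>This keeps \<open>v\<close> below \<open>r\<close>, within the range that is
    searched.\<close>
  have "k * u < r * r" using k u by (simp add: mult_strict_mono)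
  then have v: "v < r" unfolding v_def by (simp add: less_mult_imp_div_less)
  have ul: "u < 2 ^ l" "v < 2 ^ l" "q - 2 < 2 ^ l" using u v r_bounds q_less by auto
  define c where "c = candidate fmul l q b n u v"
  note R = fq.repeated_squaring_correct
  have inv_\<beta>: "\<beta> \<otimes>\<^bsub>F\<^esub> \<beta> [^]\<^bsub>F\<^esub> (q - 2) = \<one>\<^bsub>F\<^esub>"
  proof -
    have "\<beta> [^]\<^bsub>F\<^esub> Suc (q - 2) = \<one>\<^bsub>F\<^esub>"
      using F_pow[OF fq.code_closed[OF b(1)] b(2)] q_gt_1 by (simp add: Suc_diff_Suc numeral_2_eq_2 del: F.nat_pow_Suc)
    then show ?thesis using fq.code_closed[OF b(1)] by (simp add: F.m_comm)
  qed
  note cl = \<zeta>_facts(1) \<alpha>(1) fq.code_closed[OF b(1)]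
  have "dec c = dec n [^]\<^bsub>F\<^esub> u \<otimes>\<^bsub>F\<^esub> (\<beta> [^]\<^bsub>F\<^esub> (q - 2)) [^]\<^bsub>F\<^esub> v"
    unfolding c_def candidate_def
    using R[OF n(1) ul(1)] R[OF b(1) ul(3)] R[OF R(1)[OF b(1) ul(3)] ul(2)] by (simp add: fq.code_mu)
  also have "dec n [^]\<^bsub>F\<^esub> u = \<zeta> [^]\<^bsub>F\<^esub> (m * u) \<otimes>\<^bsub>F\<^esub> \<alpha> [^]\<^bsub>F\<^esub> (k * u)"
    using cl by (simp add: n(2) F.nat_pow_distrib F.nat_pow_pow)
  also have "\<alpha> [^]\<^bsub>F\<^esub> (k * u) = \<alpha> \<otimes>\<^bsub>F\<^esub> \<beta> [^]\<^bsub>F\<^esub> v"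
  proof -
    have "\<alpha> [^]\<^bsub>F\<^esub> (k * u) = \<alpha> [^]\<^bsub>F\<^esub> (1::nat) \<otimes>\<^bsub>F\<^esub> \<alpha> [^]\<^bsub>F\<^esub> (r * v)"
      unfolding ku using cl by (simp only: F.nat_pow_mult mult.commute)
    also have "\<alpha> [^]\<^bsub>F\<^esub> (r * v) = \<beta> [^]\<^bsub>F\<^esub> v" using cl \<alpha>(2) by (simp add: F.nat_pow_pow[symmetric])
    finally show ?thesis using cl by simp
  qed
  also have "\<zeta> [^]\<^bsub>F\<^esub> (m * u) \<otimes>\<^bsub>F\<^esub> (\<alpha> \<otimes>\<^bsub>F\<^esub> \<beta> [^]\<^bsub>F\<^esub> v) \<otimes>\<^bsub>F\<^esub> (\<beta> [^]\<^bsub>F\<^esub> (q - 2)) [^]\<^bsub>F\<^esub> v =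
      \<zeta> [^]\<^bsub>F\<^esub> (m * u) \<otimes>\<^bsub>F\<^esub> \<alpha> \<otimes>\<^bsub>F\<^esub> (\<beta> \<otimes>\<^bsub>F\<^esub> \<beta> [^]\<^bsub>F\<^esub> (q - 2)) [^]\<^bsub>F\<^esub> v"
    using cl by (simp add: F.nat_pow_distrib F.m_assoc)
  also have "\<dots> = conjugate (m * u)" using cl by (simp add: inv_\<beta> conjugate_def)
  finally have "dec c [^]\<^bsub>F\<^esub> r = \<beta>" by (simp add: conjugate_power)
  then have "check fmul l r b c \<noteq> 0"
    unfolding c_def using candidate_less[OF n(1) u v] by (rule check_complete[rotated])
  then show ?thesis
    unfolding candidates_def c_def using u v by (intro first_nonzero[of u] first_nonzero[of v])
qed

lemma try_power_complete:
  assumes w: "w < q ^ r" and n: "n < 2 ^ l" and c: "c < q"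
    and j: "j < r" "E j w [^]\<^bsub>F\<^esub> n = dec c" and j': "j' < r" "E j' w [^]\<^bsub>F\<^esub> n \<noteq> dec c"
  shows "try_power fadd fmul l q r b z (p - 1) w n c \<noteq> 0"
proof -
  define h where "h = power_minus fadd fmul l q r b (p - 1) w n c"
  have cl: "c < q ^ r" "p - 1 < q ^ r" using c neg(1) q_le by linarith+
  have 1: "am (p - 1) c < q ^ r" "E i (am (p - 1) c) = \<ominus>\<^bsub>F\<^esub> dec c" for i
    using E_am[OF cl(2,1)] E_const[OF neg(1)] E_const[OF c] neg(2) fq.code_closed[OF c]
    by (simp_all add: F.l_minus)
  have h: "h < q ^ r" "E i h = E i w [^]\<^bsub>F\<^esub> n \<ominus>\<^bsub>F\<^esub> dec c" for i
    using E_aa[OF _ 1(1)] E_rsa[OF w n] 1(2) by (simp_all add: h_def power_minus_def F.minus_eq)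
  have z: "E i h = \<zero>\<^bsub>F\<^esub> \<longleftrightarrow> E i w [^]\<^bsub>F\<^esub> n = dec c" for i
    using F.r_right_minus_eq[of "E i w [^]\<^bsub>F\<^esub> n" "dec c"] E_closed fq.code_closed[OF c] by (simp add: h)
  obtain m k :: nat where "split_code fadd fmul l q r b z (p - 1) h < q" "0 < k" "k < r"
    "dec (split_code fadd fmul l q r b z (p - 1) h) = \<zeta> [^]\<^bsub>F\<^esub> m \<otimes>\<^bsub>F\<^esub> \<alpha> [^]\<^bsub>F\<^esub> k"
    by (rule split_code_correct[OF h(1) j(1) _ j'(1)]) (use j j' z in auto)
  then show ?thesis unfolding try_power_def h_def[symmetric] by (intro candidates_complete)
qed

end

context radical_root
begin

lemma conjugate_distinct: "conjugate (Suc j) \<noteq> conjugate j"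
proof
  assume "conjugate (Suc j) = conjugate j"
  then have "\<zeta> \<otimes>\<^bsub>F\<^esub> conjugate j = \<one>\<^bsub>F\<^esub> \<otimes>\<^bsub>F\<^esub> conjugate j"
    using \<zeta>_facts(1) \<alpha>(1) by (simp add: conjugate_def F.m_ac)
  then have "\<zeta> = \<one>\<^bsub>F\<^esub>"
    using F.m_rcancel[OF conjugate_nonzero[of j] conjugate_closed[of j] \<zeta>_facts(1) F.one_closed] by simp
  then show False using \<zeta>_facts(1) \<zeta>_facts(3)[of 1] r_bounds by simp
qed

text \<open>Put v = 1/(a - \<theta>_1) and e_j = \<theta>_1 - \<theta>_j. Then (a - \<theta>_j) v =
  1 + e_j v, so u(\<alpha>) equals (1 + e_0 v)(1 + e_2 v). Both e_0 and e_2 are nonzero since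
  consecutive conjugates differ; \<theta>_0 and \<theta>_2 may coincide, as they do for r =
  2.\<close>

lemma exists_good_shift:
  fixes t :: nat
  assumes A: "A \<subseteq> carrier F" and t: "t > 0" and card: "2 * t < card A"
    and ne: "\<And>a j. a \<in> A \<Longrightarrow> a \<noteq> conjugate j"
  shows "\<exists>a\<in>A. (((a \<ominus>\<^bsub>F\<^esub> conjugate 0) \<otimes>\<^bsub>F\<^esub> inv\<^bsub>mult_of F\<^esub> (a \<ominus>\<^bsub>F\<^esub> conjugate 1)) \<otimes>\<^bsub>F\<^esub>
      inv\<^bsub>mult_of F\<^esub> ((a \<ominus>\<^bsub>F\<^esub> conjugate 1) \<otimes>\<^bsub>F\<^esub> inv\<^bsub>mult_of F\<^esub> (a \<ominus>\<^bsub>F\<^esub> conjugate 2))) [^]\<^bsub>F\<^esub> t \<noteq> \<one>\<^bsub>F\<^esub>"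
    (is "\<exists>a\<in>A. ?P a")
proof (rule ccontr)
  interpret M: comm_group "mult_of F" by (rule F.units_comm_group[unfolded F.mult_of_is_Units[symmetric]])
  define B where "B = (\<lambda>a j. a \<ominus>\<^bsub>F\<^esub> conjugate j)"
  define v where "v = (\<lambda>a. inv\<^bsub>mult_of F\<^esub> (B a 1))"
  define e where "e = (\<lambda>j. conjugate 1 \<ominus>\<^bsub>F\<^esub> conjugate j)"
  assume "\<not> (\<exists>a\<in>A. ?P a)"
  then have U: "((B a 0 \<otimes>\<^bsub>F\<^esub> v a) \<otimes>\<^bsub>F\<^esub> inv\<^bsub>mult_of F\<^esub> (B a 1 \<otimes>\<^bsub>F\<^esub> inv\<^bsub>mult_of F\<^esub> (B a 2))) [^]\<^bsub>F\<^esub> t = \<one>\<^bsub>F\<^esub>"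
    if "a \<in> A" for a using that unfolding B_def v_def by blast
  have B: "B a j \<in> carrier (mult_of F)" if "a \<in> A" for a j
    using that ne[OF that, of j] A conjugate_closed[of j] F.r_right_minus_eq[of a "conjugate j"] by (auto simp: B_def)
  have v: "v a \<in> carrier (mult_of F)" "B a 1 \<otimes>\<^bsub>F\<^esub> v a = \<one>\<^bsub>F\<^esub>" if "a \<in> A" for a
    using M.inv_closed[OF B[OF that, of 1]] M.r_inv[OF B[OF that, of 1]] by (simp_all add: v_def)
  have e: "e j \<in> carrier F" for j using conjugate_closed by (simp add: e_def)
  have e_ne: "e 0 \<noteq> \<zero>\<^bsub>F\<^esub>" "e 2 \<noteq> \<zero>\<^bsub>F\<^esub>"
    using F.r_right_minus_eq[OF conjugate_closed[of 1] conjugate_closed] conjugate_distinct[of 0] conjugate_distinct[of 1]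
    by (auto simp: e_def numeral_2_eq_2)
  have Bv: "B a j \<otimes>\<^bsub>F\<^esub> v a = \<one>\<^bsub>F\<^esub> \<oplus>\<^bsub>F\<^esub> e j \<otimes>\<^bsub>F\<^esub> v a" if a: "a \<in> A" for a j
  proof -
    have cl: "a \<in> carrier F" "B a 1 \<in> carrier F" "v a \<in> carrier F" using a A B[OF a, of 1] v(1)[OF a] by auto
    have "B a j = B a 1 \<oplus>\<^bsub>F\<^esub> e j"
      using cl conjugate_closed by (simp add: B_def e_def F.minus_eq F.a_assoc F.r_neg1)
    then show ?thesis using cl e v(2)[OF a] by (simp add: F.l_distr)
  qed
  have "card A \<le> 2 * t"
  proof (rule fiber_bound[OF _ e e e_ne t, of A v])
    show "finite A" using A finite_F by (rule finite_subset)
    show "v a \<in> carrier F" if "a \<in> A" for a using v(1)[OF that] by simp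
    show "inj_on v A"
    proof (rule inj_onI)
      fix x y assume xy: "x \<in> A" "y \<in> A" "v x = v y"
      then have "B x 1 = B y 1" using B unfolding v_def by (metis M.inv_inv)
      then show "x = y"
        using A xy conjugate_closed[of 1] unfolding B_def F.minus_eq by (simp add: subset_iff F.add.right_cancel)
    qed
    fix a assume a: "a \<in> A"
    have "inv\<^bsub>mult_of F\<^esub> (B a 1 \<otimes>\<^bsub>F\<^esub> inv\<^bsub>mult_of F\<^esub> (B a 2)) = v a \<otimes>\<^bsub>F\<^esub> B a 2"
      using M.inv_mult[OF B[OF a, of 1] M.inv_closed[OF B[OF a, of 2]]] M.inv_inv[OF B[OF a, of 2]] by (simp add: v_def)
    also have "\<dots> = B a 2 \<otimes>\<^bsub>F\<^esub> v a" using M.m_comm[OF v(1)[OF a] B[OF a, of 2]] by simp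
    finally show "((\<one>\<^bsub>F\<^esub> \<oplus>\<^bsub>F\<^esub> e 0 \<otimes>\<^bsub>F\<^esub> v a) \<otimes>\<^bsub>F\<^esub> (\<one>\<^bsub>F\<^esub> \<oplus>\<^bsub>F\<^esub> e 2 \<otimes>\<^bsub>F\<^esub> v a)) [^]\<^bsub>F\<^esub> t = \<one>\<^bsub>F\<^esub>"
      using U[OF a] Bv[OF a, of 0] Bv[OF a, of 2] by simp
  qed
  then show False using card by simp
qed

lemma try_powers_complete:
  assumes s: "prime s" "s \<le> T" "s ^ i dvd q - 1"
    and om: "om s 0 < q" "primitive_root_of_unity F (root_of_unity_order s) (dec (om s 0))"
    and k: "k < root_of_unity_order s" and w: "w < q ^ r"
    and j: "j < r" "E j w [^]\<^bsub>F\<^esub> ((q - 1) div s ^ i) = dec (om s 0) [^]\<^bsub>F\<^esub> k"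
    and j': "j' < r" "E j' w [^]\<^bsub>F\<^esub> ((q - 1) div s ^ i) \<noteq> dec (om s 0) [^]\<^bsub>F\<^esub> k"
  shows "try_powers fadd fmul l q r b z (p - 1) T om w \<noteq> 0"
proof -
  have "2 ^ i \<le> s ^ i" using s(1) prime_ge_2_nat by (intro power_mono) auto
  also have "\<dots> \<le> q - 1" using s(3) q_gt_1 by (intro dvd_imp_le) auto
  also have "\<dots> < 2 ^ l" using q_less by simp
  finally have i: "i < l + 1" by simp
  have k': "k < T + 3" using k s(2) by (auto simp: root_of_unity_order_def split: if_splits)
  let ?o = "dec (om s 0)"
  have o: "?o \<in> carrier F" "?o [^]\<^bsub>F\<^esub> root_of_unity_order s = \<one>\<^bsub>F\<^esub>" "root_of_unity_order s > 0"
    "\<And>i. 0 < i \<Longrightarrow> i < root_of_unity_order s \<Longrightarrow> ?o [^]\<^bsub>F\<^esub> i \<noteq> \<one>\<^bsub>F\<^esub>"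
    using om(2) unfolding primitive_root_of_unity_def by auto
  have "?o \<noteq> \<zero>\<^bsub>F\<^esub>" using o(2,3) F_pow_0[of "root_of_unity_order s"] F.one_not_zero by auto
  then have "?o [^]\<^bsub>F\<^esub> (q - 1) = \<one>\<^bsub>F\<^esub>" by (rule F_pow[OF o(1)])
  then have "root_of_unity_order s \<le> q - 1" using o(4)[of "q - 1"] q_gt_1 by (cases "root_of_unity_order s \<le> q - 1") auto
  then have kl: "k < 2 ^ l" using k q_less by linarith
  note rs = fq.repeated_squaring_correct[OF om(1) kl]
  have n: "(q - 1) div s ^ i < 2 ^ l" using q_less by (meson div_le_dividend diff_le_self le_less_trans)
  have "try_power fadd fmul l q r b z (p - 1) w ((q - 1) div s ^ i) (rsf (om s 0) k) \<noteq> 0"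
    by (rule try_power_complete[OF w n rs(1) j(1) _ j'(1)]) (use j(2) j'(2) rs(2) in auto)
  then show ?thesis
    unfolding try_powers_def using s(2) i k'
    by (intro first_nonzero[of s] first_nonzero[of i] first_nonzero[of k]) auto
qed

lemma find_root_complete:
  fixes t T :: nat and P :: "nat set"
  assumes t: "t > 0" "t \<le> T"
    and P: "\<And>s. prime s \<Longrightarrow> s \<notin> P \<Longrightarrow> multiplicity s (q - 1) = multiplicity s t" "\<And>s. s \<in> P \<Longrightarrow> s \<le> T"
    and om: "\<And>s. s \<in> P \<Longrightarrow> om s 0 < q \<and> primitive_root_of_unity F (root_of_unity_order s) (dec (om s 0))"
  shows "find_root fadd fmul l q r z (p - 1) T b om \<noteq> 0"
proof -
  let ?t = "\<lambda>a. try_shift fadd fmul l q r b z (p - 1) T om (a mod q)"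
  have found: "find_root fadd fmul l q r z (p - 1) T b om \<noteq> 0" if "a < 2 * T + 1" "?t a \<noteq> 0" for a
    unfolding find_root_def by (rule first_nonzero[of a]) (use that in auto)
  have modq: "a mod q < q" for a using q_gt_1 by (intro mod_less_divisor) simp
  show ?thesis
  proof (cases "\<exists>a<2 * T + 1. dec (a mod q) [^]\<^bsub>F\<^esub> r = \<beta>")
    case True
    then obtain a where a: "a < 2 * T + 1" "dec (a mod q) [^]\<^bsub>F\<^esub> r = \<beta>" by blast
    have "check fmul l r b (a mod q) \<noteq> 0" by (rule check_complete[OF modq a(2)])
    then show ?thesis by (intro found[OF a(1)]) (simp add: try_shift_def)
  next
    case False
    \<comment> \<open>In a field of at most \<open>2 * T + 1\<close> elements \<alpha> itself would
      have been among the shifts.\<close>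
    have large: "2 * T + 1 < q"
    proof (rule ccontr)
      assume "\<not> 2 * T + 1 < q"
      moreover have "encode_poly p \<alpha> < q" by (rule carrier_coded[OF \<alpha>(1)])
      ultimately have "encode_poly p \<alpha> < 2 * T + 1" "dec (encode_poly p \<alpha> mod q) [^]\<^bsub>F\<^esub> r = \<beta>"
        using carrier_coded[OF \<alpha>(1)] \<alpha>(2) by auto
      then show False using False by blast
    qed
    define A where "A = dec ` {..<2 * T + 1}"
    have "card A = 2 * T + 1"
      unfolding A_def using large dec_inj by (subst card_image) (auto intro!: inj_onI)
    then have card: "2 * t < card A" using t(2) by simp
    have A: "A \<subseteq> carrier F" unfolding A_def using large by (auto intro!: fq.code_closed)
    have neA: "x \<noteq> conjugate j" if xA: "x \<in> A" for x j
    proof -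
      obtain a where a: "a < 2 * T + 1" "x = dec a"
        using xA unfolding A_def by (elim imageE) (simp only: lessThan_iff)
      then have "dec a [^]\<^bsub>F\<^esub> r \<noteq> \<beta>" using False large by auto
      then show ?thesis using conjugate_power a by metis
    qed
    obtain x where x: "x \<in> A" and U0: "(((x \<ominus>\<^bsub>F\<^esub> conjugate 0) \<otimes>\<^bsub>F\<^esub> inv\<^bsub>mult_of F\<^esub> (x \<ominus>\<^bsub>F\<^esub> conjugate 1)) \<otimes>\<^bsub>F\<^esub>
      inv\<^bsub>mult_of F\<^esub> ((x \<ominus>\<^bsub>F\<^esub> conjugate 1) \<otimes>\<^bsub>F\<^esub> inv\<^bsub>mult_of F\<^esub> (x \<ominus>\<^bsub>F\<^esub> conjugate 2))) [^]\<^bsub>F\<^esub> t \<noteq> \<one>\<^bsub>F\<^esub>"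
      using exists_good_shift[OF A t(1) card neA] by blast
    obtain a where a: "a < 2 * T + 1" "x = dec a"
      using x unfolding A_def by (elim imageE) (simp only: lessThan_iff)
    have aq: "a < q" using a large by simp
    interpret M: comm_group "mult_of F" by (rule F.units_comm_group[unfolded F.mult_of_is_Units[symmetric]])
    define B where "B = (\<lambda>j. x \<ominus>\<^bsub>F\<^esub> conjugate j)"
    have B: "B j \<in> carrier F" "B j \<noteq> \<zero>\<^bsub>F\<^esub>" for j
      using neA[OF x, of j] A x conjugate_closed[of j] F.r_right_minus_eq[of x "conjugate j"] by (auto simp: B_def)
    define Y where "Y = (\<lambda>j. B j \<otimes>\<^bsub>mult_of F\<^esub> inv\<^bsub>mult_of F\<^esub> (B (Suc j)))"
    define U where "U = (\<lambda>j. Y j \<otimes>\<^bsub>mult_of F\<^esub> inv\<^bsub>mult_of F\<^esub> (Y (Suc j)))"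
    have Y: "Y j \<in> carrier F" "Y j \<noteq> \<zero>\<^bsub>F\<^esub>" for j
    proof -
      have "Y j \<in> carrier (mult_of F)" unfolding Y_def using B by (intro M.m_closed M.inv_closed) auto
      then show "Y j \<in> carrier F" "Y j \<noteq> \<zero>\<^bsub>F\<^esub>" by auto
    qed
    define h where "h = a + (p - 1) * q"
    define y where "y = shift_quotient fadd fmul l q r b z h"
    define u where "u = shift_quotient fadd fmul l q r b z y"
    have h: "h < q ^ r" "E j h = B j" for j
      unfolding h_def B_def a(2) by (rule linear_less[OF aq], rule E_linear[OF aq])
    have y: "y < q ^ r" "E j y = Y j" for j
      using E_shift_quotient[OF h(1)] F_inv[OF B] unfolding y_def Y_def h(2) by simp_all
    have u: "u < q ^ r" "E j u = U j" for j
      using E_shift_quotient[OF y(1)] F_inv[OF Y] unfolding u_def U_def y(2) by simp_all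
    obtain s i k W j j' where *: "s \<in> P" "prime s" "s ^ i dvd q - 1" "k < root_of_unity_order s"
      "W = Y \<or> W = U" "j < r" "j' < r"
      "W j [^]\<^bsub>mult_of F\<^esub> ((q - 1) div s ^ i) = dec (om s 0) [^]\<^bsub>mult_of F\<^esub> k"
      "W j' [^]\<^bsub>mult_of F\<^esub> ((q - 1) div s ^ i) \<noteq> dec (om s 0) [^]\<^bsub>mult_of F\<^esub> k"
    proof (rule M.splitting_power[of Y B U "q - 1" r t P root_of_unity_order "\<lambda>s. dec (om s 0)"])
      show "Y j = B j \<otimes>\<^bsub>mult_of F\<^esub> inv\<^bsub>mult_of F\<^esub> (B (Suc j))"
        "U j = Y j \<otimes>\<^bsub>mult_of F\<^esub> inv\<^bsub>mult_of F\<^esub> (Y (Suc j))" for j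
        by (simp_all only: Y_def U_def)
      show "0 < q - 1" using q_gt_1 by simp
      show "c [^]\<^bsub>mult_of F\<^esub> (q - 1) = \<one>\<^bsub>mult_of F\<^esub>" if "c \<in> carrier (mult_of F)" for c
        using that F_pow[of c] by (simp add: nat_pow_mult_of)
      show "B j \<in> carrier (mult_of F)" for j using B by simp
      show "B (j + r) = B j" for j by (simp add: B_def conjugate_periodic)
      show "\<exists>k<root_of_unity_order s. c = dec (om s 0) [^]\<^bsub>mult_of F\<^esub> k"
        if "s \<in> P" "c \<in> carrier (mult_of F)" "c [^]\<^bsub>mult_of F\<^esub> root_of_unity_order s = \<one>\<^bsub>mult_of F\<^esub>" for s c
        using F.primitive_root_power[OF finite_F, of "root_of_unity_order s" "dec (om s 0)" c] that om
        by (auto simp: nat_pow_mult_of)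
      show "U 0 [^]\<^bsub>mult_of F\<^esub> t \<noteq> \<one>\<^bsub>mult_of F\<^esub>"
        using U0 by (simp add: nat_pow_mult_of U_def Y_def B_def numeral_2_eq_2)
    qed (use prime_r t P in \<open>auto simp: root_of_unity_order_def\<close>)
    define w where "w = (if W = Y then y else u)"
    have w: "w < q ^ r" "E i w = W i" for i using *(5) y u by (auto simp: w_def)
    have "try_powers fadd fmul l q r b z (p - 1) T om w \<noteq> 0"
      using * P(2)[OF *(1)] om[OF *(1)] w
      by (intro try_powers_complete[of s T i om k w j j']) (auto simp: nat_pow_mult_of)
    then have "try_powers fadd fmul l q r b z (p - 1) T om y \<noteq> 0 \<or> try_powers fadd fmul l q r b z (p - 1) T om u \<noteq> 0"
      by (auto simp: w_def split: if_splits)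
    then have "?t a \<noteq> 0"
      unfolding try_shift_def mod_less[OF aq] h_def[symmetric] y_def[symmetric] u_def[symmetric] by auto
    then show ?thesis by (rule found[OF a(1)])
  qed
qed

end

section \<open>Unknown primes and nonresidues\<close>

definition field_add :: "nat \<Rightarrow> nat \<Rightarrow> nat \<Rightarrow> nat \<Rightarrow> nat" where
  "field_add p d = ext_add (\<lambda>a b. (a + b) mod p) p d"

definition reduction_code :: "nat \<Rightarrow> nat \<Rightarrow> nat \<Rightarrow> nat" where
  "reduction_code p d c = tab d p (\<lambda>j. (p - dig p c j) mod p)"

definition field_mul :: "nat \<Rightarrow> nat \<Rightarrow> nat \<Rightarrow> nat \<Rightarrow> nat \<Rightarrow> nat" where
  "field_mul p d c = ext_mul (\<lambda>a b. (a + b) mod p) (\<lambda>a b. (a * b) mod p) p d (reduction_code p d c)"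

text \<open>The output of \<open>prog\<close> on \<open>[p, d, c, s]\<close>, if it halts within \<open>w\<close> steps, and an arbitrary
  field element otherwise: whether \<open>s\<close> is one of the primes for which \<open>prog\<close> has to work is unknown.\<close>

definition guess :: "nat \<Rightarrow> program \<Rightarrow> nat \<Rightarrow> nat \<Rightarrow> nat \<Rightarrow> nat \<Rightarrow> nat \<Rightarrow> nat" where
  "guess k prog w p d c s = dig (2 ^ w) (clocked k w (2 ^ w) prog (tab k (2 ^ w) (\<lambda>j.
     if j = 0 then p else if j = 1 then d else if j = 2 then c else if j = 3 then s else 0))) 0 mod p ^ d"

text \<open>For r = 2 the given root of unity has order 4, so it is squared.\<close>

definition unity_root :: "nat \<Rightarrow> program \<Rightarrow> nat \<Rightarrow> nat \<Rightarrow> nat \<Rightarrow> nat \<Rightarrow> nat \<Rightarrow> nat" where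
  "unity_root k prog w p d c r =
     (if r = 2 then field_mul p d c (guess k prog w p d c 2) (guess k prog w p d c 2) else guess k prog w p d c r)"

definition radical_of :: "nat \<Rightarrow> program \<Rightarrow> nat \<Rightarrow> nat \<Rightarrow> nat \<Rightarrow> nat \<Rightarrow> nat \<Rightarrow> nat \<Rightarrow> nat \<Rightarrow> nat" where
  "radical_of k prog w t p d c r b = find_root (field_add p d) (field_mul p d c) (bits (p ^ d)) (p ^ d) r
     (unity_root k prog w p d c r) (p - 1) t b (\<lambda>s _. guess k prog w p d c s)"

lemma polytime_field_ops:
  assumes p: "polytime C p" and d: "unary C d" and c: "polytime C c"
  shows "polytime_op C (\<lambda>xs. field_add (p xs) (d xs))"
    and "polytime_op C (\<lambda>xs. field_mul (p xs) (d xs) (c xs))"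
    and "bounded_op C (\<lambda>xs. field_mul (p xs) (d xs) (c xs))"
proof -
  have 1: "polytime_op C (\<lambda>xs a b. (a + b) mod p xs)"
    unfolding polytime_op_def by (intro allI impI polytime_mod polytime_add descends_lift[OF _ p])
  have 2: "polytime_op C (\<lambda>xs a b. (a * b) mod p xs)"
    unfolding polytime_op_def by (intro allI impI polytime_mod polytime_mult descends_lift[OF _ p])
  have 3: "polytime C (\<lambda>xs. reduction_code (p xs) (d xs) (c xs))"
    unfolding reduction_code_def
  proof (intro polytime_tab d p)
    fix C' assume C': "extends C d C'" "unary C' hd"
    show "polytime C' (\<lambda>ys. (p (tl ys) - dig (p (tl ys)) (c (tl ys)) (hd ys)) mod p (tl ys))"
      by (intro polytime_mod polytime_diff polytime_dig C'(2) polytime_lift[OF C'(1) p] polytime_lift[OF C'(1) c])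
  qed
  show "polytime_op C (\<lambda>xs. field_add (p xs) (d xs))"
    unfolding field_add_def by (intro polytime_op_ext_add 1 p d)
  show "polytime_op C (\<lambda>xs. field_mul (p xs) (d xs) (c xs))"
    unfolding field_mul_def by (intro polytime_op_ext_mul 1 2 3 p d)
  show "bounded_op C (\<lambda>xs. field_mul (p xs) (d xs) (c xs))"
    unfolding field_mul_def by (intro bounded_op_ext_mul p d)
qed

lemma polytime_guess:
  assumes w: "unary C w" and p: "polytime C p" and d: "unary C d" and c: "polytime C c" and s: "polytime C s"
  shows "polytime C (\<lambda>xs. guess k prog (w xs) (p xs) (d xs) (c xs) (s xs))"
  unfolding guess_def
proof (intro polytime_mod polytime_dig polytime_clocked polytime_tab polytime_power polytime_const unary_const w p d)
  fix C' :: ctx assume C': "extends C (\<lambda>_. k) C'" "unary C' hd"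
  note lift = polytime_lift[OF C'(1)]
  show "polytime C' (\<lambda>ys. if hd ys = 0 then p (tl ys) else if hd ys = 1 then d (tl ys)
      else if hd ys = 2 then c (tl ys) else if hd ys = 3 then s (tl ys) else 0)"
    by (intro polytime_if_eq polytime_const unaryD(1)[OF C'(2)] lift[OF p] lift[OF c] lift[OF s] lift[OF unaryD(1)[OF d]])
qed

lemma polytime_unity_root:
  assumes "unary C w" "polytime C p" "unary C d" "polytime C c" "unary C r"
  shows "polytime C (\<lambda>xs. unity_root k prog (w xs) (p xs) (d xs) (c xs) (r xs))"
  unfolding unity_root_def
  by (intro polytime_if_eq polytime_op_apply[OF polytime_field_ops(2)] polytime_guess polytime_const
      unaryD(1)[OF assms(5)] assms)

lemma polytime_radical_of:
  assumes w: "unary C w" and t: "unary C t" and p: "polytime C p" and d: "unary C d" and c: "polytime C c"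
    and r: "unary C r" and b: "polytime C b"
  shows "polytime C (\<lambda>xs. radical_of k prog (w xs) (t xs) (p xs) (d xs) (c xs) (r xs) (b xs))"
proof -
  interpret algebra_ctx C "\<lambda>xs. field_add (p xs) (d xs)" "\<lambda>xs. field_mul (p xs) (d xs) (c xs)"
    "\<lambda>xs. bits (p xs ^ d xs)" "\<lambda>xs. p xs ^ d xs" r b
    "\<lambda>xs. unity_root k prog (w xs) (p xs) (d xs) (c xs) (r xs)" "\<lambda>xs. p xs - 1"
    by unfold_locales (intro polytime_field_ops[OF p d c] unary_bits polytime_power polytime_unity_root polytime_diff
        polytime_const w p d c r b)+
  have "polytime_op C (\<lambda>xs s _. guess k prog (w xs) (p xs) (d xs) (c xs) s)"
    unfolding polytime_op_def
    by (intro allI impI polytime_guess descends_lift[OF _ p] descends_lift[OF _ c] descends_lift_unary[OF _ w]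
        descends_lift_unary[OF _ d])
  then show ?thesis unfolding radical_of_def by (rule polytime_find_root[OF t])
qed

section \<open>From functions on instances to search problems\<close>

lemma poly_bounded_real:
  assumes "poly_bounded I S T" and S: "\<And>i. i \<in> I \<Longrightarrow> real (S i) + 2 \<le> c * sz i" and "c \<ge> 0"
  shows "\<exists>(C::real) (d::nat). \<forall>i\<in>I. real (T i) \<le> C * sz i ^ d"
proof -
  obtain k where k: "\<forall>i\<in>I. T i \<le> (S i + 2) ^ k" using assms(1) unfolding poly_bounded_def by blast
  have "real (T i) \<le> c ^ k * sz i ^ k" if "i \<in> I" for i
  proof -
    have "real (T i) \<le> real ((S i + 2) ^ k)" using k that by (simp only: of_nat_le_iff)
    also have "\<dots> = (real (S i) + 2) ^ k" by (simp add: add.commute)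
    also have "\<dots> \<le> (c * sz i) ^ k" using S[OF that] by (intro power_mono) auto
    finally show ?thesis by (simp add: power_mult_distrib)
  qed
  then show ?thesis by blast
qed

text \<open>The inputs occupy the registers below \<open>k\<close>, so the program is compiled at
  \<open>k\<close> and its result is finally copied to register 0.\<close>

lemma polytime_solvableI:
  assumes f: "polytime (enc ` I, S, (\<lambda>j. (j, \<lambda>xs. xs ! j)) ` {..<k}) f"
    and len: "\<And>i. i \<in> I \<Longrightarrow> length (enc i) = k"
    and sol: "\<And>i. i \<in> I \<Longrightarrow> f (enc i) \<in> sol i"
    and S: "\<And>i. i \<in> I \<Longrightarrow> real (S (enc i)) + 2 \<le> c * sz i" and c: "c \<ge> 0"
  shows "polytime_solvable I enc sz sol"
proof -
  let ?C = "(enc ` I, S, (\<lambda>j. (j, \<lambda>xs. xs ! j)) ` {..<k}) :: ctx"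
  have C: "insts ?C = enc ` I" "size_of ?C = S" "stored ?C = (\<lambda>j. (j, \<lambda>xs. xs ! j)) ` {..<k}"
    by (simp_all add: insts_def size_of_def stored_def)
  have "below ?C k" unfolding below_def C by auto
  with f obtain prog T where T: "pbd ?C T" "runs ?C k prog T f" by (rule polytimeE)
  define W where "W = (\<lambda>xs. T xs + (2 + bits (f xs) + bits (f xs)))"
  have "pbd ?C W"
    unfolding W_def by (intro poly_bounded_add poly_bounded_const T polytime_bits[OF f])
  then have "poly_bounded (enc ` I) S W" unfolding C .
  then have "poly_bounded I (\<lambda>i. S (enc i)) (\<lambda>i. W (enc i))"
    unfolding poly_bounded_def by blast
  then have "\<exists>(A::real) (d::nat). \<forall>i\<in>I. real (W (enc i)) \<le> A * sz i ^ d"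
    by (rule poly_bounded_real[OF _ S c])
  then obtain A :: real and d :: nat where W: "\<forall>i\<in>I. real (W (enc i)) \<le> A * sz i ^ d"
    by blast
  have "\<exists>n s. exec (Seq prog (Assign 0 (Reg k))) (input (enc i)) n s \<and> real n \<le> A * sz i ^ d \<and> s 0 \<in> sol i"
    if i: "i \<in> I" for i
  proof -
    have mt: "matches ?C (enc i) (input (enc i))"
      unfolding matches_def C using len[OF i] by (auto simp: input_def)
    have "enc i \<in> insts ?C" using i C by simp
    from runsE[OF T(2) this mt] obtain n s where
      1: "exec prog (input (enc i)) n s" "s k = f (enc i)" "n \<le> T (enc i)"
      by metis
    let ?m = "1 + acost (Reg k) s + bits (aval (Reg k) s)"
    have "exec (Seq prog (Assign 0 (Reg k))) (input (enc i)) (n + ?m) (s(0 := aval (Reg k) s))"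
      by (rule exec.Seq[OF 1(1) exec.Assign])
    moreover have "n + ?m \<le> W (enc i)" using 1(2,3) by (simp add: W_def)
    then have "real (n + ?m) \<le> A * sz i ^ d" using W i by (meson of_nat_mono order_trans)
    moreover have "(s(0 := aval (Reg k) s)) 0 \<in> sol i" using 1(2) sol[OF i] by simp
    ultimately show ?thesis by blast
  qed
  then show ?thesis unfolding polytime_solvable_def by blast
qed

lemma bits_log:
  assumes "q \<ge> 2"
  shows "log 2 (real q) \<le> real (bits q)" "real (bits q) \<le> log 2 (real q) + 1" "1 \<le> log 2 (real q)"
proof -
  have l: "0 \<le> log 2 (real q)" "1 \<le> log 2 (real q)" using assms by (simp_all add: le_log_iff)
  have "bits q = nat \<lfloor>log 2 (real q)\<rfloor> + 1" using assms by (simp add: floorlog_def)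
  then have "real (bits q) = of_int \<lfloor>log 2 (real q)\<rfloor> + 1" using l by simp
  then show "log 2 (real q) \<le> real (bits q)" "real (bits q) \<le> log 2 (real q) + 1" by linarith+
  show "1 \<le> log 2 (real q)" by (rule l)
qed

lemma poly_log_le:
  assumes "q \<ge> 2" "real x \<le> A * log 2 (real q) ^ d"
  shows "x \<le> nat \<lceil>A\<rceil> * bits q ^ d"
proof -
  have l: "0 \<le> log 2 (real q)" using bits_log(3)[OF assms(1)] by simp
  have "real x \<le> A * log 2 (real q) ^ d" by (rule assms(2))
  also have "\<dots> \<le> real (nat \<lceil>A\<rceil>) * log 2 (real q) ^ d"
    using l by (intro mult_right_mono real_nat_ceiling_ge) auto
  also have "\<dots> \<le> real (nat \<lceil>A\<rceil>) * real (bits q) ^ d"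
    using l bits_log(1)[OF assms(1)] by (intro mult_left_mono power_mono) auto
  also have "\<dots> = real (nat \<lceil>A\<rceil> * bits q ^ d)" by simp
  finally show ?thesis by (simp only: of_nat_le_iff)
qed

context presented
begin

lemma field_add_eq: "field_add p d = fadd"
  by (simp add: field_add_def)

lemma field_mul_eq: "field_mul p d (encode_poly p f) = fmul"
  by (simp add: field_mul_def reduction_code_def low_code_def)

lemma encode_less: "(\<And>i. coeff a i \<in> {0..<int p}) \<Longrightarrow> encode_poly p a < p ^ Suc (degree a)"
proof (induction a)
  case 0
  then show ?case by (simp add: encode_poly_def)
next
  case (pCons c a)
  have a: "coeff a i \<in> {0..<int p}" for i using pCons.prems[of "Suc i"] by simp
  have c: "0 \<le> c" "c < int p" using pCons.prems[of 0] by simp_all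
  have pos: "0 \<le> poly a (int p)"
    unfolding poly_altdef using a by (intro sum_nonneg mult_nonneg_nonneg) auto
  have e: "encode_poly p (pCons c a) = nat c + p * encode_poly p a"
    unfolding encode_poly_def using c pos by (simp add: nat_add_distrib nat_mult_distrib)
  have cp: "nat c < p" using c by simp
  show ?case
  proof (cases "a = 0")
    case True
    then show ?thesis using cp by (simp add: e encode_poly_def)
  next
    case False
    have "encode_poly p a < p ^ Suc (degree a)" by (rule pCons.IH[OF a])
    then have "nat c + p * encode_poly p a < p + p * (p ^ Suc (degree a) - 1)"
      using cp by (intro add_less_le_mono mult_left_mono) auto
    also have "\<dots> = p * p ^ Suc (degree a)"
      by (metis One_nat_def Suc_leI add.commute diff_Suc_1 le_add_diff_inverse2 mult_Suc_right p_pos zero_less_power Suc_pred)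
    finally show ?thesis using False by (simp add: e)
  qed
qed

text \<open>The code of \<open>f\<close> includes its leading coefficient and has d + 1 digits, so
  it is compared with q^2 rather than q.\<close>

lemma input_bounds: "p \<le> q" "d < q" "encode_poly p f < q * q"
proof -
  show "p \<le> q" using d_pos p_gt_1 by (intro self_le_power) auto
  have "d < 2 ^ d" by simp
  also have "\<dots> \<le> q" using p_gt_1 by (intro power_mono) auto
  finally show "d < q" .
  have "encode_poly p f < p ^ Suc d" by (rule encode_less[OF coeff_f])
  also have "\<dots> \<le> q * q" using \<open>p \<le> q\<close> by simp
  finally show "encode_poly p f < q * q" .
qed

lemma d_le_bits: "d \<le> bits q"
proof -
  have "2 ^ d \<le> q" using p_gt_1 by (intro power_mono) auto
  also have "q < 2 ^ bits q" by (rule less_two_power_bits)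
  finally show ?thesis by simp
qed

lemma bits_input_bounds: "bits p \<le> bits q" "bits (encode_poly p f) \<le> bits q + bits q"
  using bits_mono[OF input_bounds(1)] bits_mono[OF less_imp_le[OF input_bounds(3)]] bits_mult_le[of q q]
  by simp_all

text \<open>The clock is also the digit width of the simulated registers. It therefore has to exceed
  the lengths of the inputs as well as the running time.\<close>

lemma guess_correct:
  assumes prog: "exec prog (input [p, d, encode_poly p f, s]) n u" "n \<le> w" "program_below k prog" "4 \<le> k"
    and w: "bits q + bits q \<le> w" "s < 2 ^ w"
    and u: "u 0 = encode_poly p x" "x \<in> carrier F"
  shows "guess k prog w p d (encode_poly p f) s < q" "dec (guess k prog w p d (encode_poly p f) s) = x"
proof -
  let ?c = "encode_poly p f"
  let ?st = "tab k (2 ^ w) (\<lambda>j. if j = 0 then p else if j = 1 then d else if j = 2 then ?c else if j = 3 then s else 0)"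
  have "q < 2 ^ bits q" by (rule less_two_power_bits)
  also have "\<dots> \<le> 2 ^ w" using w(1) by (intro power_increasing) auto
  finally have q: "q < 2 ^ w" .
  have "?c < 2 ^ (bits q + bits q)"
    using bits_input_bounds(2) bits_le_iff by blast
  also have "\<dots> \<le> 2 ^ w" using w(1) by (intro power_increasing) auto
  finally have c: "?c < 2 ^ w" .
  have st: "dig (2 ^ w) ?st j = input [p, d, ?c, s] j" if "j < k" for j
  proof -
    have i: "input [p, d, ?c, s] j = (if j = 0 then p else if j = 1 then d else if j = 2 then ?c else if j = 3 then s else 0)"
      by (auto simp: input_def nth_Cons' numeral_eq_Suc)
    show ?thesis
      unfolding i by (rule dig_tab[OF that]) (use q c w(2) input_bounds(1,2) in auto)
  qed
  have "dig (2 ^ w) (clocked k w (2 ^ w) prog ?st) 0 = u 0"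
    by (rule clocked_exec[OF prog(1,2,3) st order_refl]) (use prog(4) in auto)
  then have "guess k prog w p d ?c s = encode_poly p x"
    using u carrier_coded(1)[OF u(2)] by (simp add: guess_def)
  then show "guess k prog w p d ?c s < q" "dec (guess k prog w p d ?c s) = x"
    using carrier_coded[OF u(2)] by simp_all
qed

lemma unity_root_correct:
  assumes g: "guess k prog w p d (encode_poly p f) r < q"
    "primitive_root_of_unity F (root_of_unity_order r) (dec (guess k prog w p d (encode_poly p f) r))"
  shows "unity_root k prog w p d (encode_poly p f) r < q"
    "primitive_root_of_unity F r (dec (unity_root k prog w p d (encode_poly p f) r))"
proof -
  let ?g = "guess k prog w p d (encode_poly p f) r"
  have "unity_root k prog w p d (encode_poly p f) r < q \<and>
    primitive_root_of_unity F r (dec (unity_root k prog w p d (encode_poly p f) r))"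
  proof (cases "r = 2")
    case True
    have u: "unity_root k prog w p d (encode_poly p f) r = fmul ?g ?g"
      using True field_mul_eq by (simp add: unity_root_def)
    have x: "dec ?g \<in> carrier F" "dec ?g [^]\<^bsub>F\<^esub> (4::nat) = \<one>\<^bsub>F\<^esub>" "dec ?g [^]\<^bsub>F\<^esub> (2::nat) \<noteq> \<one>\<^bsub>F\<^esub>"
      using g(2) True unfolding primitive_root_of_unity_def by (auto simp: root_of_unity_order_def)
    have sq: "dec (fmul ?g ?g) = dec ?g [^]\<^bsub>F\<^esub> (2::nat)"
      using g(1) x(1) by (simp add: fq.code_mu numeral_2_eq_2)
    have "dec (fmul ?g ?g) [^]\<^bsub>F\<^esub> r = \<one>\<^bsub>F\<^esub>"
      unfolding sq using x(1,2) True by (simp add: F.nat_pow_pow)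
    moreover have "dec (fmul ?g ?g) [^]\<^bsub>F\<^esub> i \<noteq> \<one>\<^bsub>F\<^esub>" if "0 < i" "i < r" for i
    proof -
      have "i = 1" using that True by simp
      then show ?thesis using x sq by simp
    qed
    ultimately show ?thesis
      using g(1) True unfolding u primitive_root_of_unity_def by (simp add: fq.mu_less fq.code_closed)
  next
    case False
    then show ?thesis using g by (simp add: unity_root_def root_of_unity_order_def)
  qed
  then show "unity_root k prog w p d (encode_poly p f) r < q"
    "primitive_root_of_unity F r (dec (unity_root k prog w p d (encode_poly p f) r))" by auto
qed

text \<open>The two claims are separate because soundness also concerns codes of nonresidues, which
  the construction of nonresidues eventually meets.\<close>

lemma radical_of_correct:
  fixes k w T t r :: nat and prog :: program and P :: "nat set"
  defines "g \<equiv> guess k prog w p d (encode_poly p f)"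
  defines "rad \<equiv> radical_of k prog w T p d (encode_poly p f) r"
  assumes r: "prime r" "r dvd q - 1" "r \<in> P" and b: "b < q" "dec b \<noteq> \<zero>\<^bsub>F\<^esub>"
    and t: "t > 0" "t \<le> T"
    and P: "\<And>s. prime s \<Longrightarrow> s \<notin> P \<Longrightarrow> multiplicity s (q - 1) = multiplicity s t" "\<And>s. s \<in> P \<Longrightarrow> s \<le> T"
    and g: "\<And>s. s \<in> P \<Longrightarrow> g s < q \<and> primitive_root_of_unity F (root_of_unity_order s) (dec (g s))"
  shows "rad b \<noteq> 0 \<Longrightarrow> rad b < q \<and> dec (rad b) [^]\<^bsub>F\<^esub> r = dec b"
    and "\<alpha> \<in> carrier F \<Longrightarrow> \<alpha> [^]\<^bsub>F\<^esub> r = dec b \<Longrightarrow> rad b \<noteq> 0"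
proof -
  let ?z = "unity_root k prog w p d (encode_poly p f) r"
  have z: "?z < q" "primitive_root_of_unity F r (dec ?z)"
    using unity_root_correct[of k prog w r] g[OF r(3)] unfolding g_def by auto
  interpret R: radical p f r "bits q" b ?z
    by unfold_locales (use r b z less_two_power_bits in auto)
  have rad: "rad b = find_root fadd fmul (bits q) q r ?z (p - 1) T b (\<lambda>s _. g s)"
    by (simp add: rad_def g_def radical_of_def field_add_eq field_mul_eq)
  show "rad b \<noteq> 0 \<Longrightarrow> rad b < q \<and> dec (rad b) [^]\<^bsub>F\<^esub> r = dec b"
    unfolding rad by (rule R.find_root_sound)
  assume \<alpha>: "\<alpha> \<in> carrier F" "\<alpha> [^]\<^bsub>F\<^esub> r = dec b"
  interpret RR: radical_root p f r "bits q" b ?z \<alpha>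
    by unfold_locales (use \<alpha> in auto)
  show "rad b \<noteq> 0"
    unfolding rad by (rule RR.find_root_complete[OF t P]) (use g in auto)
qed

text \<open>Extracting roots repeatedly from a primitive \<open>r\<close>-th root of unity multiplies the order
  by \<open>r\<close> each time, so a nonresidue is reached after fewer than \<open>log q\<close> steps.\<close>

lemma iterated_roots:
  fixes rad :: "nat \<Rightarrow> nat"
  assumes r: "prime r" and z: "z < q" "primitive_root_of_unity F r (dec z)"
    and sound: "\<And>b. b < q \<Longrightarrow> dec b \<noteq> \<zero>\<^bsub>F\<^esub> \<Longrightarrow> rad b \<noteq> 0 \<Longrightarrow> rad b < q \<and> dec (rad b) [^]\<^bsub>F\<^esub> r = dec b"
    and complete: "\<And>b \<alpha>. b < q \<Longrightarrow> dec b \<noteq> \<zero>\<^bsub>F\<^esub> \<Longrightarrow> \<alpha> \<in> carrier F \<Longrightarrow> \<alpha> [^]\<^bsub>F\<^esub> r = dec b \<Longrightarrow> rad b \<noteq> 0"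
  defines "it \<equiv> \<lambda>i. loop i (\<lambda>_ b. if rad b \<noteq> 0 then rad b else b) z"
  shows "it i < q" and "dec (it (bits q)) \<in> nonresidues_of_power F r"
proof -
  interpret M: comm_group "mult_of F" by (rule F.units_comm_group[unfolded F.mult_of_is_Units[symmetric]])
  have r0: "r > 0" using r prime_gt_0_nat by simp
  let ?N = "nonresidues_of_power F r"
  have \<zeta>: "dec z \<in> carrier F" "dec z [^]\<^bsub>F\<^esub> r = \<one>\<^bsub>F\<^esub>" "dec z [^]\<^bsub>F\<^esub> (1::nat) \<noteq> \<one>\<^bsub>F\<^esub>"
    using z(2) prime_gt_1_nat[OF r] unfolding primitive_root_of_unity_def by auto
  \<comment> \<open>A nonresidue, once reached, is kept: extraction fails there and the value no
    longer changes. Otherwise \<open>i\<close> extractions have succeeded.\<close>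
  have inv: "it i < q \<and> dec (it i) \<noteq> \<zero>\<^bsub>F\<^esub> \<and> (dec (it i) \<in> ?N \<or> dec (it i) [^]\<^bsub>F\<^esub> (r ^ i) = dec z)" for i
  proof (induction i)
    case 0
    have "dec z \<noteq> \<zero>\<^bsub>F\<^esub>" using \<zeta>(2) F_pow_0[OF r0] F.one_not_zero by auto
    then show ?case using z \<zeta>(1) by (simp add: it_def)
  next
    case (Suc i)
    let ?b = "it i"
    have b: "?b < q" "dec ?b \<noteq> \<zero>\<^bsub>F\<^esub>" using Suc by auto
    have step: "it (Suc i) = (if rad ?b \<noteq> 0 then rad ?b else ?b)" by (simp add: it_def)
    have cl: "dec ?b \<in> carrier F" by (rule fq.code_closed[OF b(1)])
    show ?case
    proof (cases "rad ?b = 0")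
      case True
      then have "\<alpha> [^]\<^bsub>F\<^esub> r \<noteq> dec ?b" if "\<alpha> \<in> carrier F" for \<alpha>
        using complete[OF b that] by blast
      then have "dec ?b \<in> ?N"
        using cl b(2) unfolding nonresidues_of_power_def by (simp add: eq_commute)
      then show ?thesis using True step b by simp
    next
      case False
      have s: "rad ?b < q" "dec (rad ?b) [^]\<^bsub>F\<^esub> r = dec ?b" using sound[OF b False] by auto
      have c: "dec (rad ?b) \<in> carrier F" by (rule fq.code_closed[OF s(1)])
      have "dec ?b \<notin> ?N" using s(2)[symmetric] c unfolding nonresidues_of_power_def by blast
      then have "dec ?b [^]\<^bsub>F\<^esub> (r ^ i) = dec z" using Suc by blast
      then have "dec (rad ?b) [^]\<^bsub>F\<^esub> (r ^ Suc i) = dec z"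
        using s(2) c by (simp add: F.nat_pow_pow[symmetric])
      moreover have "dec (rad ?b) \<noteq> \<zero>\<^bsub>F\<^esub>" using s(2) b(2) F_pow_0[OF r0] by auto
      ultimately show ?thesis using False step s(1) by simp
    qed
  qed
  then show "it i < q" by blast
  let ?L = "bits q" and ?x = "dec (it (bits q))"
  have x: "?x \<in> carrier (mult_of F)" using inv[of ?L] fq.code_closed by auto
  \<comment> \<open>Equality would give \<open>?x\<close> the order r^(L+1), because its r^L-th
    power has order r; this exceeds q - 1.\<close>
  have "?x [^]\<^bsub>F\<^esub> (r ^ ?L) \<noteq> dec z"
  proof
    assume e: "?x [^]\<^bsub>F\<^esub> (r ^ ?L) = dec z"
    then have "?x [^]\<^bsub>F\<^esub> (r ^ Suc ?L) = \<one>\<^bsub>F\<^esub>"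
      using \<zeta>(2) x by (simp add: F.nat_pow_pow[symmetric] mult.commute[of r])
    then have o1: "M.ord ?x dvd r ^ Suc ?L" using x M.pow_eq_id[OF x, of "r ^ Suc ?L"] by (simp add: nat_pow_mult_of)
    have "\<not> M.ord ?x dvd r ^ ?L"
      using e \<zeta>(1,3) x M.pow_eq_id[OF x, of "r ^ ?L"] by (simp add: nat_pow_mult_of)
    moreover obtain i where i: "i \<le> Suc ?L" "M.ord ?x = r ^ i"
      using o1 divides_primepow_nat[OF r] by blast
    ultimately have "i = Suc ?L" by (metis le_Suc_eq le_imp_power_dvd)
    moreover have "M.ord ?x dvd q - 1"
      using F_pow[of ?x] x M.pow_eq_id[OF x, of "q - 1"] by (simp add: nat_pow_mult_of)
    ultimately have "r ^ Suc ?L \<le> q - 1" using i q_gt_1 by (intro dvd_imp_le) auto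
    moreover have "2 ^ ?L \<le> r ^ ?L" using prime_ge_2_nat[OF r] by (intro power_mono) auto
    moreover have "r ^ ?L \<le> r ^ Suc ?L" using r0 by simp
    ultimately show False using less_two_power_bits[of q] by linarith
  qed
  then show "?x \<in> ?N" using inv[of ?L] by blast
qed

end

definition instance_bits :: "nat list \<Rightarrow> nat" where
  "instance_bits xs = bits (xs ! 0 ^ xs ! 1)"

definition base_ctx :: "nat list set \<Rightarrow> nat \<Rightarrow> ctx" where
  "base_ctx I m = (I, instance_bits, (\<lambda>j. (j, \<lambda>xs. xs ! j)) ` {..<m})"

lemma base_ctx_polytime:
  assumes j: "j < m" and B: "pbd (base_ctx I m) B" "\<And>xs. xs \<in> I \<Longrightarrow> bits (xs ! j) \<le> B xs"
  shows "polytime (base_ctx I m) (\<lambda>xs. xs ! j)"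
proof (rule polytime_stored)
  show "(j, \<lambda>xs. xs ! j) \<in> stored (base_ctx I m)" using j by (simp add: base_ctx_def stored_def)
  show "pbd (base_ctx I m) (\<lambda>xs. bits (xs ! j))"
    using B(1) by (rule poly_bounded_mono) (use B(2) in \<open>simp add: base_ctx_def insts_def\<close>)
qed

lemma base_ctx_unary:
  assumes j: "j < m" and B: "pbd (base_ctx I m) B" "\<And>xs. xs \<in> I \<Longrightarrow> xs ! j \<le> B xs"
  shows "unary (base_ctx I m) (\<lambda>xs. xs ! j)"
  unfolding unary_def
proof
  show "pbd (base_ctx I m) (\<lambda>xs. xs ! j)"
    using B(1) by (rule poly_bounded_mono) (use B(2) in \<open>simp add: base_ctx_def insts_def\<close>)
  show "polytime (base_ctx I m) (\<lambda>xs. xs ! j)"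
    by (rule base_ctx_polytime[OF j B(1)]) (use B(2) bits_le_self order_trans in blast)
qed

lemma pbd_instance_bits: "pbd (base_ctx I m) instance_bits"
  using poly_bounded_size[of I instance_bits] by (simp add: base_ctx_def insts_def size_of_def)

lemma multiplicity_cofactor:
  fixes A :: "nat set"
  assumes A: "finite A" "\<And>r. r \<in> A \<Longrightarrow> prime r" and s: "prime s" "s \<notin> A" and t: "t > 0"
  shows "multiplicity s ((\<Prod>r\<in>A. r ^ e r) * t) = multiplicity s t"
proof -
  have "\<not> s dvd (\<Prod>r\<in>A. r ^ e r)"
  proof
    assume "s dvd (\<Prod>r\<in>A. r ^ e r)"
    then obtain r where r: "r \<in> A" "s dvd r ^ e r" using s(1) A(1) by (auto simp: prime_dvd_prod_iff)
    then have "s dvd r" using s(1) prime_dvd_power by blast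
    then have "s = r" using s(1) A(2)[OF r(1)] by (simp add: primes_dvd_imp_eq)
    then show False using r(1) s(2) by simp
  qed
  then have "multiplicity s (\<Prod>r\<in>A. r ^ e r) = 0" by (rule not_dvd_imp_multiplicity_0)
  moreover have "(\<Prod>r\<in>A. r ^ e r) \<noteq> 0"
    using A by (auto simp: prod_zero_iff dest: prime_gt_0_nat)
  ultimately show ?thesis using s(1) t by (simp add: prime_elem_multiplicity_mult_distrib)
qed

text \<open>The constants of the bounds and the program for roots of unity are built into the new
  programs. The sets \<open>R q\<close> and the cofactors \<open>t q\<close> are never computed:
  bounds obtained from \<open>p\<close> and the degree alone replace them.\<close>

theorem theorem2p1:
  fixes Q :: "nat set"
    and R :: "nat \<Rightarrow> nat set"
    and e :: "nat \<Rightarrow> nat \<Rightarrow> nat"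
    and t :: "nat \<Rightarrow> nat"
    and Ks :: "(nat \<times> int poly) set"
  assumes prime_powers: "\<And>q. q \<in> Q \<Longrightarrow> primepow q"
    and primes: "\<And>q. q \<in> Q \<Longrightarrow> finite (R q) \<and> R q \<noteq> {} \<and> (\<forall>r\<in>R q. prime r \<and> e q r \<ge> 1)"
    and cofactor: "\<And>q. q \<in> Q \<Longrightarrow> t q \<ge> 1 \<and> gcd (\<Prod>r\<in>R q. r) (t q) = 1"
    and representation: "\<And>q. q \<in> Q \<Longrightarrow> q = (\<Prod>r\<in>R q. r ^ e q r) * t q + 1"
    and small: "\<exists>(C::real) (d::nat). \<forall>q\<in>Q. real ((\<Sum>r\<in>R q. r) + t q) \<le> C * log 2 (real q) ^ d"
    and fields: "\<And>K. K \<in> Ks \<Longrightarrow> field_presentation K"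
    and sizes: "field_size ` Ks = Q"
    and roots_of_unity: "roots_of_unity_polytime Ks R"
  shows "taking_roots_polytime Ks R \<and> nonresidues_polytime Ks R"
proof -
  obtain C1 :: real and d1 :: nat where
    small: "\<forall>q\<in>Q. real ((\<Sum>r\<in>R q. r) + t q) \<le> C1 * log 2 (real q) ^ d1"
    using small by blast
  obtain prog and C0 :: real and d0 :: nat where
    prog: "\<forall>i\<in>{(K, r). K \<in> Ks \<and> r \<in> R (field_size K)}. \<exists>n s.
      exec prog (input ((\<lambda>(K, r). encode_field K @ [r]) i)) n s \<and>
      real n \<le> C0 * ((\<lambda>(K, r). log 2 (real (field_size K))) i) ^ d0 \<and>
      s 0 \<in> (\<lambda>(K, r). encode_poly (fst K) `
        {\<zeta>. primitive_root_of_unity (Fq K) (root_of_unity_order r) \<zeta>}) i"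
    using roots_of_unity unfolding roots_of_unity_polytime_def polytime_solvable_def by blast
  obtain k where k: "4 \<le> k" "program_below k prog" using program_below_exists by blast
  define c0 where "c0 = nat \<lceil>C0\<rceil>"
  define c1 where "c1 = nat \<lceil>C1\<rceil>"
  define T where "T = (\<lambda>xs. c1 * instance_bits xs ^ d1)"
  \<comment> \<open>The clock is the sum of the running time of \<open>prog\<close>, the length 2
    \<open>bits q\<close> available for the code of \<open>f\<close>, and \<open>T\<close>, which
    ensures s < 2^W for the primes s.\<close>
  define W where "W = (\<lambda>xs. c0 * instance_bits xs ^ d0 + (instance_bits xs + instance_bits xs + T xs))"
  define rad where "rad = (\<lambda>xs b. radical_of k prog (W xs) (T xs) (xs ! 0) (xs ! 1) (xs ! 2) (xs ! 3) b)"
  define root where "root = (\<lambda>xs. unity_root k prog (W xs) (xs ! 0) (xs ! 1) (xs ! 2) (xs ! 3))"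
  \<comment> \<open>Both problems encode the field and \<open>r\<close> in the entries 0 to 3, so
    all facts about them are proved once, for any such list.\<close>
  define valid where "valid = (\<lambda>xs p f r. (p, f) \<in> Ks \<and> r \<in> R (field_size (p, f)) \<and>
    xs ! 0 = p \<and> xs ! 1 = degree f \<and> xs ! 2 = encode_poly p f \<and> xs ! 3 = r)"

  have pres: "presented p f" if "(p, f) \<in> Ks" for p f
    using fields[OF that] by unfold_locales
  have Q: "field_size (p, f) \<in> Q" "field_size (p, f) = p ^ degree f" if "(p, f) \<in> Ks" for p f
    using that sizes presented.field_size_eq[OF pres[OF that]] by blast+

  have facts: "presented p f \<and> instance_bits xs = bits (p ^ degree f) \<and> r \<le> T xs \<and> prime r \<and>
      root xs < p ^ degree f \<and> primitive_root_of_unity (Fq (p, f)) r (presented.dec p f (root xs)) \<and>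
      (\<forall>b. b < p ^ degree f \<longrightarrow> presented.dec p f b \<noteq> \<zero>\<^bsub>Fq (p, f)\<^esub> \<longrightarrow>
        (rad xs b \<noteq> 0 \<longrightarrow> rad xs b < p ^ degree f \<and>
          presented.dec p f (rad xs b) [^]\<^bsub>Fq (p, f)\<^esub> r = presented.dec p f b) \<and>
        (\<forall>\<alpha>\<in>carrier (Fq (p, f)). \<alpha> [^]\<^bsub>Fq (p, f)\<^esub> r = presented.dec p f b \<longrightarrow> rad xs b \<noteq> 0))"
    if v: "valid xs p f r" for xs p f r
  proof -
    have K: "(p, f) \<in> Ks" and r: "r \<in> R (field_size (p, f))"
      and xs: "xs ! 0 = p" "xs ! 1 = degree f" "xs ! 2 = encode_poly p f" "xs ! 3 = r"
      using v by (auto simp: valid_def)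
    interpret presented p f by (rule pres[OF K])
    have qQ: "q \<in> Q" and fs: "field_size (p, f) = q" using Q[OF K] by simp_all
    note r = r[unfolded fs]
    have ib: "instance_bits xs = bits q" by (simp only: instance_bits_def xs)
    have q2: "q \<ge> 2" using q_gt_1 by simp
    have fin: "finite (R q)" and pr: "\<And>s. s \<in> R q \<Longrightarrow> prime s \<and> e q s \<ge> 1" using primes[OF qQ] by auto
    have tq: "t q > 0" using cofactor[OF qQ] by simp
    have sm: "(\<Sum>r\<in>R q. r) + t q \<le> T xs"
      unfolding T_def c1_def ib using small qQ by (intro poly_log_le[OF q2]) blast
    have sT: "s \<le> T xs" if "s \<in> R q" for s
      using sm member_le_sum[OF that, of "\<lambda>x. x"] fin by simp
    have rep: "q - 1 = (\<Prod>r\<in>R q. r ^ e q r) * t q" using representation[OF qQ] by simp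
    have rdvd: "r dvd q - 1"
    proof -
      have "r dvd r ^ e q r" using pr[OF r] by (intro dvd_power) auto
      also have "\<dots> dvd (\<Prod>r\<in>R q. r ^ e q r)" using fin r by (rule dvd_prodI)
      finally show ?thesis unfolding rep by simp
    qed
    have mult: "multiplicity s (q - 1) = multiplicity s (t q)" if "prime s" "s \<notin> R q" for s
      unfolding rep using fin pr that tq by (intro multiplicity_cofactor) auto
    let ?g = "\<lambda>s. guess k prog (W xs) p d (encode_poly p f) s"
    have g: "?g s < q \<and> primitive_root_of_unity F (root_of_unity_order s) (dec (?g s))" if s: "s \<in> R q" for s
    proof -
      have "((p, f), s) \<in> {(K, r). K \<in> Ks \<and> r \<in> R (field_size K)}" using K s fs by simp
      from bspec[OF prog this] obtain n u where nu: "exec prog (input [p, d, encode_poly p f, s]) n u"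
        "real n \<le> C0 * log 2 (real q) ^ d0"
        "u 0 \<in> encode_poly p ` {\<zeta>. primitive_root_of_unity F (root_of_unity_order s) \<zeta>}"
        by (auto simp: encode_field_def fs)
      obtain x where x: "u 0 = encode_poly p x" "primitive_root_of_unity F (root_of_unity_order s) x"
        using nu(3) by blast
      have xc: "x \<in> carrier F" using x(2) by (simp add: primitive_root_of_unity_def)
      have "n \<le> W xs" using poly_log_le[OF q2 nu(2)] by (simp add: W_def c0_def ib)
      moreover have "bits q + bits q \<le> W xs" by (simp add: W_def ib)
      moreover have "s < 2 ^ W xs"
      proof -
        have "s \<le> W xs" using sT[OF s] by (simp add: W_def)
        also have "\<dots> < 2 ^ W xs" by (rule less_exp)
        finally show ?thesis .
      qed
      ultimately show ?thesis
        using guess_correct[OF nu(1) _ k(2,1) _ _ x(1) xc, of "W xs"] x(2) by simp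
    qed
    have root: "root xs < q" "primitive_root_of_unity F r (dec (root xs))"
      unfolding root_def xs using unity_root_correct[of k prog "W xs" r] g[OF r] by auto
    have "(rad xs b \<noteq> 0 \<longrightarrow> rad xs b < q \<and> dec (rad xs b) [^]\<^bsub>F\<^esub> r = dec b) \<and>
        (\<forall>\<alpha>\<in>carrier F. \<alpha> [^]\<^bsub>F\<^esub> r = dec b \<longrightarrow> rad xs b \<noteq> 0)" if b: "b < q" "dec b \<noteq> \<zero>\<^bsub>F\<^esub>" for b
    proof (intro conjI impI ballI)
      have c: "prime r" "t q \<le> T xs" using pr[OF r] sm by auto
      show "rad xs b < q" "dec (rad xs b) [^]\<^bsub>F\<^esub> r = dec b" if "rad xs b \<noteq> 0"
      proof -
        have "rad xs b < q \<and> dec (rad xs b) [^]\<^bsub>F\<^esub> r = dec b"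
          unfolding rad_def xs
          by (rule radical_of_correct(1)[of r "R q" b "t q" "T xs" k prog "W xs"]; fact c rdvd r b tq mult sT g
              that[unfolded rad_def xs])
        then show "rad xs b < q" "dec (rad xs b) [^]\<^bsub>F\<^esub> r = dec b" by auto
      qed
      show "rad xs b \<noteq> 0" if "\<alpha> \<in> carrier F" "\<alpha> [^]\<^bsub>F\<^esub> r = dec b" for \<alpha>
        unfolding rad_def xs
        by (rule radical_of_correct(2)[of r "R q" b "t q" "T xs" k prog "W xs"]; fact)
    qed
    then show ?thesis using presented_axioms ib sT[OF r] pr[OF r] root by blast
  qed

  have ctx: "unary (base_ctx I m) instance_bits" "unary (base_ctx I m) T" "unary (base_ctx I m) W"
    "polytime (base_ctx I m) (\<lambda>xs. xs ! 0)" "unary (base_ctx I m) (\<lambda>xs. xs ! 1)"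
    "polytime (base_ctx I m) (\<lambda>xs. xs ! 2)" "unary (base_ctx I m) (\<lambda>xs. xs ! 3)"
    if I: "\<And>xs. xs \<in> I \<Longrightarrow> \<exists>p f r. valid xs p f r" and m: "4 \<le> m" for I m
  proof -
    note ib = pbd_instance_bits[of I m]
    have b: "bits (xs ! 0) \<le> instance_bits xs \<and> xs ! 1 \<le> instance_bits xs \<and>
        bits (xs ! 2) \<le> instance_bits xs + instance_bits xs \<and> xs ! 3 \<le> T xs" if xs: "xs \<in> I" for xs
    proof -
      obtain p f r where v: "valid xs p f r" using I[OF xs] by blast
      then interpret presented p f using facts by blast
      show ?thesis
        using facts[OF v] v bits_input_bounds d_le_bits by (simp add: valid_def)
    qed
    show 0: "polytime (base_ctx I m) (\<lambda>xs. xs ! 0)"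
      by (rule base_ctx_polytime[OF _ ib]) (use m b in auto)
    show 1: "unary (base_ctx I m) (\<lambda>xs. xs ! 1)"
      by (rule base_ctx_unary[OF _ ib]) (use m b in auto)
    show "polytime (base_ctx I m) (\<lambda>xs. xs ! 2)"
      by (rule base_ctx_polytime[OF _ poly_bounded_add[OF ib ib]]) (use m b in auto)
    show 2: "unary (base_ctx I m) instance_bits"
      unfolding instance_bits_def by (intro unary_bits polytime_power 0 1)
    show 3: "unary (base_ctx I m) T"
      unfolding T_def by (intro unary_mult unary_const unary_power_const 2)
    show "unary (base_ctx I m) W"
      unfolding W_def by (intro unary_add unary_mult unary_const unary_power_const 2 3)
    show "unary (base_ctx I m) (\<lambda>xs. xs ! 3)"
      by (rule base_ctx_unary[OF _ unaryD(2)[OF 3]]) (use m b in auto)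
  qed

  \<comment> \<open>The factor 4 comes from \<open>bits q\<close> \<le> log q + 1 and log q \<ge>
    1.\<close>
  have size: "real (bits (field_size (p, f))) + 2 \<le> 4 * log 2 (real (field_size (p, f)))" if "(p, f) \<in> Ks" for p f
  proof -
    have "2 \<le> field_size (p, f)"
      using presented.q_gt_1[OF pres[OF that]] Q(2)[OF that] by simp
    from bits_log(2,3)[OF this] show ?thesis by linarith
  qed

  have "taking_roots_polytime Ks R"
    unfolding taking_roots_polytime_def
  proof (rule polytime_solvableI[where k = 5 and S = instance_bits and f = "\<lambda>xs. rad xs (xs ! 4)" and c = 4])
    let ?I = "{(K, r, \<beta>). K \<in> Ks \<and> r \<in> R (field_size K) \<and> \<beta> \<in> residues_of_power (Fq K) r}"
    let ?enc = "\<lambda>(K, r, \<beta>). encode_field K @ [r, encode_poly (fst K) \<beta>]"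
    have val: "valid (?enc ((p, f), r, \<beta>)) p f r" if "((p, f), r, \<beta>) \<in> ?I" for p f r \<beta>
      using that by (simp add: valid_def encode_field_def)
    have I: "\<exists>p f r. valid xs p f r \<and> bits (xs ! 4) \<le> instance_bits xs" if xs: "xs \<in> ?enc ` ?I" for xs
    proof -
      obtain p f r \<beta> where i: "((p, f), r, \<beta>) \<in> ?I" "xs = ?enc ((p, f), r, \<beta>)" using xs by auto
      interpret presented p f using i(1) pres by simp
      have "\<beta> \<in> carrier F" using i(1) by (simp add: residues_of_power_def)
      then have "xs ! 4 < q" using carrier_coded(1) by (simp add: i(2) encode_field_def)
      then have "bits (xs ! 4) \<le> instance_bits xs"
        using facts[OF val[OF i(1)]] bits_mono i(2) by (metis less_imp_le)
      then show ?thesis using val[OF i(1)] i(2) by blast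
    qed
    let ?C = "base_ctx (?enc ` ?I) 5"
    have "polytime ?C (\<lambda>xs. xs ! 4)"
      by (rule base_ctx_polytime[OF _ pbd_instance_bits]) (use I in auto)
    then have "polytime ?C (\<lambda>xs. rad xs (xs ! 4))"
      unfolding rad_def by (intro polytime_radical_of ctx) (use I in \<open>blast, simp\<close>)+
    then show "polytime (?enc ` ?I, instance_bits, (\<lambda>j. (j, \<lambda>xs. xs ! j)) ` {..<5}) (\<lambda>xs. rad xs (xs ! 4))"
      by (simp only: base_ctx_def)
    fix i assume i: "i \<in> ?I"
    obtain p f r \<beta> where i_eq: "i = ((p, f), r, \<beta>)" by (metis prod.exhaust)
    note i = i[unfolded i_eq]
    interpret presented p f using i pres by simp
    let ?xs = "?enc ((p, f), r, \<beta>)"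
    note fa = facts[OF val[OF i]]
    show "length (?enc i) = 5" by (simp add: i_eq encode_field_def)
    show "real (instance_bits (?enc i)) + 2 \<le> 4 * (\<lambda>(K, r, \<beta>). log 2 (real (field_size K))) i"
      using fa size[of p f] i by (simp add: i_eq field_size_eq)
    have \<beta>: "\<beta> \<in> carrier F" "\<beta> \<noteq> \<zero>\<^bsub>F\<^esub>" and "\<exists>\<alpha>\<in>carrier F. \<beta> = \<alpha> [^]\<^bsub>F\<^esub> r"
      using i by (auto simp: residues_of_power_def)
    then obtain \<alpha> where \<alpha>: "\<alpha> \<in> carrier F" "\<alpha> [^]\<^bsub>F\<^esub> r = \<beta>" by metis
    note c = carrier_coded[OF \<beta>(1)]
    have "dec (encode_poly p \<beta>) \<noteq> \<zero>\<^bsub>F\<^esub>" using \<beta>(2) by (simp only: c(2) not_False_eq_True)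
    with fa c(1) have sound: "rad ?xs (encode_poly p \<beta>) \<noteq> 0 \<longrightarrow> rad ?xs (encode_poly p \<beta>) < q \<and>
          dec (rad ?xs (encode_poly p \<beta>)) [^]\<^bsub>F\<^esub> r = dec (encode_poly p \<beta>)"
      and complete: "\<forall>\<alpha>\<in>carrier F. \<alpha> [^]\<^bsub>F\<^esub> r = dec (encode_poly p \<beta>) \<longrightarrow> rad ?xs (encode_poly p \<beta>) \<noteq> 0"
      by blast+
    have "rad ?xs (encode_poly p \<beta>) \<noteq> 0" using complete \<alpha> unfolding c(2) by blast
    with sound have *: "rad ?xs (encode_poly p \<beta>) < q" "dec (rad ?xs (encode_poly p \<beta>)) [^]\<^bsub>F\<^esub> r = \<beta>"
      unfolding c(2) by blast+
    have x4: "?xs ! 4 = encode_poly p \<beta>" by (simp add: encode_field_def)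
    have "rad ?xs (?xs ! 4) \<in> encode_poly p ` {\<alpha> \<in> carrier F. \<alpha> [^]\<^bsub>F\<^esub> r = \<beta>}"
      unfolding x4
    proof (rule image_eqI)
      show "rad ?xs (encode_poly p \<beta>) = encode_poly p (dec (rad ?xs (encode_poly p \<beta>)))"
        by (rule encode_dec[OF *(1), symmetric])
      show "dec (rad ?xs (encode_poly p \<beta>)) \<in> {\<alpha> \<in> carrier F. \<alpha> [^]\<^bsub>F\<^esub> r = \<beta>}"
        using * fq.code_closed by blast
    qed
    then show "rad (?enc i) (?enc i ! 4) \<in> (\<lambda>(K, r, \<beta>). encode_poly (fst K) ` {\<alpha> \<in> carrier (Fq K). \<alpha> [^]\<^bsub>Fq K\<^esub> r = \<beta>}) i"
      by (simp add: i_eq)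
  qed simp

  moreover have "nonresidues_polytime Ks R"
    unfolding nonresidues_polytime_def
  proof (rule polytime_solvableI[where k = 4 and S = instance_bits and c = 4 and
        f = "\<lambda>xs. loop (instance_bits xs) (\<lambda>_ b. if rad xs b \<noteq> 0 then rad xs b else b) (root xs)"])
    let ?I = "{(K, r). K \<in> Ks \<and> r \<in> R (field_size K)}"
    let ?enc = "\<lambda>(K, r). encode_field K @ [r]"
    let ?F = "\<lambda>xs (_::nat) b. if rad xs b \<noteq> 0 then rad xs b else b"
    have val: "valid (?enc ((p, f), r)) p f r" if "((p, f), r) \<in> ?I" for p f r
      using that by (simp add: valid_def encode_field_def)
    have I: "\<exists>p f r. valid xs p f r" if xs: "xs \<in> ?enc ` ?I" for xs
      using xs val by fast
    have it: "loop j (?F xs) (root xs) < p ^ degree f"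
      "presented.dec p f (loop (bits (p ^ degree f)) (?F xs) (root xs)) \<in> nonresidues_of_power (Fq (p, f)) r"
      if v: "valid xs p f r" for xs p f r j
    proof -
      note fa = facts[OF v]
      interpret presented p f using fa by blast
      show "loop j (?F xs) (root xs) < q"
        by (rule iterated_roots(1)[of r]) (use fa in blast)+
      show "dec (loop (bits q) (?F xs) (root xs)) \<in> nonresidues_of_power F r"
        by (rule iterated_roots(2)[of r]) (use fa in blast)+
    qed
    let ?C = "base_ctx (?enc ` ?I) 4"
    note ctx = ctx[OF I order_refl]
    have "polytime ?C (\<lambda>xs. loop (instance_bits xs) (?F xs) (root xs))"
    \<comment> \<open>All iterates are codes below q, which bounds the accumulator.\<close>
    proof (rule polytime_loop[OF ctx(1) _ pbd_instance_bits])
      show "polytime ?C root"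
        unfolding root_def by (intro polytime_unity_root ctx)
      show "bits (loop j (?F xs) (root xs)) \<le> instance_bits xs" if "xs \<in> insts ?C" for xs j
      proof -
        have "xs \<in> ?enc ` ?I" using that by (simp add: base_ctx_def insts_def)
        then obtain p f r where v: "valid xs p f r" using I by blast
        show ?thesis using bits_mono[OF less_imp_le[OF it(1)[OF v]]] facts[OF v] by simp
      qed
      fix C' assume C': "extends ?C instance_bits C'" "polytime C' (\<lambda>ys. loop (hd ys) (?F (tl ys)) (root (tl ys)))"
      show "polytime C' (\<lambda>ys. ?F (tl ys) (hd ys) (loop (hd ys) (?F (tl ys)) (root (tl ys))))"
        unfolding rad_def
        by (intro polytime_if_nonzero polytime_radical_of unary_lift[OF C'(1)] polytime_lift[OF C'(1)] ctx
            C'(2)[unfolded rad_def])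
    qed
    then show "polytime (?enc ` ?I, instance_bits, (\<lambda>j. (j, \<lambda>xs. xs ! j)) ` {..<4})
        (\<lambda>xs. loop (instance_bits xs) (?F xs) (root xs))"
      by (simp only: base_ctx_def)
    fix i assume i: "i \<in> ?I"
    obtain p f r where i_eq: "i = ((p, f), r)" by (metis prod.exhaust)
    note i = i[unfolded i_eq]
    interpret presented p f using i pres by simp
    let ?xs = "?enc ((p, f), r)"
    note fa = facts[OF val[OF i]]
    show "length (?enc i) = 4" by (simp add: i_eq encode_field_def)
    show "real (instance_bits (?enc i)) + 2 \<le> 4 * (\<lambda>(K, r). log 2 (real (field_size K))) i"
      using fa size[of p f] i by (simp add: i_eq field_size_eq)
    have "loop (instance_bits ?xs) (?F ?xs) (root ?xs) \<in> encode_poly p ` nonresidues_of_power F r"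
    proof (rule image_eqI)
      have ib: "instance_bits ?xs = bits q" using fa by blast
      show "loop (instance_bits ?xs) (?F ?xs) (root ?xs) = encode_poly p (dec (loop (instance_bits ?xs) (?F ?xs) (root ?xs)))"
        by (rule encode_dec[OF it(1)[OF val[OF i]], symmetric])
      show "dec (loop (instance_bits ?xs) (?F ?xs) (root ?xs)) \<in> nonresidues_of_power F r"
        unfolding ib by (rule it(2)[OF val[OF i]])
    qed
    then show "loop (instance_bits (?enc i)) (?F (?enc i)) (root (?enc i)) \<in>
        (\<lambda>(K, r). encode_poly (fst K) ` nonresidues_of_power (Fq K) r) i"
      by (simp only: i_eq prod.case fst_conv)
  qed simp
  ultimately show ?thesis by blast
qed

end
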